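(* Let $G$ be a hyperbolic group and let $(K_i,f_i)_{i\ge0}$ be the Markov system representing $\partial G$ constructed as described in the context, with the associated homeomorphism $\varphi:\partial G\to\varprojlim K_i$. Then the quasi-conformal structures on $\partial G$ and $\varprojlim K_i$ (identified by $\varphi$), defined respectively by the visual metrics $\{d_v^{(a)}\}$ and the simplicial metrics $\{d^M_a\}$ (for sufficiently small values of $a>1$), coincide. More precisely, for $a>1$ sufficiently close to $1$, the metric spaces $(\partial G, d_v^{(a)})$ and $(\varprojlim K_i, d^M_a)$ are bi-Lipschitz equivalent.
   Context: **Group.** $G$ is hyperbolic with a fixed finite generating set closed under inverses, enumerated $s_1,\dots,s_Q$; $d$ is the word metric, $|x|=d(x,e)$; geodesics are isometric embeddings of intervals of $\mathbb Z$ into $G$. $\delta\ge1$ is such that the Cayley graph is $\delta$-hyperbolic (in particular each side of a geodesic triangle with vertices in $G\cup\partial G$, $p$ of them in $\partial G$, lies in the $4(p+1)\delta$-neighbourhood of the union of the other two sides). **Visual metrics.** For $p\ne q\in\partial G$, $d_a(p,q)=a^{-l}$, where $l$ is the largest distance from $e$ to a bi-infinite geodesic joining $p$ with $q$; $d_a(p,p)=0$. For $a>1$ close to $1$ the visual metric $d_v^{(a)}$ is a metric on $\partial G$ which is bi-Lipschitz equivalent to $d_a$. Two metrics define the same quasi-conformal structure if the identity map between them is quasisymmetric: for some homeomorphism $\eta$ of $[0,\infty)$, $d(x,y)\le t\,d(x,z)$ implies $d'(x,y)\le\eta(t)d'(x,z)$. **Simplicial metrics.** On a finite simplicial complex $K$,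 $d_K$ is the $\ell^1$ metric of barycentric coordinates (vertices sent to distinct standard basis vectors of $\mathbb R^m$, extended affinely). For $a>1$, $d^M_a((x_i),(y_i))=\sum_{i\ge0}a^{-i}d_{K_i}(x_i,y_i)$ on $\varprojlim K_i$. **Types.** $T^c(x)$ (cone type) is the set of $y\in G$ such that some geodesic from $e$ to $xy$ passes through $x$. $T^b_N(x)$ (ball $N$-type) is the function $y\mapsto|xy|-|x|$ on $B_N(e)=\{y\in G:|y|\le N\}$. $N_0$ is a constant such that for $N\ge N_0$ equality of ball $N$-types implies equality of cone types. Let $R=\max(\{|g^n|: |g|\le16\delta,\ g \text{ torsion},\ n\in\mathbb Z\}\cup\{16\delta\})$. Constants $N$ and $L\in\mathbb N$ are fixed and sufficiently large: $N\ge 2N_0+8\delta+2$, $N\geq N_0+77\delta$, $N$ so large that $|h|\le16\delta$, $|gh|=|g|$, $T^b_N(gh)=T^b_N(g)$ imply that $h$ is torsion; $L\ge\max(N+4\delta,14\delta,R/2+4\delta)$. For $y\ne e$, $y^\uparrow=ys_i$ with $i$ least such that $|ys_i|=|y|-1$; $y^{\uparrow k}$ is the $k$-fold iterate, $y^{\Uparrow k}=y^{\uparrow Lk}$ (for $|y|\ge Lk$), $y^\Uparrow=y^{\Uparrow1}$; the p-grandchildren of $x$ are the $y$ with $y^\Uparrow=x$. $T^Z(g)=T^b_N(g)$ for $|g|\ge L$, while elements of length $<L$ receive pairwise distinct $T^Z$-values which are not ball $N$-types. For each value $\tau$ of $T^Z$ fix $g_\tau$ of that type and an enumeration of the p-grandchildren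 of $g_\tau$; for $|g|\ge L$, with $h=g^\Uparrow$ and $\tau=T^Z(h)$, $n_g$ is the number of $g_\tau h^{-1}g$ (which is a p-grandchild of $g_\tau$); $n_g=0$ if $|g|<L$. $T^A(g)=(T^Z(g),n_g)$. Let $C_g=\{g':|g'|=|g|,d(g,g')\le R\}$; for distinct $g',g''\in C_g$ let $k_{g',g''}$ be the least $k\ge0$ with $T^A(g'^{\Uparrow k})\ne T^A(g''^{\Uparrow k})$; let $(k^{(g)}_i)_{i=1}^{M_g}$ be the decreasing arrangement of $\{k_{g',g''}\}\cup\{0\}$. $T^B(g)=\{(g^{-1}g',W_{g,g'}):g'\in C_g\}$ with $W_{g,g'}=(T^A(g'^{\Uparrow k^{(g)}_i}))_{i=1}^{M_g}$. Finally, with $P_r(g)=\{h:|gh|=|g|,|h|\le r\}$, $T^B_\theta(g)$ is the function $h\mapsto T^B(gh)$ on $P_{12\theta\delta}(g)$. **The construction.** $\operatorname{span}(g)$ is the set of $x\in\partial G$ such that some geodesic from $e$ to $x$ passes through $g$; $S_g$ is the interior in $\partial G$ of the union of all $\operatorname{span}(gh)$ with $|gh|=|g|$ and $\operatorname{span}(gh)\cap\operatorname{span}(g)\ne\emptyset$. Let $k=\dim\partial G$. $\mathcal E=\{E_x\}_{x\in G}$ is a family of open subsets of $\partial G$ with $E_x\subseteq S_x$; $E_{gx}=g\cdot E_x$ whenever $T^B_{3k+4}(x)=T^B_{3k+4}(gx)$; and, for each $n$, $\mathcal E_n=\{E_x:|x|=n\}$ covers $\partial G$ and any $k+2$ pairwise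 distinct members of $\mathcal E_n$ have empty intersection. (Such $\mathcal E$ exists and is a quasi-$G$-invariant system of covers with type function $T^B_{3k+5}$, i.e. with $T=T^B_{3k+5}$ there are $D,J>0$ such that: diameters of members of $\mathcal E_n$ tend uniformly to $0$; $|x|=|y|$, $E_x\cap E_y\ne\emptyset$ imply $d(x,y)\le D$; for every integer $m$ with $0<m\le|x|/J$ there is $y$ with $|y|=|x|-mJ$, $E_y\supseteq E_x$; and if $T(x)=T(gx)$ then $E_{gx}=gE_x$, and $E_{gy}=gE_y$, $|gy|=|gx|$ for all $|y|=|x|$ with $E_x\cap E_y\ne\emptyset$, and $|gy|=|gx|+mJ$, $T(gy)=T(y)$ for all $y$ with $|y|=|x|+mJ$, $m>0$, $\emptyset\ne E_y\subseteq E_x$.) Let $\widetilde{\mathcal E}_n$ be the set of non-empty members of $\mathcal E_n$. The step $\ell$ is a positive integer for which the sequence of covers $(\widetilde{\mathcal E}_{n\ell})_{n\ge0}$ is admissible, meaning: each $\widetilde{\mathcal E}_{n\ell}$ is a finite open cover without empty members; the maximal number of its members with non-empty intersection is bounded independently of $n$; the maximal diameter of its members tends to $0$ as $n\to\infty$; and for every $n>0$ and $U\in\widetilde{\mathcal E}_{n\ell}$ some $V\in\widetilde{\mathcal E}_{(n-1)\ell}$ contains the union of all $U'\in\widetilde{\mathcal E}_{n\ell}$ meeting $U$. (Such $\ell$ exists.) $K_i$ is the nerve of $\widetilde{\mathcal E}_{i\ell}$ with vertices $v_U$, and $f_i:K_{i+1}\to K_i$ is affine on simplexes with $f_i(v_U)$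 the barycentre of the simplex spanned by $\{v_V:V\in\widetilde{\mathcal E}_{i\ell},V\supseteq U\}$. $\varphi(x)$ is the unique point of $\varprojlim K_i$ whose $i$-th coordinate lies, for every $i$, in the simplex spanned by $\{v_U:U\in\widetilde{\mathcal E}_{i\ell},x\in U\}$.
   Formalization: The bi-Lipschitz equivalence is stated between d_v^(a) and d^M with parameter a^ℓ, where ℓ is the step of the covers, instead of the same a; with the same a the claim fails for ℓ ≥ 2 (e.g. the free group F_2 with E_x = span(x)). *)

theory Defs
  imports "HOL-Analysis.Analysis" "HOL-Algebra.Generated_Groups"
begin

section \<open>Metric comparison and dimension\<close>

definition bilipschitz :: "'a set \<Rightarrow> ('a \<Rightarrow> 'a \<Rightarrow> real) \<Rightarrow> 'b set \<Rightarrow> ('b \<Rightarrow> 'b \<Rightarrow> real) \<Rightarrow> ('a \<Rightarrow> 'b) \<Rightarrow> bool"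
  where "bilipschitz M d M' d' f \<longleftrightarrow>
    bij_betw f M M' \<and>
    (\<exists>C\<ge>1. \<forall>x\<in>M. \<forall>y\<in>M. d x y / C \<le> d' (f x) (f y) \<and> d' (f x) (f y) \<le> C * d x y)"

text \<open>The identity map from \<open>(M, d)\<close> to \<open>(M, d')\<close> is quasisymmetric.\<close>

definition same_quasiconformal :: "'a set \<Rightarrow> ('a \<Rightarrow> 'a \<Rightarrow> real) \<Rightarrow> ('a \<Rightarrow> 'a \<Rightarrow> real) \<Rightarrow> bool"
  where "same_quasiconformal M d d' \<longleftrightarrow>
    (\<exists>\<eta> \<eta>'. homeomorphism {0..} {0..} \<eta> \<eta>' \<and>
      (\<forall>x\<in>M. \<forall>y\<in>M. \<forall>z\<in>M. \<forall>t\<ge>0::real. d x y \<le> t * d x z \<longrightarrow> d' x y \<le> \<eta> t * d' x z))"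

text \<open>Lebesgue covering dimension, with value \<open>-1\<close> exactly for the empty space.\<close>

definition covering_dim_le :: "'a topology \<Rightarrow> int \<Rightarrow> bool"
  where "covering_dim_le X n \<longleftrightarrow>
    (\<forall>\<U>. finite \<U> \<and> (\<forall>U\<in>\<U>. openin X U) \<and> \<Union>\<U> = topspace X \<longrightarrow>
      (\<exists>\<V>. finite \<V> \<and> (\<forall>V\<in>\<V>. openin X V) \<and> \<Union>\<V> = topspace X \<and>
        (\<forall>V\<in>\<V>. \<exists>U\<in>\<U>. V \<subseteq> U) \<and>
        (\<forall>F\<subseteq>\<V>. int (card F) = n + 2 \<longrightarrow> \<Inter>F = {})))"

definition has_covering_dim :: "'a topology \<Rightarrow> int \<Rightarrow> bool"
  where "has_covering_dim X n \<longleftrightarrow> n \<ge> -1 \<and> covering_dim_le X n \<and> \<not> covering_dim_le X (n - 1)"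

section \<open>Inverse systems of nerves\<close>

text \<open>The vertex \<open>v\<^sub>U\<close> of a nerve is the set \<open>U\<close> itself, and a point of the geometric
  realization is its vector of barycentric coordinates.\<close>

definition nerve :: "'x set set \<Rightarrow> 'x set set set"
  where "nerve \<C> = {F. finite F \<and> F \<noteq> {} \<and> F \<subseteq> \<C> \<and> \<Inter>F \<noteq> {}}"

definition realization :: "'v set set \<Rightarrow> ('v \<Rightarrow> real) set"
  where "realization K = {t. {v. t v \<noteq> 0} \<in> K \<and> (\<forall>v. t v \<ge> 0) \<and> (\<Sum>v\<in>{v. t v \<noteq> 0}. t v) = 1}"

definition simplex_dist :: "'v set \<Rightarrow> ('v \<Rightarrow> real) \<Rightarrow> ('v \<Rightarrow> real) \<Rightarrow> real"
  where "simplex_dist V s t = (\<Sum>v\<in>V. \<bar>s v - t v\<bar>)"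

definition barycentre :: "'v set \<Rightarrow> 'v \<Rightarrow> real"
  where "barycentre F v = (if v \<in> F then 1 / card F else 0)"

definition bonding :: "(nat \<Rightarrow> 'x set set) \<Rightarrow> nat \<Rightarrow> ('x set \<Rightarrow> real) \<Rightarrow> 'x set \<Rightarrow> real"
  where "bonding \<U> i t = (\<lambda>V. \<Sum>U\<in>\<U> (Suc i). t U * barycentre {V' \<in> \<U> i. U \<subseteq> V'} V)"

definition inverse_limit :: "(nat \<Rightarrow> 'x set set) \<Rightarrow> (nat \<Rightarrow> 'x set \<Rightarrow> real) set"
  where "inverse_limit \<U> =
    {p. \<forall>i. p i \<in> realization (nerve (\<U> i)) \<and> bonding \<U> i (p (Suc i)) = p i}"

text \<open>The value \<open>0\<close> off the inverse limit is immaterial; it is there because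
  \<^const>\<open>Metric_space\<close> asks for symmetry and non-negativity outside the carrier too.\<close>

definition simplicial_metric ::
    "(nat \<Rightarrow> 'x set set) \<Rightarrow> real \<Rightarrow> (nat \<Rightarrow> 'x set \<Rightarrow> real) \<Rightarrow> (nat \<Rightarrow> 'x set \<Rightarrow> real) \<Rightarrow> real"
  where "simplicial_metric \<U> a p q =
    (if p \<in> inverse_limit \<U> \<and> q \<in> inverse_limit \<U>
     then \<Sum>i. simplex_dist (\<U> i) (p i) (q i) / a ^ i else 0)"

definition canonical_map :: "(nat \<Rightarrow> 'x set set) \<Rightarrow> 'x \<Rightarrow> nat \<Rightarrow> 'x set \<Rightarrow> real"
  where "canonical_map \<U> x =
    (THE p. p \<in> inverse_limit \<U> \<and> (\<forall>i. {U. p i U \<noteq> 0} \<subseteq> {U \<in> \<U> i. x \<in> U}))"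

definition admissible :: "'x topology \<Rightarrow> ('x \<Rightarrow> 'x \<Rightarrow> real) \<Rightarrow> (nat \<Rightarrow> 'x set set) \<Rightarrow> bool"
  where "admissible X d \<U> \<longleftrightarrow>
    (\<forall>n. finite (\<U> n) \<and> (\<forall>U\<in>\<U> n. openin X U \<and> U \<noteq> {}) \<and> \<Union>(\<U> n) = topspace X) \<and>
    (\<exists>m. \<forall>n. \<forall>F\<subseteq>\<U> n. \<Inter>F \<noteq> {} \<longrightarrow> card F \<le> m) \<and>
    (\<forall>\<epsilon>>0. \<forall>\<^sub>F n in sequentially. \<forall>U\<in>\<U> n. \<forall>x\<in>U. \<forall>y\<in>U. d x y \<le> \<epsilon>) \<and>
    (\<forall>n>0. \<forall>U\<in>\<U> n. \<exists>V\<in>\<U> (n - 1). \<Union>{U' \<in> \<U> n. U' \<inter> U \<noteq> {}} \<subseteq> V)"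

section \<open>Groups with a finite symmetric generating set\<close>

locale generated_group = group G for G :: "('g, 'm) monoid_scheme" (structure) +
  fixes ss :: "'g list"
  assumes gens_distinct: "distinct ss"
    and gens_closed: "set ss \<subseteq> carrier G"
    and gens_inv: "s \<in> set ss \<Longrightarrow> inv s \<in> set ss"
    and gens_generate: "generate G (set ss) = carrier G"
begin

definition wlen :: "'g \<Rightarrow> nat"
  where "wlen x = (LEAST n. \<exists>ws. set ws \<subseteq> set ss \<and> length ws = n \<and> foldr (\<otimes>) ws \<one> = x)"

definition wdist :: "'g \<Rightarrow> 'g \<Rightarrow> nat"
  where "wdist x y = wlen (inv x \<otimes> y)"

definition geodesic :: "int set \<Rightarrow> (int \<Rightarrow> 'g) \<Rightarrow> bool"
  where "geodesic I \<gamma> \<longleftrightarrow>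
    \<gamma> ` I \<subseteq> carrier G \<and> (\<forall>i\<in>I. \<forall>j\<in>I. int (wdist (\<gamma> i) (\<gamma> j)) = \<bar>i - j\<bar>)"

definition gromov_product :: "'g \<Rightarrow> 'g \<Rightarrow> 'g \<Rightarrow> real"
  where "gromov_product w x y = (real (wdist w x) + real (wdist w y) - real (wdist x y)) / 2"

subsection \<open>The Gromov boundary\<close>

definition rays :: "(nat \<Rightarrow> 'g) set"
  where "rays = {\<rho>. geodesic {0..} (\<lambda>i. \<rho> (nat i))}"

definition asymptotic :: "((nat \<Rightarrow> 'g) \<times> (nat \<Rightarrow> 'g)) set"
  where "asymptotic = {(\<rho>, \<sigma>). \<rho> \<in> rays \<and> \<sigma> \<in> rays \<and> (\<exists>C. \<forall>n. wdist (\<rho> n) (\<sigma> n) \<le> C)}"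

definition boundary :: "(nat \<Rightarrow> 'g) set set"
  where "boundary = rays // asymptotic"

text \<open>The standard basis of neighbourhoods: \<open>liminf (\<rho> s | \<sigma> t) \<ge> r\<close> for some rays
  from the identity to \<open>\<xi>\<close> and \<open>\<eta>\<close>. Gromov products of group elements are half-integers,
  so the inequality for the limit inferior is an eventual inequality.\<close>

definition bdry_nhd :: "(nat \<Rightarrow> 'g) set \<Rightarrow> real \<Rightarrow> (nat \<Rightarrow> 'g) set set"
  where "bdry_nhd \<xi> r = {\<eta> \<in> boundary. \<exists>\<rho>\<in>\<xi>. \<exists>\<sigma>\<in>\<eta>. \<rho> 0 = \<one> \<and> \<sigma> 0 = \<one> \<and>
      (\<exists>m. \<forall>s\<ge>m. \<forall>t\<ge>m. gromov_product \<one> (\<rho> s) (\<sigma> t) \<ge> r)}"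

definition bdry_topology :: "(nat \<Rightarrow> 'g) set topology"
  where "bdry_topology = topology (\<lambda>U. U \<subseteq> boundary \<and> (\<forall>\<xi>\<in>U. \<exists>r. bdry_nhd \<xi> r \<subseteq> U))"

lemma bdry_nhd_antimono: "r \<le> r' \<Longrightarrow> bdry_nhd \<xi> r' \<subseteq> bdry_nhd \<xi> r"
  unfolding bdry_nhd_def by (auto; meson order_trans)

lemma openin_bdry_topology:
  "openin bdry_topology U \<longleftrightarrow> U \<subseteq> boundary \<and> (\<forall>\<xi>\<in>U. \<exists>r. bdry_nhd \<xi> r \<subseteq> U)"
proof -
  have "istopology (\<lambda>U. U \<subseteq> boundary \<and> (\<forall>\<xi>\<in>U. \<exists>r. bdry_nhd \<xi> r \<subseteq> U))"
    unfolding istopology_def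
  proof (intro conjI allI impI)
    fix S T
    assume S: "S \<subseteq> boundary \<and> (\<forall>\<xi>\<in>S. \<exists>r. bdry_nhd \<xi> r \<subseteq> S)"
      and T: "T \<subseteq> boundary \<and> (\<forall>\<xi>\<in>T. \<exists>r. bdry_nhd \<xi> r \<subseteq> T)"
    then show "S \<inter> T \<subseteq> boundary" by blast
    show "\<forall>\<xi>\<in>S \<inter> T. \<exists>r. bdry_nhd \<xi> r \<subseteq> S \<inter> T"
    proof
      fix \<xi> assume "\<xi> \<in> S \<inter> T"
      then obtain r r' where "bdry_nhd \<xi> r \<subseteq> S" "bdry_nhd \<xi> r' \<subseteq> T"
        using S T by blast
      then have "bdry_nhd \<xi> (max r r') \<subseteq> S \<inter> T"
        using bdry_nhd_antimono[of r "max r r'" \<xi>] bdry_nhd_antimono[of r' "max r r'" \<xi>]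
        by auto
      then show "\<exists>r. bdry_nhd \<xi> r \<subseteq> S \<inter> T" by blast
    qed
  next
    fix K :: "(nat \<Rightarrow> 'g) set set set"
    assume K: "\<forall>S\<in>K. S \<subseteq> boundary \<and> (\<forall>\<xi>\<in>S. \<exists>r. bdry_nhd \<xi> r \<subseteq> S)"
    then show "\<Union>K \<subseteq> boundary" by blast
    show "\<forall>\<xi>\<in>\<Union>K. \<exists>r. bdry_nhd \<xi> r \<subseteq> \<Union>K"
      using K by (meson UnionE Union_upper order_trans)
  qed
  then show ?thesis
    unfolding bdry_topology_def by simp
qed

lemma topspace_bdry_topology: "topspace bdry_topology = boundary"
proof -
  have "openin bdry_topology boundary"
    unfolding openin_bdry_topology by (auto simp: bdry_nhd_def)
  then show ?thesis
    by (metis openin_bdry_topology openin_subset openin_topspace subset_antisym)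
qed

definition bdry_act :: "'g \<Rightarrow> (nat \<Rightarrow> 'g) set set \<Rightarrow> (nat \<Rightarrow> 'g) set set"
  where "bdry_act g A = (\<lambda>\<xi>. (\<lambda>\<rho> n. g \<otimes> \<rho> n) ` \<xi>) ` A"

definition joins :: "(int \<Rightarrow> 'g) \<Rightarrow> (nat \<Rightarrow> 'g) set \<Rightarrow> (nat \<Rightarrow> 'g) set \<Rightarrow> bool"
  where "joins \<gamma> \<xi> \<eta> \<longleftrightarrow>
    geodesic UNIV \<gamma> \<and> (\<lambda>n. \<gamma> (- int n)) \<in> \<xi> \<and> (\<lambda>n. \<gamma> (int n)) \<in> \<eta>"

definition line_depth :: "(nat \<Rightarrow> 'g) set \<Rightarrow> (nat \<Rightarrow> 'g) set \<Rightarrow> nat"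
  where "line_depth \<xi> \<eta> = Max {INF i. wdist \<one> (\<gamma> i) | \<gamma>. joins \<gamma> \<xi> \<eta>}"

definition visual_qmetric :: "real \<Rightarrow> (nat \<Rightarrow> 'g) set \<Rightarrow> (nat \<Rightarrow> 'g) set \<Rightarrow> real"
  where "visual_qmetric a \<xi> \<eta> = (if \<xi> = \<eta> then 0 else 1 / a ^ line_depth \<xi> \<eta>)"

definition visual_metric :: "real \<Rightarrow> ((nat \<Rightarrow> 'g) set \<Rightarrow> (nat \<Rightarrow> 'g) set \<Rightarrow> real) \<Rightarrow> bool"
  where "visual_metric a d \<longleftrightarrow>
    Metric_space boundary d \<and> bilipschitz boundary (visual_qmetric a) boundary d id"

subsection \<open>Geodesic triangles with vertices in the group or on the boundary\<close>

text \<open>\<open>side u v A\<close>: \<open>A\<close> is the image of a geodesic joining \<open>u\<close> with \<open>v\<close>, where \<open>Inl\<close> marks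
  group elements and \<open>Inr\<close> boundary points.\<close>

fun side :: "'g + (nat \<Rightarrow> 'g) set \<Rightarrow> 'g + (nat \<Rightarrow> 'g) set \<Rightarrow> 'g set \<Rightarrow> bool"
  where
    "side (Inl x) (Inl y) A \<longleftrightarrow>
      (\<exists>\<gamma> n. geodesic {0..int n} \<gamma> \<and> \<gamma> 0 = x \<and> \<gamma> (int n) = y \<and> A = \<gamma> ` {0..int n})"
  | "side (Inl x) (Inr \<eta>) A \<longleftrightarrow> \<eta> \<in> boundary \<and> (\<exists>\<rho>\<in>\<eta>. \<rho> 0 = x \<and> A = range \<rho>)"
  | "side (Inr \<xi>) (Inl y) A \<longleftrightarrow> \<xi> \<in> boundary \<and> (\<exists>\<rho>\<in>\<xi>. \<rho> 0 = y \<and> A = range \<rho>)"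
  | "side (Inr \<xi>) (Inr \<eta>) A \<longleftrightarrow>
      \<xi> \<in> boundary \<and> \<eta> \<in> boundary \<and> (\<exists>\<gamma>. joins \<gamma> \<xi> \<eta> \<and> A = range \<gamma>)"

definition thin_triangles :: "real \<Rightarrow> bool"
  where "thin_triangles \<delta> \<longleftrightarrow>
    (\<forall>u v w A B C. side u v A \<and> side v w B \<and> side w u C \<longrightarrow>
      (\<forall>x\<in>A. \<exists>y\<in>B \<union> C.
        real (wdist x y) \<le> 4 * (real (length (filter (\<lambda>z. \<not> isl z) [u, v, w])) + 1) * \<delta>))"

subsection \<open>Spans, cone types and ball types\<close>

definition span :: "'g \<Rightarrow> (nat \<Rightarrow> 'g) set set"
  where "span g = {\<xi> \<in> boundary. \<exists>\<rho>\<in>\<xi>. \<rho> 0 = \<one> \<and> g \<in> range \<rho>}"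

definition span_star :: "'g \<Rightarrow> (nat \<Rightarrow> 'g) set set"
  where "span_star g = bdry_topology interior_of
    (\<Union>{span (g \<otimes> h) | h. h \<in> carrier G \<and> wlen (g \<otimes> h) = wlen g \<and> span (g \<otimes> h) \<inter> span g \<noteq> {}})"

definition cone_type :: "'g \<Rightarrow> 'g set"
  where "cone_type x = {y \<in> carrier G. \<exists>\<gamma> n.
    geodesic {0..int n} \<gamma> \<and> \<gamma> 0 = \<one> \<and> \<gamma> (int n) = x \<otimes> y \<and> x \<in> \<gamma> ` {0..int n}}"

definition ball_type :: "nat \<Rightarrow> 'g \<Rightarrow> 'g \<Rightarrow> int"
  where "ball_type r x = (\<lambda>y\<in>{y \<in> carrier G. wlen y \<le> r}. int (wlen (x \<otimes> y)) - int (wlen x))"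

definition torsion :: "'g \<Rightarrow> bool"
  where "torsion g \<longleftrightarrow> (\<exists>n::nat. n > 0 \<and> g [^] n = \<one>)"

definition torsion_radius :: "real \<Rightarrow> real"
  where "torsion_radius \<delta> =
    Max ({real (wlen (g [^] n)) | (g::'g) (n::int). g \<in> carrier G \<and> real (wlen g) \<le> 16 * \<delta> \<and> torsion g}
         \<union> {16 * \<delta>})"

text \<open>\<open>up y\<close> is \<open>y\<^sup>\<up>\<close>; it is only meant for \<open>y \<noteq> \<one>\<close>.\<close>

definition up :: "'g \<Rightarrow> 'g"
  where "up y = y \<otimes> ss ! (LEAST i. i < length ss \<and> int (wlen (y \<otimes> ss ! i)) = int (wlen y) - 1)"

definition big_up :: "nat \<Rightarrow> nat \<Rightarrow> 'g \<Rightarrow> 'g"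
  where "big_up L k = up ^^ (L * k)"

definition p_grandchildren :: "nat \<Rightarrow> 'g \<Rightarrow> 'g set"
  where "p_grandchildren L x = {y \<in> carrier G. L \<le> wlen y \<and> big_up L 1 y = x}"

text \<open>The left summand provides the pairwise distinct values, none of them a ball type, on
  the elements of length less than \<open>L\<close>.\<close>

definition Z_type :: "nat \<Rightarrow> nat \<Rightarrow> 'g \<Rightarrow> 'g + ('g \<Rightarrow> int)"
  where "Z_type N L g = (if wlen g < L then Inl g else Inr (ball_type N g))"

definition level_cover :: "('g \<Rightarrow> (nat \<Rightarrow> 'g) set set) \<Rightarrow> nat \<Rightarrow> (nat \<Rightarrow> 'g) set set set"
  where "level_cover E n = {E x | x. x \<in> carrier G \<and> wlen x = n} - {{}}"

end

section \<open>Hyperbolic groups and their type functions\<close>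

locale hyperbolic_group = generated_group +
  assumes gromov_hyperbolic:
    "\<exists>\<delta>\<^sub>0. \<forall>w\<in>carrier G. \<forall>x\<in>carrier G. \<forall>y\<in>carrier G. \<forall>z\<in>carrier G.
      gromov_product w x z \<ge> min (gromov_product w x y) (gromov_product w y z) - \<delta>\<^sub>0"

locale hyperbolic_types = hyperbolic_group G ss
  for G :: "('g, 'm) monoid_scheme" (structure) and ss :: "'g list" +
  fixes \<delta> :: real and N\<^sub>0 N L :: nat
    and rep :: "'g + ('g \<Rightarrow> int) \<Rightarrow> 'g"
    and enum :: "'g + ('g \<Rightarrow> int) \<Rightarrow> 'g list"
  assumes \<delta>_ge_1: "\<delta> \<ge> 1"
    and thin: "thin_triangles \<delta>"
    and N\<^sub>0: "\<And>n x y. \<lbrakk>n \<ge> N\<^sub>0; x \<in> carrier G; y \<in> carrier G; ball_type n x = ball_type n y\<rbrakk>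
      \<Longrightarrow> cone_type x = cone_type y"
    and N_1: "real N \<ge> 2 * real N\<^sub>0 + 8 * \<delta> + 2"
    and N_2: "real N \<ge> real N\<^sub>0 + 77 * \<delta>"
    and N_3: "\<And>g h. \<lbrakk>g \<in> carrier G; h \<in> carrier G; real (wlen h) \<le> 16 * \<delta>;
      wlen (g \<otimes> h) = wlen g; ball_type N (g \<otimes> h) = ball_type N g\<rbrakk> \<Longrightarrow> torsion h"
    and L: "real L \<ge> Max {real N + 4 * \<delta>, 14 * \<delta>, torsion_radius \<delta> / 2 + 4 * \<delta>}"
    and rep: "\<And>\<tau>. \<tau> \<in> Z_type N L ` carrier G \<Longrightarrow> rep \<tau> \<in> carrier G \<and> Z_type N L (rep \<tau>) = \<tau>"
    and enum: "\<And>\<tau>. \<tau> \<in> Z_type N L ` carrier G \<Longrightarrow>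
      distinct (enum \<tau>) \<and> set (enum \<tau>) = p_grandchildren L (rep \<tau>)"
begin

text \<open>Numbering starts at \<open>1\<close>, so that \<open>0\<close> is kept for the elements of length less than \<open>L\<close>.\<close>

definition child_number :: "'g \<Rightarrow> nat"
  where "child_number g =
    (if wlen g < L then 0
     else let h = big_up L 1 g; \<tau> = Z_type N L h
       in Suc (THE i. i < length (enum \<tau>) \<and> enum \<tau> ! i = rep \<tau> \<otimes> inv h \<otimes> g))"

definition A_type :: "'g \<Rightarrow> ('g + ('g \<Rightarrow> int)) \<times> nat"
  where "A_type g = (Z_type N L g, child_number g)"

definition companions :: "'g \<Rightarrow> 'g set"
  where "companions g =
    {g' \<in> carrier G. wlen g' = wlen g \<and> real (wdist g g') \<le> torsion_radius \<delta>}"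

definition split_height :: "'g \<Rightarrow> 'g \<Rightarrow> nat"
  where "split_height g' g'' = (LEAST k. A_type (big_up L k g') \<noteq> A_type (big_up L k g''))"

definition split_heights :: "'g \<Rightarrow> nat list"
  where "split_heights g = rev (sorted_list_of_set
    (insert 0 {split_height g' g'' | g' g''. g' \<in> companions g \<and> g'' \<in> companions g \<and> g' \<noteq> g''}))"

definition B_type :: "'g \<Rightarrow> ('g \<times> (('g + ('g \<Rightarrow> int)) \<times> nat) list) set"
  where "B_type g =
    {(inv g \<otimes> g', map (\<lambda>k. A_type (big_up L k g')) (split_heights g)) | g'. g' \<in> companions g}"

text \<open>A partial map, since its domain depends on \<open>g\<close>.\<close>

definition B_type_ext :: "int \<Rightarrow> 'g \<Rightarrow> 'g \<Rightarrow> ('g \<times> (('g + ('g \<Rightarrow> int)) \<times> nat) list) set option"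
  where "B_type_ext \<theta> g h =
    (if h \<in> carrier G \<and> wlen (g \<otimes> h) = wlen g \<and> real (wlen h) \<le> 12 * of_int \<theta> * \<delta>
     then Some (B_type (g \<otimes> h)) else None)"

end

section \<open>The system of covers\<close>

locale boundary_covers = hyperbolic_types +
  fixes k :: int and E :: "'a \<Rightarrow> (nat \<Rightarrow> 'a) set set"
  assumes dim: "has_covering_dim bdry_topology k"
    and E_open: "\<And>x. x \<in> carrier G \<Longrightarrow> openin bdry_topology (E x)"
    and E_span_star: "\<And>x. x \<in> carrier G \<Longrightarrow> E x \<subseteq> span_star x"
    and E_equivariant: "\<And>g x. \<lbrakk>g \<in> carrier G; x \<in> carrier G;
      B_type_ext (3 * k + 4) x = B_type_ext (3 * k + 4) (g \<otimes> x)\<rbrakk> \<Longrightarrow> E (g \<otimes> x) = bdry_act g (E x)"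
    and E_cover: "\<And>n. \<Union>{E x | x. x \<in> carrier G \<and> wlen x = n} = boundary"
    and E_rank: "\<And>n F. \<lbrakk>F \<subseteq> {E x | x. x \<in> carrier G \<and> wlen x = n}; int (card F) = k + 2\<rbrakk>
      \<Longrightarrow> \<Inter>F = {}"

text \<open>\<open>dv a\<close> is the visual metric with parameter \<open>a\<close>, given for all \<open>a > 1\<close> close to \<open>1\<close>.
  Mesh sizes are measured in these metrics; they all induce the compact topology of the
  boundary, so the choice of the parameter does not matter.

  Level \<open>i\<close> of the inverse system consists of sets indexed by elements of length \<open>i * \<l>\<close>, which
  have visual diameter about \<open>1 / a ^ (i * \<l>)\<close>, whereas \<^const>\<open>simplicial_metric\<close> with parameter
  \<open>b\<close> gives that level the weight \<open>1 / b ^ i\<close>. The visual parameter \<open>a\<close> therefore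
  corresponds to the simplicial parameter \<open>a ^ \<l>\<close>.\<close>

locale boundary_markov_system = boundary_covers +
  fixes dv :: "real \<Rightarrow> (nat \<Rightarrow> 'a) set \<Rightarrow> (nat \<Rightarrow> 'a) set \<Rightarrow> real" and \<l> :: nat
  assumes visual: "\<forall>\<^sub>F a in at_right 1. visual_metric a (dv a)"
    and step_pos: "\<l> > 0"
    and step_admissible:
      "\<forall>\<^sub>F a in at_right 1. admissible bdry_topology (dv a) (\<lambda>n. level_cover E (n * \<l>))"

end

theory Submission
  imports Defs "HOL-Library.Diagonal_Subsequence"
begin

text \<open>
  Both metrics at a pair of boundary points are comparable to \<open>1 / a ^ line_depth\<close>. For the
  simplicial metric, let \<open>j\<close> be the last level with a member that contains both points. The
  bonding maps contract geometrically, since by star refinement the images of all relevant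
  vertices share a vertex of weight at least \<open>1 / m\<close>; so the coordinates below level \<open>j\<close> agree up
  to \<open>(1 - 1 / m) ^ (j - i)\<close>, which for \<open>a\<close> close to \<open>1\<close> beats the weights, and soon after level
  \<open>j\<close> the two coordinates have disjoint supports. That \<open>j * \<l>\<close> and the line depth differ by a
  bounded amount is a matter of hyperbolic geometry in one direction (a member indexed by \<open>x\<close> lies in the
  shadow of a ball around \<open>x\<close>) and of a uniform Lebesgue number in the other, which comes from
  equivariance and the finiteness of the set of types.
\<close>

section \<open>Contraction in inverse systems of nerves\<close>

text \<open>The contraction and the weights meet only in the product (1 - 1/m) * b with b =
  \<open>a ^ \<l>\<close>. It has to be below 1, which is one of the two demands for
  \<open>a\<close> to be close to 1; the other is the existence of the visual metric. All geometry
  reaches the nerves through one natural number C: members of level n contain only pairs of line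
  depth at least n - C, and pairs of depth at least n + C lie in a common member of level n.
  Additive errors in the depth become bounded factors. The delicate half is the second. Compactness
  yields a threshold for each level separately, with nothing to bound it as the level grows. The
  threshold is therefore phrased by the distance from the identity to a joining line, which a
  translation by g changes by at most the length of g; a deep pair can then be moved to one of
  finitely many reference levels. Bijectivity of the canonical map comes along: injectivity from the
  lower metric bound, surjectivity from sequential compactness. Independent parameters in the
  quasi-conformal statement are possible because changing \<open>a\<close> raises the visual
  quasi-metric to a power.\<close>

lemma simplex_dist_commute: "simplex_dist V s t = simplex_dist V t s"
  unfolding simplex_dist_def by (simp add: abs_minus_commute)

lemma simplex_dist_nonneg: "0 \<le> simplex_dist V s t"
  unfolding simplex_dist_def by (simp add: sum_nonneg)

lemma simplex_dist_triangle: "simplex_dist V s u \<le> simplex_dist V s t + simplex_dist V t u"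
  unfolding simplex_dist_def sum.distrib[symmetric] by (intro sum_mono) simp

lemma convergent_if_summable_increments:
  fixes f :: "nat \<Rightarrow> real"
  assumes "\<And>n. \<bar>f (Suc n) - f n\<bar> \<le> g n" "summable g"
  shows "convergent f"
proof -
  have "summable (\<lambda>n. f (Suc n) - f n)"
    by (rule summable_comparison_test[OF _ assms(2)]) (use assms(1) in auto)
  then have "convergent (\<lambda>n. \<Sum>k<n. f (Suc k) - f k)"
    by (simp add: summable_iff_convergent)
  then have "convergent (\<lambda>n. f n - f 0)"
    by (simp add: sum_lessThan_telescope)
  then show ?thesis
    by (simp add: convergent_diff_const_right_iff)
qed

text \<open>The combinatorics of nerves, isolated from the geometry: \<open>X\<close> becomes the
  boundary and \<open>m\<close> a uniform multiplicity bound.\<close>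

locale star_refining =
  fixes \<U> :: "nat \<Rightarrow> 'x set set" and X :: "'x set" and m :: nat
  assumes finite_level: "finite (\<U> n)"
    and nonempty_member: "V \<in> \<U> n \<Longrightarrow> V \<noteq> {}"
    and covers: "\<Union>(\<U> n) = X"
    and m_pos: "m > 0"
    and multiplicity: "F \<subseteq> \<U> n \<Longrightarrow> \<Inter>F \<noteq> {} \<Longrightarrow> card F \<le> m"
    and star: "W \<in> \<U> (Suc n) \<Longrightarrow> \<exists>V\<in>\<U> n. \<Union>{W' \<in> \<U> (Suc n). W' \<inter> W \<noteq> {}} \<subseteq> V"
begin

text \<open>A point of the realization without the demand that its support be a simplex. This weaker
  property passes through bonding maps by mere averaging; that supports are simplexes is recovered
  afterwards from a point common to all their members.\<close>

definition prob_vec :: "nat \<Rightarrow> ('x set \<Rightarrow> real) \<Rightarrow> bool"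
  where "prob_vec i t \<longleftrightarrow> (\<forall>v. 0 \<le> t v) \<and> (\<forall>v. v \<notin> \<U> i \<longrightarrow> t v = 0) \<and> sum t (\<U> i) = 1"

lemma prob_vec_realization:
  assumes "t \<in> realization (nerve (\<U> i))"
  shows "prob_vec i t"
proof -
  have fin: "{v. t v \<noteq> 0} \<subseteq> \<U> i" and "\<forall>v. t v \<ge> 0" and "(\<Sum>v\<in>{v. t v \<noteq> 0}. t v) = 1"
    using assms by (auto simp: realization_def nerve_def)
  moreover have "sum t (\<U> i) = (\<Sum>v\<in>{v. t v \<noteq> 0}. t v)"
    using fin finite_level by (intro sum.mono_neutral_right) auto
  ultimately show ?thesis
    unfolding prob_vec_def by auto
qed

lemma realization_prob_vec:
  assumes "prob_vec i t" "\<And>V. t V \<noteq> 0 \<Longrightarrow> x \<in> V"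
  shows "t \<in> realization (nerve (\<U> i))"
proof -
  have sub: "{v. t v \<noteq> 0} \<subseteq> \<U> i"
    using assms by (auto simp: prob_vec_def)
  have "sum t (\<U> i) = (\<Sum>v\<in>{v. t v \<noteq> 0}. t v)"
    using sub finite_level by (intro sum.mono_neutral_right) auto
  then have sum: "(\<Sum>v\<in>{v. t v \<noteq> 0}. t v) = 1"
    using assms by (simp add: prob_vec_def)
  then have "{v. t v \<noteq> 0} \<noteq> {}"
    by (metis sum.empty zero_neq_one)
  then have "{v. t v \<noteq> 0} \<in> nerve (\<U> i)"
    using assms sub finite_subset[OF sub finite_level] unfolding nerve_def by auto
  then show ?thesis
    using assms sum by (simp add: realization_def prob_vec_def)
qed

lemma simplex_dist_le_2:
  assumes "prob_vec i s" "prob_vec i t"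
  shows "simplex_dist (\<U> i) s t \<le> 2"
proof -
  have "simplex_dist (\<U> i) s t \<le> (\<Sum>v\<in>\<U> i. s v + t v)"
    unfolding simplex_dist_def using assms
    by (intro sum_mono) (auto simp: prob_vec_def abs_if)
  then show ?thesis
    using assms by (simp add: prob_vec_def sum.distrib)
qed

lemma prob_vec_barycentre:
  assumes "F \<subseteq> \<U> i" "F \<noteq> {}"
  shows "prob_vec i (barycentre F)"
proof -
  have "finite F"
    using assms finite_level finite_subset by blast
  moreover have "sum (barycentre F) (\<U> i) = sum (barycentre F) F"
    using assms finite_level by (intro sum.mono_neutral_right) (auto simp: barycentre_def)
  ultimately show ?thesis
    using assms by (auto simp: prob_vec_def barycentre_def)
qed

lemma obtain_superset:
  assumes "W \<in> \<U> (Suc i)"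
  obtains V where "V \<in> \<U> i" "\<And>W'. W' \<in> \<U> (Suc i) \<Longrightarrow> W' \<inter> W \<noteq> {} \<Longrightarrow> W' \<subseteq> V"
  using star[OF assms] by blast

text \<open>\<open>W\<close> is nonempty and so meets itself; star refinement then gives a superset
  one level coarser. This keeps the barycentre in \<open>bonding\<close> from being that of the
  empty set.\<close>

lemma supersets_nonempty:
  assumes "W \<in> \<U> (Suc i)"
  shows "{V \<in> \<U> i. W \<subseteq> V} \<noteq> {}"
  using obtain_superset[OF assms] nonempty_member[OF assms] assms by (metis (mono_tags, lifting) Collect_empty_eq inf.idem)

lemma barycentre_supersets:
  assumes "W \<in> \<U> (Suc i)"
  shows "prob_vec i (barycentre {V \<in> \<U> i. W \<subseteq> V})"
  by (intro prob_vec_barycentre supersets_nonempty assms) auto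

text \<open>The supersets of \<open>W\<close> share the points of \<open>W\<close>, so the
  multiplicity bound limits their number to \<open>m\<close>.\<close>

lemma barycentre_supersets_ge:
  assumes "W \<in> \<U> (Suc i)" "V \<in> \<U> i" "W \<subseteq> V"
  shows "1 / m \<le> barycentre {V \<in> \<U> i. W \<subseteq> V} V"
proof -
  have "\<Inter>{V \<in> \<U> i. W \<subseteq> V} \<noteq> {}"
    using nonempty_member[OF assms(1)] by blast
  then have "card {V \<in> \<U> i. W \<subseteq> V} \<le> m"
    by (intro multiplicity) auto
  moreover have "0 < card {V \<in> \<U> i. W \<subseteq> V}"
    using assms finite_level[of i] by (auto simp: card_gt_0_iff)
  ultimately show ?thesis
    using assms by (simp add: barycentre_def frac_le)
qed

lemma bonding_prob_vec:
  assumes "prob_vec (Suc i) t"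
  shows "prob_vec i (bonding \<U> i t)"
proof -
  have "(\<Sum>V\<in>\<U> i. \<Sum>U\<in>\<U> (Suc i). t U * barycentre {V' \<in> \<U> i. U \<subseteq> V'} V)
     = (\<Sum>U\<in>\<U> (Suc i). t U * (\<Sum>V\<in>\<U> i. barycentre {V' \<in> \<U> i. U \<subseteq> V'} V))"
    by (subst sum.swap) (simp add: sum_distrib_left)
  also have "\<dots> = (\<Sum>U\<in>\<U> (Suc i). t U)"
    using barycentre_supersets by (intro sum.cong) (auto simp: prob_vec_def)
  finally show ?thesis
    using assms barycentre_supersets unfolding prob_vec_def bonding_def
    by (auto intro!: sum_nonneg sum.neutral simp: barycentre_def)
qed

lemma bonding_support:
  assumes "bonding \<U> i t V \<noteq> 0"
  obtains W where "W \<in> \<U> (Suc i)" "t W \<noteq> 0" "W \<subseteq> V"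
proof -
  obtain W where "W \<in> \<U> (Suc i)" "t W * barycentre {V' \<in> \<U> i. W \<subseteq> V'} V \<noteq> 0"
    using assms unfolding bonding_def by (meson sum.neutral)
  then show ?thesis
    using that by (auto simp: barycentre_def split: if_splits)
qed

text \<open>Dobrushin's argument: the images of all vertices concerned share mass \<open>1 / m\<close> at \<open>V\<close>,
  and this common part cancels in the difference.\<close>

lemma bonding_contracts:
  assumes s: "prob_vec (Suc i) s" and t: "prob_vec (Suc i) t" and V: "V \<in> \<U> i"
    and sub: "\<And>W. s W \<noteq> 0 \<or> t W \<noteq> 0 \<Longrightarrow> W \<subseteq> V"
  shows "simplex_dist (\<U> i) (bonding \<U> i s) (bonding \<U> i t)
    \<le> (1 - 1 / m) * simplex_dist (\<U> (Suc i)) s t"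
proof -
  define \<beta> where "\<beta> W = barycentre {V' \<in> \<U> i. W \<subseteq> V'}" for W
  define c where "c v = (if v = V then 1 / real m else 0)" for v
  have c: "sum c (\<U> i) = 1 / m"
    using V finite_level by (simp add: c_def)
  have \<beta>: "sum (\<beta> W) (\<U> i) = 1" if "W \<in> \<U> (Suc i)" for W
    using barycentre_supersets[OF that] by (simp add: \<beta>_def prob_vec_def)
  have le: "\<bar>bonding \<U> i s v - bonding \<U> i t v\<bar> \<le> (\<Sum>W\<in>\<U> (Suc i). \<bar>s W - t W\<bar> * (\<beta> W v - c v))" for v
  proof -
    have "(\<Sum>W\<in>\<U> (Suc i). (s W - t W) * c v) = 0"
      using s t by (simp add: sum_distrib_right[symmetric] sum_subtractf prob_vec_def)
    then have "bonding \<U> i s v - bonding \<U> i t v = (\<Sum>W\<in>\<U> (Suc i). (s W - t W) * (\<beta> W v - c v))"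
      unfolding bonding_def \<beta>_def[symmetric]
      by (simp add: right_diff_distrib left_diff_distrib sum_subtractf)
    also have "\<bar>\<dots>\<bar> \<le> (\<Sum>W\<in>\<U> (Suc i). \<bar>(s W - t W) * (\<beta> W v - c v)\<bar>)"
      by (rule sum_abs)
    also have "\<dots> = (\<Sum>W\<in>\<U> (Suc i). \<bar>s W - t W\<bar> * (\<beta> W v - c v))"
    proof (rule sum.cong[OF refl])
      fix W assume W: "W \<in> \<U> (Suc i)"
      show "\<bar>(s W - t W) * (\<beta> W v - c v)\<bar> = \<bar>s W - t W\<bar> * (\<beta> W v - c v)"
      \<comment> \<open>\<open>\<beta> W v - c v\<close> may be negative when \<open>W\<close> is
        not contained in \<open>V\<close>, but such \<open>W\<close> carry no mass of
        \<open>s\<close> or \<open>t\<close>.\<close>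
      proof (cases "s W = 0 \<and> t W = 0")
        case False
        then have "W \<subseteq> V" using sub by blast
        then have "c v \<le> \<beta> W v"
          using barycentre_supersets_ge[OF W V] barycentre_supersets[OF W]
          by (auto simp: c_def \<beta>_def prob_vec_def)
        then show ?thesis by (simp add: abs_mult)
      qed simp
    qed
    finally show ?thesis .
  qed
  have "simplex_dist (\<U> i) (bonding \<U> i s) (bonding \<U> i t)
      \<le> (\<Sum>v\<in>\<U> i. \<Sum>W\<in>\<U> (Suc i). \<bar>s W - t W\<bar> * (\<beta> W v - c v))"
    unfolding simplex_dist_def by (intro sum_mono le)
  also have "\<dots> = (\<Sum>W\<in>\<U> (Suc i). \<bar>s W - t W\<bar> * (\<Sum>v\<in>\<U> i. \<beta> W v - c v))"
    by (subst sum.swap) (simp add: sum_distrib_left)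
  also have "\<dots> = (\<Sum>W\<in>\<U> (Suc i). (1 - 1 / m) * \<bar>s W - t W\<bar>)"
    by (intro sum.cong) (auto simp: sum_subtractf \<beta> c)
  finally show ?thesis
    by (simp add: simplex_dist_def sum_distrib_left)
qed

text \<open>The composite of \<open>n\<close> bonding maps from level \<open>i + n\<close> to level
  \<open>i\<close>; the recursion splits off the coarsest map.\<close>

primrec bonding_iter :: "nat \<Rightarrow> nat \<Rightarrow> ('x set \<Rightarrow> real) \<Rightarrow> 'x set \<Rightarrow> real"
  where "bonding_iter i 0 t = t"
  | "bonding_iter i (Suc n) t = bonding \<U> i (bonding_iter (Suc i) n t)"

text \<open>Splits off the finest map instead, the form that compares successive approximations of a
  thread.\<close>

lemma bonding_iter_Suc: "bonding_iter i (Suc n) t = bonding_iter i n (bonding \<U> (i + n) t)"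
proof (induction n arbitrary: i)
  case (Suc n)
  then show ?case
    by (metis add_Suc_shift bonding_iter.simps(2))
qed simp

lemma bonding_iter_prob_vec: "prob_vec (i + n) t \<Longrightarrow> prob_vec i (bonding_iter i n t)"
  by (induction n arbitrary: i) (auto intro!: bonding_prob_vec)

lemma bonding_iter_inverse_limit:
  assumes "p \<in> inverse_limit \<U>"
  shows "bonding_iter i n (p (i + n)) = p i"
  using assms by (induction n arbitrary: i) (auto simp: inverse_limit_def simp flip: add_Suc)

lemma bonding_iter_support:
  assumes "\<And>V. t V \<noteq> 0 \<Longrightarrow> x \<in> V" "bonding_iter i n t V \<noteq> 0"
  shows "x \<in> V"
  using assms(2)
proof (induction n arbitrary: i V)
  case (Suc n)
  then obtain W where "bonding_iter (Suc i) n t W \<noteq> 0" "W \<subseteq> V"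
    by (auto elim: bonding_support)
  then show ?case using Suc.IH by blast
qed (use assms(1) in simp)

text \<open>The second claim is the invariant that feeds the next contraction. Star refinement puts
  everything that meets \<open>W'\<close> inside one \<open>V\<close>, so
  \<open>bonding_contracts\<close> applies; vertices of the image contain vertices of the old
  support, hence meet \<open>V\<close>. Meeting a common member, rather than sharing a point, is the
  right hypothesis because the two supports may belong to different boundary points.\<close>

lemma bonding_iter_contracts:
  assumes "prob_vec (i + n) s" "prob_vec (i + n) t" "W \<in> \<U> (i + n)"
    and "\<And>V. s V \<noteq> 0 \<or> t V \<noteq> 0 \<Longrightarrow> V \<inter> W \<noteq> {}"
  shows "simplex_dist (\<U> i) (bonding_iter i n s) (bonding_iter i n t) \<le> 2 * (1 - 1 / m) ^ n"
    and "\<exists>V\<in>\<U> i. \<forall>V'. bonding_iter i n s V' \<noteq> 0 \<or> bonding_iter i n t V' \<noteq> 0 \<longrightarrow> V' \<inter> V \<noteq> {}"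
  using assms
proof (induction n arbitrary: i)
  case 0
  case 1
  then show ?case using simplex_dist_le_2 by simp
  case 2
  then show ?case by auto
next
  case (Suc n)
  {
    fix i
    let ?s = "bonding_iter (Suc i) n s" and ?t = "bonding_iter (Suc i) n t"
    assume prems: "prob_vec (i + Suc n) s" "prob_vec (i + Suc n) t" "W \<in> \<U> (i + Suc n)"
      "\<And>V. s V \<noteq> 0 \<or> t V \<noteq> 0 \<Longrightarrow> V \<inter> W \<noteq> {}"
    then have prob: "prob_vec (Suc i) ?s" "prob_vec (Suc i) ?t"
      and IH1: "simplex_dist (\<U> (Suc i)) ?s ?t \<le> 2 * (1 - 1 / m) ^ n"
      and "\<exists>V\<in>\<U> (Suc i). \<forall>V'. ?s V' \<noteq> 0 \<or> ?t V' \<noteq> 0 \<longrightarrow> V' \<inter> V \<noteq> {}"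
      using Suc.IH[of "Suc i"] by (auto intro!: bonding_iter_prob_vec)
    then obtain W' where W': "W' \<in> \<U> (Suc i)"
        "\<And>V'. ?s V' \<noteq> 0 \<or> ?t V' \<noteq> 0 \<Longrightarrow> V' \<inter> W' \<noteq> {}"
      by blast
    obtain V where V: "V \<in> \<U> i"
        "\<And>V'. V' \<in> \<U> (Suc i) \<Longrightarrow> V' \<inter> W' \<noteq> {} \<Longrightarrow> V' \<subseteq> V"
      using obtain_superset[OF W'(1)] by metis
    have sub: "V' \<subseteq> V" if "?s V' \<noteq> 0 \<or> ?t V' \<noteq> 0" for V'
      using that W' V prob by (metis prob_vec_def)
    have "simplex_dist (\<U> i) (bonding \<U> i ?s) (bonding \<U> i ?t)
        \<le> (1 - 1 / m) * simplex_dist (\<U> (Suc i)) ?s ?t"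
      using bonding_contracts[OF prob V(1)] sub by blast
    also have "\<dots> \<le> (1 - 1 / m) * (2 * (1 - 1 / m) ^ n)"
      using IH1 m_pos by (intro mult_left_mono) auto
    finally have 1: "simplex_dist (\<U> i) (bonding \<U> i ?s) (bonding \<U> i ?t) \<le> 2 * (1 - 1 / m) ^ Suc n"
      by simp
    have "V' \<inter> V \<noteq> {}" if "bonding \<U> i ?s V' \<noteq> 0 \<or> bonding \<U> i ?t V' \<noteq> 0" for V'
    proof -
      have "\<exists>W''. W'' \<in> \<U> (Suc i) \<and> (?s W'' \<noteq> 0 \<or> ?t W'' \<noteq> 0) \<and> W'' \<subseteq> V'"
        using that by (elim disjE bonding_support) blast+
      then obtain W'' where "W'' \<in> \<U> (Suc i)" "?s W'' \<noteq> 0 \<or> ?t W'' \<noteq> 0" "W'' \<subseteq> V'"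
        by blast
      then show ?thesis
        using sub nonempty_member by blast
    qed
    then have 2: "\<exists>V\<in>\<U> i. \<forall>V'. bonding \<U> i ?s V' \<noteq> 0 \<or> bonding \<U> i ?t V' \<noteq> 0 \<longrightarrow> V' \<inter> V \<noteq> {}"
      using V by blast
    note 1 2
  } note key = this
  case (1 i)
  show ?case unfolding bonding_iter.simps using 1 by (rule key(1)) auto
  case (2 i)
  show ?case unfolding bonding_iter.simps using 2 by (rule key(2)) auto
qed

lemma inverse_limit_prob_vec: "p \<in> inverse_limit \<U> \<Longrightarrow> prob_vec i (p i)"
  by (auto simp: inverse_limit_def intro: prob_vec_realization)

lemma inverse_limit_close:
  assumes "p \<in> inverse_limit \<U>" "q \<in> inverse_limit \<U>" "i \<le> j" "W \<in> \<U> j"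
    and "\<And>V. p j V \<noteq> 0 \<or> q j V \<noteq> 0 \<Longrightarrow> V \<inter> W \<noteq> {}"
  shows "simplex_dist (\<U> i) (p i) (q i) \<le> 2 * (1 - 1 / m) ^ (j - i)"
  using bonding_iter_contracts(1)[of i "j - i" "p j" "q j" W]
    bonding_iter_inverse_limit[of _ i "j - i"] assms inverse_limit_prob_vec by simp

text \<open>Level \<open>i\<close> can be compared with arbitrarily fine levels, so its distance is
  below every power of 1 - 1/m. Both the uniqueness and the surjectivity of the canonical map rest
  on this criterion.\<close>

lemma inverse_limit_eqI:
  assumes p: "p \<in> inverse_limit \<U>" and q: "q \<in> inverse_limit \<U>"
    and "\<And>j. \<exists>W\<in>\<U> j. \<forall>V. p j V \<noteq> 0 \<or> q j V \<noteq> 0 \<longrightarrow> V \<inter> W \<noteq> {}"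
  shows "p = q"
proof (intro ext)
  fix i V
  have "(\<lambda>n. 2 * (1 - 1 / real m) ^ n) \<longlonglongrightarrow> 0"
    using m_pos by (intro tendsto_mult_right_zero LIMSEQ_realpow_zero) auto
  moreover have "simplex_dist (\<U> i) (p i) (q i) \<le> 2 * (1 - 1 / m) ^ n" for n
    using inverse_limit_close[OF p q, of i "i + n"] assms(3)[of "i + n"] by auto
  ultimately have "simplex_dist (\<U> i) (p i) (q i) \<le> 0"
    by (meson LIMSEQ_le_const)
  then have "simplex_dist (\<U> i) (p i) (q i) = 0"
    using simplex_dist_nonneg[of "\<U> i"] by (simp add: order_antisym)
  then show "p i V = q i V"
    using inverse_limit_prob_vec[OF p, of i] inverse_limit_prob_vec[OF q, of i] finite_level[of i]
    by (cases "V \<in> \<U> i") (auto simp: simplex_dist_def sum_nonneg_eq_0_iff prob_vec_def)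
qed

text \<open>Barycentres of the members containing \<open>x\<close> serve as a first guess and are
  pushed down from ever finer levels. At level \<open>i + n\<close> the guess and the image of the
  next guess are both supported on members containing \<open>x\<close>, so the contraction makes the
  increments summable. Bonding is a finite linear combination and thus commutes with the
  limit.\<close>

lemma canonical_exists:
  assumes "x \<in> X"
  shows "\<exists>p. p \<in> inverse_limit \<U> \<and> (\<forall>i. {U. p i U \<noteq> 0} \<subseteq> {U \<in> \<U> i. x \<in> U})"
proof -
  define \<tau> where "\<tau> n = barycentre {V \<in> \<U> n. x \<in> V}" for n
  have ne: "\<exists>V\<in>\<U> n. x \<in> V" for n
    using assms covers by blast
  have \<tau>: "prob_vec n (\<tau> n)" for n
    unfolding \<tau>_def using ne[of n] by (intro prob_vec_barycentre) auto
  have \<tau>_supp: "x \<in> V" if "\<tau> n V \<noteq> 0" for n V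
    using that by (auto simp: \<tau>_def barycentre_def split: if_splits)
  define f where "f i n = bonding_iter i n (\<tau> (i + n))" for i n
  have f: "prob_vec i (f i n)" for i n
    unfolding f_def by (intro bonding_iter_prob_vec \<tau>)
  have f_supp: "x \<in> V" if "f i n V \<noteq> 0" for i n V
    using bonding_iter_support[of "\<tau> (i + n)"] \<tau>_supp that unfolding f_def by blast
  have conv: "convergent (\<lambda>n. f i n V)" for i V
  proof (rule convergent_if_summable_increments)
    show "summable (\<lambda>n. 2 * (1 - 1 / real m) ^ n)"
      using m_pos by (intro summable_mult summable_geometric) auto
    show "\<bar>f i (Suc n) V - f i n V\<bar> \<le> 2 * (1 - 1 / real m) ^ n" for n
    proof (cases "V \<in> \<U> i")
      case True
      obtain W where W: "W \<in> \<U> (i + n)" "x \<in> W"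
        using ne by blast
      let ?b = "bonding \<U> (i + n) (\<tau> (Suc (i + n)))"
      have supp: "x \<in> V" if "?b V \<noteq> 0" for V
        using that by (elim bonding_support) (use \<tau>_supp in blast)
      have "simplex_dist (\<U> i) (f i (Suc n)) (f i n) \<le> 2 * (1 - 1 / m) ^ n"
        using bonding_iter_contracts(1)[of i n ?b "\<tau> (i + n)" W] W supp \<tau>_supp
        unfolding f_def bonding_iter_Suc by (fastforce intro: bonding_prob_vec \<tau>)
      moreover have "\<bar>f i (Suc n) V - f i n V\<bar> \<le> simplex_dist (\<U> i) (f i (Suc n)) (f i n)"
        unfolding simplex_dist_def using True finite_level
        by (intro member_le_sum) auto
      ultimately show ?thesis by linarith
    next
      case False
      then show ?thesis
        using f m_pos by (auto simp: prob_vec_def)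
    qed
  qed
  define p where "p i V = lim (\<lambda>n. f i n V)" for i V
  have p: "(\<lambda>n. f i n V) \<longlonglongrightarrow> p i V" for i V
    using conv by (simp add: p_def convergent_LIMSEQ_iff)
  have supp: "x \<in> V" if "p i V \<noteq> 0" for i V
  proof (rule ccontr)
    assume "x \<notin> V"
    then have "f i n V = 0" for n
      using f_supp by blast
    then show False
      using p[of i V] that by (simp add: LIMSEQ_const_iff)
  qed
  have prob: "prob_vec i (p i)" for i
    unfolding prob_vec_def
  proof (intro conjI allI impI)
    show "0 \<le> p i V" for V
      using p[of i V] by (rule LIMSEQ_le_const) (use f in \<open>auto simp: prob_vec_def\<close>)
    show "p i V = 0" if "V \<notin> \<U> i" for V
      using p[of i V] f that by (simp add: prob_vec_def LIMSEQ_const_iff)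
    have "(\<lambda>n. sum (f i n) (\<U> i)) \<longlonglongrightarrow> sum (p i) (\<U> i)"
      by (intro tendsto_sum p)
    then show "sum (p i) (\<U> i) = 1"
      using f by (simp add: prob_vec_def LIMSEQ_const_iff)
  qed
  have "bonding \<U> i (p (Suc i)) = p i" for i
  proof
    fix V
    have "(\<lambda>n. bonding \<U> i (f (Suc i) n) V) \<longlonglongrightarrow> bonding \<U> i (p (Suc i)) V"
      unfolding bonding_def by (intro tendsto_intros p)
    moreover have "bonding \<U> i (f (Suc i) n) V = f i (Suc n) V" for n
      by (simp add: f_def)
    ultimately show "bonding \<U> i (p (Suc i)) V = p i V"
      using LIMSEQ_Suc[OF p[of i V]] LIMSEQ_unique by auto
  qed
  moreover have "p i \<in> realization (nerve (\<U> i))" for i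
    using realization_prob_vec[OF prob] supp by blast
  ultimately have "p \<in> inverse_limit \<U>"
    by (simp add: inverse_limit_def)
  moreover have "{U. p i U \<noteq> 0} \<subseteq> {U \<in> \<U> i. x \<in> U}" for i
    using supp prob by (auto simp: prob_vec_def)
  ultimately show ?thesis by blast
qed

text \<open>The definite description is legitimate: the supports of two candidates consist of
  members containing \<open>x\<close>, and these all meet any one member containing
  \<open>x\<close>.\<close>

lemma canonical_map:
  assumes "x \<in> X"
  shows "canonical_map \<U> x \<in> inverse_limit \<U>"
    and "canonical_map \<U> x i V \<noteq> 0 \<Longrightarrow> V \<in> \<U> i \<and> x \<in> V"
proof -
  have "\<exists>!p. p \<in> inverse_limit \<U> \<and> (\<forall>i. {U. p i U \<noteq> 0} \<subseteq> {U \<in> \<U> i. x \<in> U})"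
  proof (rule ex_ex1I[OF canonical_exists[OF assms]])
    fix p q
    assume p: "p \<in> inverse_limit \<U> \<and> (\<forall>i. {U. p i U \<noteq> 0} \<subseteq> {U \<in> \<U> i. x \<in> U})"
      and q: "q \<in> inverse_limit \<U> \<and> (\<forall>i. {U. q i U \<noteq> 0} \<subseteq> {U \<in> \<U> i. x \<in> U})"
    show "p = q"
    proof (rule inverse_limit_eqI)
      fix j
      obtain W where "W \<in> \<U> j" "x \<in> W"
        using assms covers by blast
      moreover have "x \<in> V" if "p j V \<noteq> 0 \<or> q j V \<noteq> 0" for V
        using that p q by auto
      ultimately show "\<exists>W\<in>\<U> j. \<forall>V. p j V \<noteq> 0 \<or> q j V \<noteq> 0 \<longrightarrow> V \<inter> W \<noteq> {}"
        by blast
    qed (use p q in blast)+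
  qed
  then have "canonical_map \<U> x \<in> inverse_limit \<U> \<and>
      (\<forall>i. {U. canonical_map \<U> x i U \<noteq> 0} \<subseteq> {U \<in> \<U> i. x \<in> U})"
    unfolding canonical_map_def by (rule theI')
  then show "canonical_map \<U> x \<in> inverse_limit \<U>"
    and "canonical_map \<U> x i V \<noteq> 0 \<Longrightarrow> V \<in> \<U> i \<and> x \<in> V"
    by blast+
qed

text \<open>The sets \<open>B n\<close> common to the supporting members decrease, and a cluster
  point \<open>x\<close> of points chosen in them is the preimage. As \<open>B n\<close> need not be
  closed, \<open>x\<close> may lie outside it; but a member \<open>W\<close> around \<open>x\<close>
  meets \<open>B n\<close> for some n \<ge> j, hence meets every supporting member at level
  \<open>j\<close>, which suffices for \<open>inverse_limit_eqI\<close>.\<close>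

lemma canonical_map_surj:
  assumes p: "p \<in> inverse_limit \<U>"
    and accumulate: "\<And>xs :: nat \<Rightarrow> 'x. range xs \<subseteq> X \<Longrightarrow>
      \<exists>x\<in>X. \<forall>n. \<forall>W\<in>\<U> n. x \<in> W \<longrightarrow> (\<exists>\<^sub>F j in sequentially. xs j \<in> W)"
  shows "p \<in> canonical_map \<U> ` X"
proof -
  define B where "B n = \<Inter>{V. p n V \<noteq> 0}" for n
  have supp: "{V. p n V \<noteq> 0} \<subseteq> \<U> n" "{V. p n V \<noteq> 0} \<noteq> {}" "B n \<noteq> {}" for n
    using p by (auto simp: inverse_limit_def realization_def nerve_def B_def)
  have step: "B (Suc n) \<subseteq> B n" for n
  proof
    fix y assume y: "y \<in> B (Suc n)"
    have "y \<in> V" if "p n V \<noteq> 0" for V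
    proof -
      have "bonding \<U> n (p (Suc n)) V \<noteq> 0"
        using that p by (simp add: inverse_limit_def)
      then show ?thesis
        using y by (elim bonding_support) (auto simp: B_def)
    qed
    then show "y \<in> B n" by (simp add: B_def)
  qed
  define xs where "xs n = (SOME y. y \<in> B n)" for n
  have xs: "xs n \<in> B n" for n
    using supp(3) by (simp add: xs_def some_in_eq)
  have "xs n \<in> X" for n
    using xs[of n] supp(1,2)[of n] covers[of n] unfolding B_def by blast
  then obtain x where x: "x \<in> X"
      "\<And>n W. W \<in> \<U> n \<Longrightarrow> x \<in> W \<Longrightarrow> \<exists>\<^sub>F j in sequentially. xs j \<in> W"
    using accumulate[of xs] by blast
  have "p = canonical_map \<U> x"
  proof (rule inverse_limit_eqI[OF p canonical_map(1)[OF x(1)]])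
    fix j
    obtain W where W: "W \<in> \<U> j" "x \<in> W"
      using x covers by blast
    have "\<exists>n\<ge>j. xs n \<in> W"
      using x(2)[OF W] unfolding frequently_sequentially by blast
    then obtain n where n: "n \<ge> j" "xs n \<in> W" by blast
    have "B n \<subseteq> B j"
      using lift_Suc_antimono_le[of B] step n by blast
    then have "V \<inter> W \<noteq> {}" if "p j V \<noteq> 0" for V
      using that n xs[of n] by (auto simp: B_def)
    then show "\<exists>W\<in>\<U> j. \<forall>V. p j V \<noteq> 0 \<or> canonical_map \<U> x j V \<noteq> 0 \<longrightarrow> V \<inter> W \<noteq> {}"
      using W canonical_map(2)[OF x(1)] by blast
  qed
  then show ?thesis using x by blast
qed

section \<open>The simplicial metric on the inverse limit\<close>

context
  fixes b :: real
  assumes b: "1 < b"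
begin

lemma simplicial_term_le:
  assumes "p \<in> inverse_limit \<U>" "q \<in> inverse_limit \<U>"
  shows "simplex_dist (\<U> i) (p i) (q i) / b ^ i \<le> 2 * (1 / b) ^ i"
  using simplex_dist_le_2[of i "p i" "q i"] assms inverse_limit_prob_vec b
  by (simp add: power_one_over field_simps)

lemma summable_simplicial:
  assumes "p \<in> inverse_limit \<U>" "q \<in> inverse_limit \<U>"
  shows "summable (\<lambda>i. simplex_dist (\<U> i) (p i) (q i) / b ^ i)"
proof (rule summable_comparison_test)
  show "summable (\<lambda>i. 2 * (1 / b) ^ i)"
    using b by (intro summable_mult summable_geometric) auto
  show "\<exists>N. \<forall>i\<ge>N. norm (simplex_dist (\<U> i) (p i) (q i) / b ^ i) \<le> 2 * (1 / b) ^ i"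
    using simplicial_term_le[OF assms] b by (auto simp: simplex_dist_nonneg)
qed

lemma simplicial_term_le_metric:
  assumes "p \<in> inverse_limit \<U>" "q \<in> inverse_limit \<U>"
  shows "simplex_dist (\<U> i) (p i) (q i) / b ^ i \<le> simplicial_metric \<U> b p q"
proof -
  have "(\<Sum>i\<in>{i}. simplex_dist (\<U> i) (p i) (q i) / b ^ i)
      \<le> (\<Sum>i. simplex_dist (\<U> i) (p i) (q i) / b ^ i)"
    using b by (intro sum_le_suminf summable_simplicial assms) (auto simp: simplex_dist_nonneg)
  then show ?thesis
    using assms by (simp add: simplicial_metric_def)
qed

lemma Metric_space_simplicial: "Metric_space (inverse_limit \<U>) (simplicial_metric \<U> b)"
proof
  show "0 \<le> simplicial_metric \<U> b p q" for p q
    using b summable_simplicial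
    by (auto simp: simplicial_metric_def simplex_dist_nonneg intro!: suminf_nonneg)
  show "simplicial_metric \<U> b p q = simplicial_metric \<U> b q p" for p q
    by (simp add: simplicial_metric_def simplex_dist_commute[of _ "p _"])
  fix p q
  assume p: "p \<in> inverse_limit \<U>" and q: "q \<in> inverse_limit \<U>"
  show "simplicial_metric \<U> b p q = 0 \<longleftrightarrow> p = q"
  proof
    assume "simplicial_metric \<U> b p q = 0"
    then have "simplex_dist (\<U> i) (p i) (q i) \<le> 0" for i
      using simplicial_term_le_metric[OF p q, of i] b zero_less_power[of b i]
      by (auto simp: divide_le_0_iff simp del: zero_less_power)
    then have *: "simplex_dist (\<U> i) (p i) (q i) = 0" for i
      by (intro order_antisym simplex_dist_nonneg)
    show "p = q"
    proof (intro ext)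
      fix i V
      show "p i V = q i V"
        using *[of i] inverse_limit_prob_vec[OF p, of i] inverse_limit_prob_vec[OF q, of i]
          finite_level[of i]
        by (cases "V \<in> \<U> i") (auto simp: simplex_dist_def sum_nonneg_eq_0_iff prob_vec_def)
    qed
  qed (simp add: simplicial_metric_def simplex_dist_def)
  fix r assume r: "r \<in> inverse_limit \<U>"
  have "(\<Sum>i. simplex_dist (\<U> i) (p i) (r i) / b ^ i) \<le>
      (\<Sum>i. simplex_dist (\<U> i) (p i) (q i) / b ^ i + simplex_dist (\<U> i) (q i) (r i) / b ^ i)"
    using b
    by (intro suminf_le summable_simplicial summable_add p q r)
      (simp add: add_divide_distrib[symmetric] divide_right_mono simplex_dist_triangle)
  also have "\<dots> = (\<Sum>i. simplex_dist (\<U> i) (p i) (q i) / b ^ i) +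
      (\<Sum>i. simplex_dist (\<U> i) (q i) (r i) / b ^ i)"
    by (intro suminf_add[symmetric] summable_simplicial p q r)
  finally show "simplicial_metric \<U> b p r \<le> simplicial_metric \<U> b p q + simplicial_metric \<U> b q r"
    using p q r by (simp add: simplicial_metric_def)
qed

lemma simplicial_metric_ge:
  assumes x: "x \<in> X" and y: "y \<in> X" and sep: "\<And>V. V \<in> \<U> j \<Longrightarrow> \<not> (x \<in> V \<and> y \<in> V)"
  shows "2 / b ^ j \<le> simplicial_metric \<U> b (canonical_map \<U> x) (canonical_map \<U> y)"
proof -
  let ?p = "canonical_map \<U> x" and ?q = "canonical_map \<U> y"
  note p = canonical_map[OF x] and q = canonical_map[OF y]
  have prob: "prob_vec j (?p j)" "prob_vec j (?q j)"
    using inverse_limit_prob_vec p q by auto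
  have "\<bar>?p j V - ?q j V\<bar> = ?p j V + ?q j V" if "V \<in> \<U> j" for V
  proof -
    have "?p j V = 0 \<or> ?q j V = 0"
      using p(2)[of j V] q(2)[of j V] sep[OF that] by blast
    then show ?thesis
      using prob by (auto simp: prob_vec_def)
  qed
  then have "simplex_dist (\<U> j) (?p j) (?q j) = 2"
    using prob unfolding simplex_dist_def by (simp add: sum.distrib prob_vec_def)
  then show ?thesis
    using simplicial_term_le_metric[OF p(1) q(1), of j] by simp
qed

lemma simplicial_metric_le_const:
  assumes "p \<in> inverse_limit \<U>" "q \<in> inverse_limit \<U>"
  shows "simplicial_metric \<U> b p q \<le> 2 / (1 - 1 / b)"
proof -
  have "simplicial_metric \<U> b p q \<le> (\<Sum>i. 2 * (1 / b) ^ i)"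
    unfolding simplicial_metric_def using assms b
    by (simp add: suminf_le simplicial_term_le summable_simplicial summable_mult summable_geometric)
  also have "\<dots> = 2 / (1 - 1 / b)"
    using b by (subst suminf_mult) (auto simp: suminf_geometric)
  finally show ?thesis .
qed

text \<open>At level \<open>j\<close> every supporting member contains \<open>x\<close> or
  \<open>y\<close> and so meets \<open>V\<close>. Going down from \<open>j\<close>, the contraction
  competes with the growing weights and leaves a geometric series of ratio (1 - 1/m) * b; this is
  what \<open>small\<close> is for. Beyond \<open>j\<close> the trivial bound 2 and the weights give
  ratio 1/b.\<close>

lemma simplicial_metric_le:
  assumes x: "x \<in> X" and y: "y \<in> X" and V: "V \<in> \<U> j" "x \<in> V" "y \<in> V"
    and small: "(1 - 1 / m) * b < 1"
  shows "simplicial_metric \<U> b (canonical_map \<U> x) (canonical_map \<U> y)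
    \<le> (2 / (1 - (1 - 1 / m) * b) + 2 / (1 - 1 / b)) / b ^ j"
proof -
  let ?p = "canonical_map \<U> x" and ?q = "canonical_map \<U> y"
  define r where "r = (1 - 1 / m) * b"
  have r: "0 \<le> r" "r < 1"
    using m_pos b small by (auto simp: r_def)
  note p = canonical_map[OF x] and q = canonical_map[OF y]
  define f where "f i = simplex_dist (\<U> i) (?p i) (?q i) / b ^ i" for i
  have sum_f: "summable f"
    unfolding f_def by (intro summable_simplicial p q)
  have small_i: "f (j - i) \<le> 2 / b ^ j * r ^ i" if "i \<le> j" for i
  proof -
    have "simplex_dist (\<U> (j - i)) (?p (j - i)) (?q (j - i)) \<le> 2 * (1 - 1 / m) ^ i"
      using inverse_limit_close[OF p(1) q(1), of "j - i" j V] that V p(2) q(2) by fastforce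
    then have "f (j - i) \<le> 2 * (1 - 1 / m) ^ i / b ^ (j - i)"
      unfolding f_def using b by (intro divide_right_mono) auto
    also have "\<dots> = 2 * (1 - 1 / m) ^ i * b ^ i / b ^ j"
      using that b by (simp add: power_diff)
    finally show ?thesis
      by (simp add: r_def power_mult_distrib)
  qed
  have "(\<Sum>i\<le>j. f i) = (\<Sum>i\<le>j. f (j - i))"
    using sum.nat_diff_reindex[of f "Suc j"] by (simp add: lessThan_Suc_atMost)
  also have "\<dots> \<le> (\<Sum>i\<le>j. 2 / b ^ j * r ^ i)"
    by (intro sum_mono small_i) auto
  also have "\<dots> \<le> (\<Sum>i. 2 / b ^ j * r ^ i)"
    using r b by (intro sum_le_suminf summable_mult summable_geometric) auto
  also have "\<dots> = 2 / b ^ j * (1 / (1 - r))"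
    using r by (subst suminf_mult) (auto simp: suminf_geometric summable_geometric)
  finally have 1: "(\<Sum>i<Suc j. f i) \<le> 2 / b ^ j * (1 / (1 - r))"
    by (simp add: lessThan_Suc_atMost)
  have "(\<Sum>i. f (i + Suc j)) \<le> (\<Sum>i. 2 / b ^ j * (1 / b) ^ i)"
  proof (rule suminf_le)
    show "summable (\<lambda>i. 2 / b ^ j * (1 / b) ^ i)"
      using b by (intro summable_mult summable_geometric) auto
    show "summable (\<lambda>i. f (i + Suc j))"
      using sum_f summable_iff_shift by blast
    fix i
    have "f (i + Suc j) \<le> 2 * (1 / b) ^ (i + Suc j)"
      unfolding f_def by (intro simplicial_term_le p q)
    also have "\<dots> \<le> 2 * (1 / b) ^ (i + j)"
      using b by (intro mult_left_mono power_decreasing) auto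
    also have "\<dots> = 2 / b ^ j * (1 / b) ^ i"
      by (simp add: power_add power_one_over)
    finally show "f (i + Suc j) \<le> 2 / b ^ j * (1 / b) ^ i" .
  qed
  also have "\<dots> = 2 / b ^ j * (1 / (1 - 1 / b))"
    using b by (subst suminf_mult) (auto simp: suminf_geometric summable_geometric)
  finally have 2: "(\<Sum>i. f (i + Suc j)) \<le> 2 / b ^ j * (1 / (1 - 1 / b))" .
  have "suminf f \<le> 2 / b ^ j * (1 / (1 - r)) + 2 / b ^ j * (1 / (1 - 1 / b))"
    using suminf_split_initial_segment[OF sum_f, of "Suc j"] 1 2 by linarith
  also have "\<dots> = (2 / (1 - r) + 2 / (1 - 1 / b)) / b ^ j"
    by (simp add: add_divide_distrib mult.commute)
  finally show ?thesis
    using p q unfolding simplicial_metric_def f_def r_def by simp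
qed

end

end

section \<open>Word metrics\<close>

text \<open>Plays the part of Arzela-Ascoli: geodesics that pass near the identity at a fixed time
  have only finitely many possible values at each time, so limits are eventually attained.\<close>

lemma diagonal_limit:
  fixes f :: "nat \<Rightarrow> 'i::countable \<Rightarrow> 'b"
  assumes fin: "\<And>i. finite (range (\<lambda>n. f n i))"
  obtains s g where "strict_mono (s :: nat \<Rightarrow> nat)" "\<And>i. \<forall>\<^sub>F n in sequentially. f (s n) i = g i"
proof -
  define P where "P k s \<longleftrightarrow> (\<exists>v. \<forall>n. f (s n) (from_nat k) = v)" for k and s :: "nat \<Rightarrow> nat"
  interpret subseqs P
  proof
    fix k and s :: "nat \<Rightarrow> nat"
    have "finite ((\<lambda>n. f (s n) (from_nat k)) ` UNIV)"
      using fin[of "from_nat k"] by (rule finite_subset[rotated]) auto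
    then obtain n\<^sub>0 where inf: "infinite {n. f (s n) (from_nat k) = f (s n\<^sub>0) (from_nat k)}"
      using pigeonhole_infinite[OF infinite_UNIV_nat, of "\<lambda>n. f (s n) (from_nat k)"] by auto
    show "\<exists>r. strict_mono r \<and> P k (s \<circ> r)"
      using infinite_enumerate[OF inf] by (auto simp: P_def)
  qed
  have "\<exists>v. \<forall>\<^sub>F n in sequentially. f (diagseq n) i = v" for i
  proof -
    \<comment> \<open>Past its first \<open>Suc (to_nat i)\<close> terms the diagonal sequence is a
      subsequence of the one constructed for coordinate \<open>i\<close>.\<close>
    have "P (to_nat i) (diagseq \<circ> (+) (Suc (to_nat i)))"
      by (rule diagseq_holds) (auto simp: P_def)
    then obtain v where v: "\<And>n. f (diagseq (Suc (to_nat i) + n)) i = v"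
      by (auto simp: P_def)
    have "f (diagseq n) i = v" if "n \<ge> Suc (to_nat i)" for n
      using v[of "n - Suc (to_nat i)"] that by simp
    then show ?thesis
      unfolding eventually_sequentially by blast
  qed
  then obtain g where "\<And>i. \<forall>\<^sub>F n in sequentially. f (diagseq n) i = g i"
    by metis
  then show ?thesis
    using that subseq_diagseq by blast
qed

lemma eventually_sequentially_obtain_ge:
  assumes "\<forall>\<^sub>F n in sequentially. P n"
  obtains n where "n \<ge> N" "P n"
  using assms unfolding eventually_sequentially by (meson le_add1 le_add2)

section \<open>Word length, the word metric and geodesic segments\<close>

context generated_group
begin

abbreviation word :: "'g list \<Rightarrow> 'g" where "word ws \<equiv> foldr (\<otimes>) ws \<one>"

lemma gen_closed: "s \<in> set ss \<Longrightarrow> s \<in> carrier G"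
  using gens_closed by blast

lemma word_closed [simp]: "set ws \<subseteq> set ss \<Longrightarrow> word ws \<in> carrier G"
  by (induction ws) (auto intro: gen_closed)

lemma word_append: "set ws \<subseteq> set ss \<Longrightarrow> set vs \<subseteq> set ss \<Longrightarrow> word (ws @ vs) = word ws \<otimes> word vs"
  by (induction ws) (auto simp: m_assoc gen_closed)

lemma word_inverse:
  "set ws \<subseteq> set ss \<Longrightarrow> \<exists>vs. set vs \<subseteq> set ss \<and> length vs = length ws \<and> word vs = inv (word ws)"
proof (induction ws)
  case (Cons w ws)
  then obtain vs where vs: "set vs \<subseteq> set ss" "length vs = length ws" "word vs = inv (word ws)"
    by auto
  have "word (vs @ [inv w]) = inv (word (w # ws))"
    using Cons.prems vs gens_inv[of w] gen_closed[of w] by (simp add: word_append inv_mult_group del: foldr_append)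
  then show ?case
    using Cons.prems vs gens_inv[of w] by (intro exI[of _ "vs @ [inv w]"]) auto
qed simp

lemma ex_word: "x \<in> carrier G \<Longrightarrow> \<exists>ws. set ws \<subseteq> set ss \<and> word ws = x"
  unfolding gens_generate[symmetric]
proof (induction rule: generate.induct)
  case one
  show ?case by (intro exI[of _ "[]"]) auto
next
  case (incl w)
  then show ?case by (intro exI[of _ "[w]"]) (auto simp: gen_closed)
next
  case (inv w)
  then show ?case by (intro exI[of _ "[inv w]"]) (auto simp: gen_closed gens_inv)
next
  case (eng x y)
  then show ?case by (metis set_append Un_least word_append)
qed

lemma wlen_word: "x \<in> carrier G \<Longrightarrow> \<exists>ws. set ws \<subseteq> set ss \<and> length ws = wlen x \<and> word ws = x"
  unfolding wlen_def by (rule LeastI_ex) (use ex_word in blast)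

lemma wlen_le: "set ws \<subseteq> set ss \<Longrightarrow> wlen (word ws) \<le> length ws"
  unfolding wlen_def by (rule Least_le) blast

lemma wlen_one [simp]: "wlen \<one> = 0"
  using wlen_le[of "[]"] by simp

lemma wlen_eq_0_iff: "x \<in> carrier G \<Longrightarrow> wlen x = 0 \<longleftrightarrow> x = \<one>"
  using wlen_word[of x] by auto

lemma wlen_mult: "x \<in> carrier G \<Longrightarrow> y \<in> carrier G \<Longrightarrow> wlen (x \<otimes> y) \<le> wlen x + wlen y"
  by (metis Un_least length_append set_append wlen_le wlen_word word_append)

lemma wlen_inv_le: "x \<in> carrier G \<Longrightarrow> wlen (inv x) \<le> wlen x"
  by (metis wlen_le wlen_word word_inverse)

lemma wlen_inv [simp]: "x \<in> carrier G \<Longrightarrow> wlen (inv x) = wlen x"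
  using wlen_inv_le[of x] wlen_inv_le[of "inv x"] by simp

lemma finite_wlen_le: "finite {x \<in> carrier G. wlen x \<le> n}"
proof (rule finite_subset)
  show "{x \<in> carrier G. wlen x \<le> n} \<subseteq> word ` {ws. set ws \<subseteq> set ss \<and> length ws \<le> n}"
    using wlen_word by (auto simp: image_iff) metis
qed (intro finite_imageI finite_lists_length_le finite_set)

lemma wdist_one [simp]: "x \<in> carrier G \<Longrightarrow> wdist \<one> x = wlen x"
  by (simp add: wdist_def)

lemma wdist_refl [simp]: "x \<in> carrier G \<Longrightarrow> wdist x x = 0"
  by (simp add: wdist_def)

lemma wdist_commute: "x \<in> carrier G \<Longrightarrow> y \<in> carrier G \<Longrightarrow> wdist x y = wdist y x"
  unfolding wdist_def using wlen_inv[of "inv x \<otimes> y"] by (simp add: inv_mult_group)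

lemma wdist_mult_left:
  "g \<in> carrier G \<Longrightarrow> x \<in> carrier G \<Longrightarrow> y \<in> carrier G \<Longrightarrow> wdist (g \<otimes> x) (g \<otimes> y) = wdist x y"
  unfolding wdist_def by (simp add: inv_mult_group m_assoc inv_solve_left)
     (metis inv_closed l_inv l_one m_assoc)

lemma wdist_triangle:
  assumes "x \<in> carrier G" "y \<in> carrier G" "z \<in> carrier G"
  shows "wdist x z \<le> wdist x y + wdist y z"
proof -
  have "inv x \<otimes> z = (inv x \<otimes> y) \<otimes> (inv y \<otimes> z)"
    using assms by (metis inv_closed l_one m_assoc m_closed r_inv)
  then show ?thesis
    unfolding wdist_def using assms wlen_mult[of "inv x \<otimes> y" "inv y \<otimes> z"] by simp
qed

text \<open>The prefixes of a shortest word for \<open>inv x \<otimes> y\<close> trace a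
  geodesic.\<close>

lemma ex_geodesic_segment:
  assumes x: "x \<in> carrier G" and y: "y \<in> carrier G"
  obtains \<gamma> where "\<gamma> 0 = x" "\<gamma> (wdist x y) = y" "\<And>i. \<gamma> i \<in> carrier G"
    "\<And>i j. i \<le> wdist x y \<Longrightarrow> j \<le> wdist x y \<Longrightarrow> real (wdist (\<gamma> i) (\<gamma> j)) = \<bar>real i - real j\<bar>"
proof -
  obtain ws where ws: "set ws \<subseteq> set ss" "length ws = wdist x y" "word ws = inv x \<otimes> y"
    using wlen_word[of "inv x \<otimes> y"] x y by (auto simp: wdist_def)
  define \<gamma> where "\<gamma> i = x \<otimes> word (take i ws)" for i
  have take_ss: "set (take i vs) \<subseteq> set ss" "set (drop i vs) \<subseteq> set ss" if "set vs \<subseteq> set ss" for i vs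
    using that set_take_subset set_drop_subset by (metis subset_trans)+
  have closed: "\<gamma> i \<in> carrier G" for i
    unfolding \<gamma>_def using x take_ss ws by auto
  have ends: "\<gamma> 0 = x" "\<gamma> (wdist x y) = y"
    unfolding \<gamma>_def using x y ws by (simp_all add: m_assoc[symmetric])
  have le: "wdist (\<gamma> i) (\<gamma> j) \<le> j - i" if "i \<le> j" for i j
  proof -
    have "take j ws = take i ws @ take (j - i) (drop i ws)"
      using that by (metis le_add_diff_inverse take_add)
    then have "word (take j ws) = word (take i ws) \<otimes> word (take (j - i) (drop i ws))"
      using ws take_ss by (simp add: word_append del: foldr_append)
    then have "\<gamma> j = \<gamma> i \<otimes> word (take (j - i) (drop i ws))"
      unfolding \<gamma>_def using x ws take_ss by (simp add: m_assoc)
    moreover have "word (take (j - i) (drop i ws)) \<in> carrier G"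
      using ws take_ss by auto
    ultimately have "wdist (\<gamma> i) (\<gamma> j) = wlen (word (take (j - i) (drop i ws)))"
      using closed[of i] unfolding wdist_def by (simp add: m_assoc[symmetric])
    also have "\<dots> \<le> length (take (j - i) (drop i ws))"
      using ws take_ss by (intro wlen_le) auto
    finally show ?thesis by simp
  qed
  \<comment> \<open>The three pieces before, between and after \<open>i\<close> and \<open>j\<close>
    have total length at least \<open>wdist x y\<close>, while \<open>le\<close> bounds each from
    above; hence none of them can be shorter.\<close>
  have eq: "wdist (\<gamma> i) (\<gamma> j) = j - i" if "i \<le> j" "j \<le> wdist x y" for i j
  proof -
    have "wdist x y \<le> wdist (\<gamma> 0) (\<gamma> i) + (wdist (\<gamma> i) (\<gamma> j) + wdist (\<gamma> j) (\<gamma> (wdist x y)))"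
      using wdist_triangle[OF closed[of 0] closed[of i] closed[of "wdist x y"]]
        wdist_triangle[OF closed[of i] closed[of j] closed[of "wdist x y"]] ends by simp
    then show ?thesis
      using le[of 0 i] le[OF that(1)] le[OF that(2)] that by linarith
  qed
  have "real (wdist (\<gamma> i) (\<gamma> j)) = \<bar>real i - real j\<bar>"
    if "i \<le> wdist x y" "j \<le> wdist x y" for i j
    using eq[of i j] eq[of j i] wdist_commute[OF closed[of i] closed[of j]] that
    by (cases "i \<le> j") auto
  then show ?thesis
    using that ends closed by blast
qed

abbreviation gd :: "'g \<Rightarrow> 'g \<Rightarrow> real" where "gd x y \<equiv> real (wdist x y)"
abbreviation gp :: "'g \<Rightarrow> 'g \<Rightarrow> real" where "gp x y \<equiv> gromov_product \<one> x y"

lemma gd_triangle: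
  "x \<in> carrier G \<Longrightarrow> y \<in> carrier G \<Longrightarrow> z \<in> carrier G \<Longrightarrow> gd x z \<le> gd x y + gd y z"
  using wdist_triangle[of x y z] by linarith

lemma gd_commute: "x \<in> carrier G \<Longrightarrow> y \<in> carrier G \<Longrightarrow> gd x y = gd y x"
  using wdist_commute by simp

section \<open>Rays, lines and asymptotic classes\<close>

lemma raysD:
  assumes "\<rho> \<in> rays"
  shows "\<rho> n \<in> carrier G" "gd (\<rho> i) (\<rho> j) = \<bar>real i - real j\<bar>"
proof -
  have g: "(\<lambda>i. \<rho> (nat i)) ` {0..} \<subseteq> carrier G"
    "\<And>i j. i \<ge> 0 \<Longrightarrow> j \<ge> 0 \<Longrightarrow> int (wdist (\<rho> (nat i)) (\<rho> (nat j))) = \<bar>i - j\<bar>"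
    using assms by (auto simp: rays_def geodesic_def)
  have "\<rho> (nat (int n)) \<in> carrier G"
    using g(1) by (intro subsetD[OF g(1)] imageI) simp
  then show "\<rho> n \<in> carrier G" by simp
  have "int (wdist (\<rho> i) (\<rho> j)) = \<bar>int i - int j\<bar>"
    using g(2)[of "int i" "int j"] by simp
  then show "gd (\<rho> i) (\<rho> j) = \<bar>real i - real j\<bar>"
    by linarith
qed

lemma raysI:
  assumes "\<And>n. \<rho> n \<in> carrier G" "\<And>i j. gd (\<rho> i) (\<rho> j) = \<bar>real i - real j\<bar>"
  shows "\<rho> \<in> rays"
proof -
  have "int (wdist (\<rho> i) (\<rho> j)) = \<bar>int i - int j\<bar>" for i j
    using assms(2)[of i j] by linarith
  then show ?thesis
    using assms(1) by (auto simp: rays_def geodesic_def)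
qed

lemma ray_based: "\<rho> \<in> rays \<Longrightarrow> \<rho> 0 = \<one> \<Longrightarrow> gd \<one> (\<rho> n) = real n"
  using raysD(2)[of \<rho> 0 n] by simp

lemma lineD:
  assumes "geodesic UNIV \<gamma>"
  shows "\<gamma> n \<in> carrier G" "gd (\<gamma> i) (\<gamma> j) = \<bar>real_of_int i - real_of_int j\<bar>"
proof -
  show "\<gamma> n \<in> carrier G"
    using assms by (auto simp: geodesic_def)
  have "int (wdist (\<gamma> i) (\<gamma> j)) = \<bar>i - j\<bar>"
    using assms by (auto simp: geodesic_def)
  then show "gd (\<gamma> i) (\<gamma> j) = \<bar>real_of_int i - real_of_int j\<bar>"
    by linarith
qed

lemma lineI:
  assumes "\<And>n. \<gamma> n \<in> carrier G" "\<And>i j. gd (\<gamma> i) (\<gamma> j) = \<bar>real_of_int i - real_of_int j\<bar>"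
  shows "geodesic UNIV \<gamma>"
proof -
  have "int (wdist (\<gamma> i) (\<gamma> j)) = \<bar>i - j\<bar>" for i j
    using assms(2)[of i j] by linarith
  then show ?thesis
    using assms(1) by (auto simp: geodesic_def)
qed

lemma equiv_asymptotic: "equiv rays asymptotic"
proof (rule equivI)
  show "asymptotic \<subseteq> rays \<times> rays"
    by (auto simp: asymptotic_def)
  show "refl_on rays asymptotic"
  proof (rule refl_onI)
    fix \<rho> assume \<rho>: "\<rho> \<in> rays"
    then have "\<forall>n. wdist (\<rho> n) (\<rho> n) \<le> 0"
      using raysD by simp
    then show "(\<rho>, \<rho>) \<in> asymptotic"
      using \<rho> by (auto simp: asymptotic_def)
  qed
  show "sym asymptotic"
    using raysD(1) wdist_commute by (fastforce intro!: symI simp: asymptotic_def)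
  show "trans asymptotic"
  proof (rule transI)
    fix \<rho> \<sigma> \<tau>
    assume *: "(\<rho>, \<sigma>) \<in> asymptotic" "(\<sigma>, \<tau>) \<in> asymptotic"
    then obtain C C' where "\<And>n. wdist (\<rho> n) (\<sigma> n) \<le> C" "\<And>n. wdist (\<sigma> n) (\<tau> n) \<le> C'"
      by (auto simp: asymptotic_def)
    then have "wdist (\<rho> n) (\<tau> n) \<le> C + C'" for n
      using wdist_triangle[of "\<rho> n" "\<sigma> n" "\<tau> n"] * raysD(1)
        add_mono[of "wdist (\<rho> n) (\<sigma> n)" C "wdist (\<sigma> n) (\<tau> n)" C']
      by (fastforce simp: asymptotic_def)
    then show "(\<rho>, \<tau>) \<in> asymptotic"
      using * by (auto simp: asymptotic_def)
  qed
qed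

lemma asymptoticI:
  assumes "\<rho> \<in> rays" "\<sigma> \<in> rays" "\<And>n. gd (\<rho> n) (\<sigma> n) \<le> C"
  shows "(\<rho>, \<sigma>) \<in> asymptotic"
proof -
  have "wdist (\<rho> n) (\<sigma> n) \<le> nat \<lceil>C\<rceil>" for n
    using assms(3)[of n] by linarith
  then show ?thesis
    using assms by (auto simp: asymptotic_def)
qed

lemma asymptoticD:
  assumes "(\<rho>, \<sigma>) \<in> asymptotic"
  obtains C where "\<And>n. gd (\<rho> n) (\<sigma> n) \<le> C"
  using assms by (auto simp: asymptotic_def) (metis of_nat_le_iff)

lemma boundary_mem_rays: "\<xi> \<in> boundary \<Longrightarrow> \<rho> \<in> \<xi> \<Longrightarrow> \<rho> \<in> rays"
  unfolding boundary_def using equiv_asymptotic by (metis in_quotient_imp_subset subsetD)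

lemma boundary_mem_asymptotic:
  "\<xi> \<in> boundary \<Longrightarrow> \<rho> \<in> \<xi> \<Longrightarrow> \<sigma> \<in> \<xi> \<Longrightarrow> (\<rho>, \<sigma>) \<in> asymptotic"
  unfolding boundary_def using equiv_asymptotic by (metis in_quotient_imp_in_rel empty_subsetI insert_subset)

lemma boundary_mem_closed:
  "\<xi> \<in> boundary \<Longrightarrow> \<rho> \<in> \<xi> \<Longrightarrow> (\<rho>, \<sigma>) \<in> asymptotic \<Longrightarrow> \<sigma> \<in> \<xi>"
  unfolding boundary_def using equiv_asymptotic by (metis in_quotient_imp_closed)

lemma boundary_class: "\<rho> \<in> rays \<Longrightarrow> asymptotic `` {\<rho>} \<in> boundary" "\<rho> \<in> rays \<Longrightarrow> \<rho> \<in> asymptotic `` {\<rho>}"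
  using equiv_class_self[OF equiv_asymptotic] by (auto simp: boundary_def intro: quotientI)

lemma boundary_eqI:
  "\<xi> \<in> boundary \<Longrightarrow> \<eta> \<in> boundary \<Longrightarrow> \<rho> \<in> \<xi> \<Longrightarrow> \<sigma> \<in> \<eta> \<Longrightarrow> (\<rho>, \<sigma>) \<in> asymptotic \<Longrightarrow> \<xi> = \<eta>"
  unfolding boundary_def using equiv_asymptotic by (metis quotient_eq_iff)

section \<open>The action of the group on boundary points\<close>

definition shift :: "'g \<Rightarrow> (nat \<Rightarrow> 'g) set \<Rightarrow> (nat \<Rightarrow> 'g) set"
  where "shift g \<xi> = (\<lambda>\<rho> n. g \<otimes> \<rho> n) ` \<xi>"

lemma bdry_act_shift: "bdry_act g A = shift g ` A"
  by (simp add: bdry_act_def shift_def)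

lemma ray_shift: "g \<in> carrier G \<Longrightarrow> \<rho> \<in> rays \<Longrightarrow> (\<lambda>n. g \<otimes> \<rho> n) \<in> rays"
  using raysD[of \<rho>] by (intro raysI) (auto simp: wdist_mult_left)

lemma asymptotic_shift:
  assumes g: "g \<in> carrier G" and "(\<rho>, \<sigma>) \<in> asymptotic"
  shows "((\<lambda>n. g \<otimes> \<rho> n), (\<lambda>n. g \<otimes> \<sigma> n)) \<in> asymptotic"
proof -
  have *: "\<rho> \<in> rays" "\<sigma> \<in> rays"
    using assms by (auto simp: asymptotic_def)
  then show ?thesis
    using assms ray_shift by (auto simp: asymptotic_def wdist_mult_left raysD(1))
qed

text \<open>The image is a full class because any ray asymptotic to the translate can be pulled back
  by \<open>inv g\<close>.\<close>

lemma shift_class: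
  assumes g: "g \<in> carrier G" and \<rho>: "\<rho> \<in> rays"
  shows "shift g (asymptotic `` {\<rho>}) = asymptotic `` {\<lambda>n. g \<otimes> \<rho> n}"
proof (intro equalityI subsetI)
  fix \<sigma> assume "\<sigma> \<in> shift g (asymptotic `` {\<rho>})"
  then show "\<sigma> \<in> asymptotic `` {\<lambda>n. g \<otimes> \<rho> n}"
    using asymptotic_shift[OF g] by (auto simp: shift_def)
next
  fix \<sigma> assume "\<sigma> \<in> asymptotic `` {\<lambda>n. g \<otimes> \<rho> n}"
  then have as: "((\<lambda>n. g \<otimes> \<rho> n), \<sigma>) \<in> asymptotic" and "\<sigma> \<in> rays"
    by (auto simp: asymptotic_def)
  have "(\<rho>, (\<lambda>n. inv g \<otimes> \<sigma> n)) \<in> asymptotic"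
    using asymptotic_shift[OF inv_closed[OF g] as] g raysD(1)[OF \<rho>]
    by (simp add: m_assoc[symmetric])
  then have "(\<lambda>n. inv g \<otimes> \<sigma> n) \<in> asymptotic `` {\<rho>}"
    by simp
  moreover have "\<sigma> = (\<lambda>n. g \<otimes> (inv g \<otimes> \<sigma> n))"
    using g raysD(1)[OF \<open>\<sigma> \<in> rays\<close>] by (simp add: m_assoc[symmetric])
  ultimately show "\<sigma> \<in> shift g (asymptotic `` {\<rho>})"
    unfolding shift_def by (intro image_eqI[where x = "\<lambda>n. inv g \<otimes> \<sigma> n"])
qed

lemma boundary_obtain:
  assumes "\<xi> \<in> boundary"
  obtains \<rho> where "\<rho> \<in> rays" "\<xi> = asymptotic `` {\<rho>}" "\<rho> \<in> \<xi>"
  using assms boundary_class(2) unfolding boundary_def by (metis quotientE)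

lemma shift_boundary: "g \<in> carrier G \<Longrightarrow> \<xi> \<in> boundary \<Longrightarrow> shift g \<xi> \<in> boundary"
  by (metis boundary_obtain boundary_class(1) ray_shift shift_class)

lemma shift_shift_inv:
  assumes "g \<in> carrier G" "\<xi> \<in> boundary"
  shows "shift g (shift (inv g) \<xi>) = \<xi>"
proof -
  obtain \<rho> where \<rho>: "\<rho> \<in> rays" "\<xi> = asymptotic `` {\<rho>}"
    using boundary_obtain[OF assms(2)] .
  then have "(\<lambda>n. g \<otimes> (inv g \<otimes> \<rho> n)) = \<rho>"
    using assms raysD(1)[OF \<rho>(1)] by (simp add: m_assoc[symmetric])
  then show ?thesis
    using \<rho> assms by (simp add: shift_class ray_shift)
qed

lemma shift_inv_shift:
  "g \<in> carrier G \<Longrightarrow> \<xi> \<in> boundary \<Longrightarrow> shift (inv g) (shift g \<xi>) = \<xi>"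
  using shift_shift_inv[of "inv g" \<xi>] by simp

lemma joins_shift:
  assumes "g \<in> carrier G" "joins \<gamma> \<xi> \<eta>"
  shows "joins (\<lambda>i. g \<otimes> \<gamma> i) (shift g \<xi>) (shift g \<eta>)"
  using assms lineD[of \<gamma>]
  by (auto simp: joins_def shift_def wdist_mult_left intro!: lineI)

end

section \<open>Hyperbolic geometry of the boundary\<close>

lemma INF_nat_le: "(INF i. f i) \<le> (f i :: nat)"
  by (rule cINF_lower) auto

text \<open>Fixes one additive constant \<open>h\<close> for the four-point inequality, so that
  later losses are explicit multiples of it.\<close>

locale four_point = generated_group G ss
  for G :: "('g, 'm) monoid_scheme" (structure) and ss :: "'g list" +
  fixes h :: real
  assumes four_point: "\<lbrakk>w \<in> carrier G; x \<in> carrier G; y \<in> carrier G; z \<in> carrier G\<rbrakk>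
    \<Longrightarrow> gromov_product w x z \<ge> min (gromov_product w x y) (gromov_product w y z) - h"
begin

lemma h_nonneg: "0 \<le> h"
  using four_point[of \<one> \<one> \<one> \<one>] by (simp add: gromov_product_def)

lemma gp_chain2:
  assumes "x \<in> carrier G" "y \<in> carrier G" "z \<in> carrier G" "r \<le> gp x y" "r \<le> gp y z"
  shows "r - h \<le> gp x z"
  using four_point[of \<one> x y z] assms by simp

lemma gp_chain3:
  assumes "w \<in> carrier G" "x \<in> carrier G" "y \<in> carrier G" "z \<in> carrier G"
    "r \<le> gp w x" "r \<le> gp x y" "r \<le> gp y z"
  shows "r - 2 * h \<le> gp w z"
  using gp_chain2[of w x y r] gp_chain2[of w y z "r - h"] assms h_nonneg by simp

text \<open>Together with \<open>segment_near_one\<close> this identifies the Gromov product, up to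
  2h + 1, with the distance from the identity to a geodesic.\<close>

lemma gp_le_between:
  assumes "u \<in> carrier G" "v \<in> carrier G" "p \<in> carrier G" "gd u v = gd u p + gd p v"
  shows "gp u v \<le> gd \<one> p"
  using gd_triangle[of \<one> p u] gd_triangle[of \<one> p v] gd_commute[of p u] assms
  unfolding gromov_product_def by simp

lemma gp_le_left:
  assumes "u \<in> carrier G" "v \<in> carrier G"
  shows "gp u v \<le> gd \<one> u"
  using gd_triangle[of \<one> u v] assms unfolding gromov_product_def by simp

text \<open>The point of the segment at distance about \<open>(\<one> | \<gamma> n)\<close> from \<open>\<gamma> 0\<close>, the product being
  taken at \<open>\<gamma> 0\<close>, is the one that is close to \<open>\<one>\<close>.\<close>

lemma segment_near_one:
  assumes closed: "\<And>i. i \<le> n \<Longrightarrow> \<gamma> i \<in> carrier G"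
    and geo: "\<And>i j. i \<le> n \<Longrightarrow> j \<le> n \<Longrightarrow> gd (\<gamma> i) (\<gamma> j) = \<bar>real i - real j\<bar>"
  obtains i where "i \<le> n" "gd \<one> (\<gamma> i) \<le> gp (\<gamma> 0) (\<gamma> n) + 2 * h + 1"
proof -
  define t where "t = (gd \<one> (\<gamma> 0) + real n - gd \<one> (\<gamma> n)) / 2"
  have c: "\<gamma> 0 \<in> carrier G" "\<gamma> n \<in> carrier G"
    using closed by auto
  have n: "gd (\<gamma> 0) (\<gamma> n) = real n"
    using geo by simp
  have t: "0 \<le> t" "t \<le> real n"
    using gd_triangle[of \<one> "\<gamma> 0" "\<gamma> n"] gd_triangle[of \<one> "\<gamma> n" "\<gamma> 0"] gd_commute[of "\<gamma> 0" "\<gamma> n"] c n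
    unfolding t_def by auto
  define i where "i = nat \<lfloor>t\<rfloor>"
  have i: "real i \<le> t" "t < real i + 1"
    using t unfolding i_def by linarith+
  then have "i \<le> n"
    using t by linarith
  define p where "p = \<gamma> i"
  have p: "p \<in> carrier G" "gd p (\<gamma> 0) = real i" "gd p (\<gamma> n) = real n - real i"
    using closed geo \<open>i \<le> n\<close> by (auto simp: p_def)
  \<comment> \<open>As \<open>p\<close> lies on the segment this product vanishes, so the four-point
    inequality at \<open>p\<close> makes one of its two products with the identity at most
    \<open>h\<close>. Rounding \<open>t\<close> down to \<open>i\<close> costs the extra 1.\<close>
  have "gromov_product p (\<gamma> 0) (\<gamma> n) = 0"
    using p n by (simp add: gromov_product_def)
  then have "gromov_product p (\<gamma> 0) \<one> \<le> h \<or> gromov_product p \<one> (\<gamma> n) \<le> h"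
    using four_point[of p "\<gamma> 0" \<one> "\<gamma> n"] p c by auto
  then have "gd \<one> p \<le> gp (\<gamma> 0) (\<gamma> n) + 2 * h + 1"
  proof
    assume "gromov_product p (\<gamma> 0) \<one> \<le> h"
    then have "gd \<one> p \<le> gd \<one> (\<gamma> 0) - real i + 2 * h"
      using p c gd_commute[of p \<one>] gd_commute[of "\<gamma> 0" \<one>] by (simp add: gromov_product_def)
    then show ?thesis
      using i n unfolding t_def gromov_product_def by argo
  next
    assume "gromov_product p \<one> (\<gamma> n) \<le> h"
    then have "gd \<one> p \<le> gd \<one> (\<gamma> n) - real n + real i + 2 * h"
      using p c gd_commute[of p \<one>] by (simp add: gromov_product_def)
    then show ?thesis
      using i n unfolding t_def gromov_product_def by argo
  qed
  then show ?thesis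
    using that \<open>i \<le> n\<close> by (simp add: p_def)
qed

text \<open>\<open>K\<close> depends on the rays, whose starting points and mutual distance are
  arbitrary. For rays from the identity \<open>based_asymptotic_close\<close> turns this into a
  bound depending on \<open>h\<close> alone.\<close>

lemma same_class_gp:
  assumes \<xi>: "\<xi> \<in> boundary" and \<rho>: "\<rho> \<in> \<xi>" and \<sigma>: "\<sigma> \<in> \<xi>"
  obtains K where "\<And>s t. min (real s) (real t) - K \<le> gp (\<rho> s) (\<sigma> t)"
proof -
  obtain C where C: "\<And>n. gd (\<rho> n) (\<sigma> n) \<le> C"
    using asymptoticD[OF boundary_mem_asymptotic[OF \<xi> \<rho> \<sigma>]] by metis
  note rays = boundary_mem_rays[OF \<xi> \<rho>] boundary_mem_rays[OF \<xi> \<sigma>]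
  have far: "real s - gd \<one> (\<tau> 0) \<le> gd \<one> (\<tau> s)" if "\<tau> \<in> rays" for \<tau> s
    using raysD(2)[OF that, of 0 s] gd_triangle[of "\<tau> 0" \<one> "\<tau> s"] gd_commute[of "\<tau> 0" \<one>]
      raysD(1)[OF that] by auto
  have "min (real s) (real t) - (gd \<one> (\<rho> 0) + gd \<one> (\<sigma> 0) + C) / 2 \<le> gp (\<rho> s) (\<sigma> t)" for s t
  proof -
    have "gd (\<rho> s) (\<sigma> t) \<le> \<bar>real s - real t\<bar> + C"
      using gd_triangle[of "\<rho> s" "\<rho> t" "\<sigma> t"] raysD[OF rays(1)] raysD[OF rays(2)] C[of t]
      by (metis (no_types, opaque_lifting) add_left_mono order_trans)
    then show ?thesis
      using far[OF rays(1), of s] far[OF rays(2), of t] unfolding gromov_product_def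
      by (auto simp: min_def abs_if field_simps split: if_splits)
  qed
  then show ?thesis using that by blast
qed

lemma based_ray_gp:
  assumes "\<rho> \<in> rays" "\<rho> 0 = \<one>"
  shows "gp (\<rho> s) (\<rho> t) = min (real s) (real t)"
  using ray_based[OF assms] raysD(2)[OF assms(1), of s t] by (auto simp: gromov_product_def)

text \<open>Along the chain \<open>\<rho> t\<close>, \<open>\<rho> s\<close>,
  \<open>\<sigma> s'\<close>, \<open>\<sigma> t\<close> all products are at least \<open>t\<close>,
  so the product of the ends is at least t - 2h; both ends have length \<open>t\<close>, which
  leaves a distance of at most 4h.\<close>

lemma based_rays_close:
  assumes \<rho>: "\<rho> \<in> rays" "\<rho> 0 = \<one>" and \<sigma>: "\<sigma> \<in> rays" "\<sigma> 0 = \<one>"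
    and t: "t \<le> s" "t \<le> s'" "real t \<le> gp (\<rho> s) (\<sigma> s')"
  shows "gd (\<rho> t) (\<sigma> t) \<le> 4 * h"
proof -
  have "real t - 2 * h \<le> gp (\<rho> t) (\<sigma> t)"
    using raysD(1)[OF \<rho>(1)] raysD(1)[OF \<sigma>(1)] t
    by (intro gp_chain3[of _ "\<rho> s" "\<sigma> s'"]) (auto simp: based_ray_gp \<rho> \<sigma>)
  then show ?thesis
    using ray_based[OF \<rho>] ray_based[OF \<sigma>] by (simp add: gromov_product_def)
qed

lemma based_asymptotic_close:
  assumes \<xi>: "\<xi> \<in> boundary" and \<rho>: "\<rho> \<in> \<xi>" "\<rho> 0 = \<one>" and \<sigma>: "\<sigma> \<in> \<xi>" "\<sigma> 0 = \<one>"
  shows "gd (\<rho> t) (\<sigma> t) \<le> 4 * h"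
proof -
  obtain K where K: "\<And>s t. min (real s) (real t) - K \<le> gp (\<rho> s) (\<sigma> t)"
    using same_class_gp[OF \<xi> \<rho>(1) \<sigma>(1)] by metis
  \<comment> \<open>Going \<open>K\<close> further out absorbs the constant that depends on the
    rays.\<close>
  define s where "s = t + nat \<lceil>K\<rceil>"
  have "real t \<le> gp (\<rho> s) (\<sigma> s)"
    using K[of s s] unfolding s_def by simp linarith
  then show ?thesis
    using boundary_mem_rays[OF \<xi>] \<rho> \<sigma> by (intro based_rays_close[of \<rho> \<sigma> t s s]) (auto simp: s_def)
qed

text \<open>A variant of \<open>bdry_nhd\<close> with rays from any starting point, so that the two
  halves of a line qualify as witnesses.\<close>

definition bdry_close :: "real \<Rightarrow> (nat \<Rightarrow> 'g) set \<Rightarrow> (nat \<Rightarrow> 'g) set \<Rightarrow> bool"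
  where "bdry_close r \<xi> \<eta> \<longleftrightarrow>
    (\<exists>\<rho>\<in>\<xi>. \<exists>\<sigma>\<in>\<eta>. \<exists>m. \<forall>s\<ge>m. \<forall>t\<ge>m. r \<le> gp (\<rho> s) (\<sigma> t))"

lemma bdry_close_mono: "bdry_close r \<xi> \<eta> \<Longrightarrow> r' \<le> r \<Longrightarrow> bdry_close r' \<xi> \<eta>"
  unfolding bdry_close_def by (meson order_trans)

text \<open>Products of two rays of the same class grow without bound, so far enough out both
  detours exceed \<open>r\<close> and only the 2h of the chain is lost.\<close>

lemma bdry_close_any_rays:
  assumes \<xi>: "\<xi> \<in> boundary" and \<eta>: "\<eta> \<in> boundary" and close: "bdry_close r \<xi> \<eta>"
    and \<rho>: "\<rho> \<in> \<xi>" and \<sigma>: "\<sigma> \<in> \<eta>"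
  obtains m where "\<And>s t. s \<ge> m \<Longrightarrow> t \<ge> m \<Longrightarrow> r - 2 * h \<le> gp (\<rho> s) (\<sigma> t)"
proof -
  obtain \<rho>' \<sigma>' m where *: "\<rho>' \<in> \<xi>" "\<sigma>' \<in> \<eta>" "\<And>s t. s \<ge> m \<Longrightarrow> t \<ge> m \<Longrightarrow> r \<le> gp (\<rho>' s) (\<sigma>' t)"
    using close unfolding bdry_close_def by blast
  obtain K where K: "\<And>s t. min (real s) (real t) - K \<le> gp (\<rho> s) (\<rho>' t)"
    using same_class_gp[OF \<xi> \<rho> *(1)] by metis
  obtain K' where K': "\<And>s t. min (real s) (real t) - K' \<le> gp (\<sigma>' s) (\<sigma> t)"
    using same_class_gp[OF \<eta> *(2) \<sigma>] by metis
  define M where "M = m + nat \<lceil>r + K\<rceil> + nat \<lceil>r + K'\<rceil>"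
  have M: "m \<le> M" "r + K \<le> real M" "r + K' \<le> real M"
    unfolding M_def by linarith+
  have "r - 2 * h \<le> gp (\<rho> s) (\<sigma> t)" if "s \<ge> M" "t \<ge> M" for s t
  proof (rule gp_chain3[of _ "\<rho>' M" "\<sigma>' M"])
    show "r \<le> gp (\<rho> s) (\<rho>' M)" "r \<le> gp (\<sigma>' M) (\<sigma> t)"
      using K[of s M] K'[of M t] M that by auto
    show "r \<le> gp (\<rho>' M) (\<sigma>' M)"
      using * M by blast
  qed (use boundary_mem_rays[OF \<xi>] boundary_mem_rays[OF \<eta>] raysD(1) \<rho> \<sigma> * in blast)+
  then show ?thesis using that by blast
qed

lemma bdry_close_trans:
  assumes \<xi>: "\<xi> \<in> boundary" and \<eta>: "\<eta> \<in> boundary" and \<zeta>: "\<zeta> \<in> boundary"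
    and 1: "bdry_close r \<xi> \<eta>" and 2: "bdry_close r \<eta> \<zeta>"
  shows "bdry_close (r - 2 * h) \<xi> \<zeta>"
proof -
  obtain \<rho> \<sigma> m where *: "\<rho> \<in> \<xi>" "\<sigma> \<in> \<eta>" "\<And>s t. s \<ge> m \<Longrightarrow> t \<ge> m \<Longrightarrow> r \<le> gp (\<rho> s) (\<sigma> t)"
    using 1 unfolding bdry_close_def by blast
  obtain \<sigma>' \<tau> m' where **: "\<sigma>' \<in> \<eta>" "\<tau> \<in> \<zeta>" "\<And>s t. s \<ge> m' \<Longrightarrow> t \<ge> m' \<Longrightarrow> r \<le> gp (\<sigma>' s) (\<tau> t)"
    using 2 unfolding bdry_close_def by blast
  obtain K where K: "\<And>s t. min (real s) (real t) - K \<le> gp (\<sigma> s) (\<sigma>' t)"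
    using same_class_gp[OF \<eta> *(2) **(1)] by metis
  define M where "M = max m m' + nat \<lceil>r + K\<rceil>"
  have M: "m \<le> M" "m' \<le> M" "r + K \<le> real M"
    unfolding M_def by linarith+
  have "r - 2 * h \<le> gp (\<rho> s) (\<tau> t)" if "s \<ge> M" "t \<ge> M" for s t
  proof (rule gp_chain3[of _ "\<sigma> M" "\<sigma>' M"])
    show "r \<le> gp (\<rho> s) (\<sigma> M)" "r \<le> gp (\<sigma>' M) (\<tau> t)"
      using *(3)[of s M] **(3)[of M t] M that by auto
    show "r \<le> gp (\<sigma> M) (\<sigma>' M)"
      using K[of M M] M by (auto simp: min_def)
  qed (use boundary_mem_rays[OF \<xi>] boundary_mem_rays[OF \<eta>] boundary_mem_rays[OF \<zeta>] raysD(1) * ** in blast)+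
  then show ?thesis
    using * ** unfolding bdry_close_def by blast
qed

lemma bdry_nhd_close: "\<eta> \<in> bdry_nhd \<xi> r \<Longrightarrow> bdry_close r \<xi> \<eta>"
  unfolding bdry_nhd_def bdry_close_def by blast

text \<open>Each segment of the line has a point whose distance from the identity is at most the
  product of its ends plus 2h + 1, and that distance is at least \<open>r\<close>. The segment is
  reindexed to start at time 0.\<close>

lemma joins_bdry_close:
  assumes "joins \<gamma> \<xi> \<eta>" and far: "\<And>i. r \<le> gd \<one> (\<gamma> i)"
  shows "bdry_close (r - 2 * h - 1) \<xi> \<eta>"
proof -
  have line: "geodesic UNIV \<gamma>" and ends: "(\<lambda>n. \<gamma> (- int n)) \<in> \<xi>" "(\<lambda>n. \<gamma> (int n)) \<in> \<eta>"
    using assms by (auto simp: joins_def)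
  have "r - 2 * h - 1 \<le> gp (\<gamma> (- int s)) (\<gamma> (int t))" for s t
  proof -
    obtain i where "gd \<one> (\<gamma> (int i - int s)) \<le> gp (\<gamma> (int 0 - int s)) (\<gamma> (int (s + t) - int s)) + 2 * h + 1"
      by (rule segment_near_one[of "s + t" "\<lambda>i. \<gamma> (int i - int s)"]) (auto simp: lineD[OF line])
    then show ?thesis
      using far[of "int i - int s"] by simp
  qed
  then show ?thesis
    unfolding bdry_close_def by (intro bexI[OF _ ends(1)] bexI[OF _ ends(2)] exI[of _ 0]) simp
qed

text \<open>Valid for every joining line. Combined with \<open>joins_bdry_close\<close>, all lines
  between the same two points keep the same distance from the identity up to a constant.\<close>

lemma bdry_close_joins:
  assumes "\<xi> \<in> boundary" "\<eta> \<in> boundary" "bdry_close r \<xi> \<eta>" "joins \<gamma> \<xi> \<eta>"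
  shows "r - 2 * h \<le> gd \<one> (\<gamma> i)"
proof -
  have line: "geodesic UNIV \<gamma>" and ends: "(\<lambda>n. \<gamma> (- int n)) \<in> \<xi>" "(\<lambda>n. \<gamma> (int n)) \<in> \<eta>"
    using assms by (auto simp: joins_def)
  obtain m where m: "\<And>s t. s \<ge> m \<Longrightarrow> t \<ge> m \<Longrightarrow> r - 2 * h \<le> gp (\<gamma> (- int s)) (\<gamma> (int t))"
    using bdry_close_any_rays[OF assms(1-3) ends] by metis
  define s where "s = m + nat \<bar>i\<bar>"
  have "r - 2 * h \<le> gp (\<gamma> (- int s)) (\<gamma> (int s))"
    by (rule m) (simp_all add: s_def)
  also have "\<dots> \<le> gd \<one> (\<gamma> i)"
    using lineD[OF line] by (intro gp_le_between) (auto simp: s_def)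
  finally show ?thesis .
qed

text \<open>Time 0 is moved to the point near the identity, and the segment is extended by constants
  to all integers. Diagonal limits then apply to total functions, and the Lipschitz bound, which
  survives the extension, gives finitely many values at each time.\<close>

lemma centred_segment:
  assumes x: "x \<in> carrier G" and y: "y \<in> carrier G"
  shows "\<exists>f p q. (\<forall>i. f i \<in> carrier G) \<and> gd \<one> (f 0) \<le> gp x y + 2 * h + 1 \<and>
    (\<forall>i. gd (f 0) (f i) \<le> \<bar>real_of_int i\<bar>) \<and> f (- int p) = x \<and> f (int q) = y \<and>
    (\<forall>i j. - int p \<le> i \<and> i \<le> int q \<and> - int p \<le> j \<and> j \<le> int q
      \<longrightarrow> gd (f i) (f j) = \<bar>real_of_int i - real_of_int j\<bar>)"
proof -
  define n where "n = wdist x y"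
  obtain \<gamma> where \<gamma>: "\<gamma> 0 = x" "\<gamma> n = y" "\<And>i. \<gamma> i \<in> carrier G"
    "\<And>i j. i \<le> n \<Longrightarrow> j \<le> n \<Longrightarrow> gd (\<gamma> i) (\<gamma> j) = \<bar>real i - real j\<bar>"
    unfolding n_def using ex_geodesic_segment[OF x y] by metis
  obtain p where p: "p \<le> n" "gd \<one> (\<gamma> p) \<le> gp (\<gamma> 0) (\<gamma> n) + 2 * h + 1"
    using segment_near_one[of n \<gamma>] \<gamma> by metis
  define q where "q = n - p"
  define c where "c i = nat (max 0 (min (int n) (int p + i)))" for i
  have c: "c i \<le> n" "c 0 = p" "c (- int p) = 0" "c (int q) = n" for i
    using p by (auto simp: c_def q_def)
  have c_eq: "real (c i) = real p + real_of_int i" if "- int p \<le> i" "i \<le> int q" for i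
    using that p unfolding c_def q_def by (simp add: max_def min_def)
  have c_lip: "\<bar>real p - real (c i)\<bar> \<le> \<bar>real_of_int i\<bar>" for i
    using p(1) unfolding c_def by (simp add: max_def min_def)
  have "gd (\<gamma> (c 0)) (\<gamma> (c i)) \<le> \<bar>real_of_int i\<bar>" for i
    using \<gamma>(4)[OF c(1)[of 0] c(1)[of i]] c(2) c_lip[of i] by simp
  moreover have "gd (\<gamma> (c i)) (\<gamma> (c j)) = \<bar>real_of_int i - real_of_int j\<bar>"
    if "- int p \<le> i" "i \<le> int q" "- int p \<le> j" "j \<le> int q" for i j
    using \<gamma>(4)[OF c(1)[of i] c(1)[of j]] c_eq[of i] c_eq[of j] that by simp
  ultimately show ?thesis
    using \<gamma> p c by (intro exI[of _ "\<lambda>i. \<gamma> (c i)"] exI[of _ p] exI[of _ q]) auto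
qed

text \<open>\<open>x\<close> lies at distance \<open>i\<close> along a geodesic from
  \<open>x\<^sub>0\<close> to \<open>\<rho> m\<close>. Both \<open>x\<close> and
  \<open>\<rho> i\<close> have product at least i - c with \<open>\<rho> m\<close>, hence at least i
  - c - h with each other; the bound is (i + c) + i - 2(i - c - h).\<close>

lemma fellow_travel:
  assumes x: "x\<^sub>0 \<in> carrier G" "x \<in> carrier G" and \<rho>: "\<rho> \<in> rays" "\<rho> 0 = \<one>"
    and c: "gd \<one> x\<^sub>0 \<le> c" and i: "gd x\<^sub>0 x = real i" "i \<le> m"
    and between: "gd x (\<rho> m) = gd x\<^sub>0 (\<rho> m) - real i"
  shows "gd x (\<rho> i) \<le> 3 * c + 2 * h"
proof -
  have \<rho>c: "\<rho> k \<in> carrier G" "gd \<one> (\<rho> k) = real k" for k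
    using raysD(1)[OF \<rho>(1)] ray_based[OF \<rho>] by auto
  have x_len: "real i - c \<le> gd \<one> x" "gd \<one> x \<le> real i + c"
    using gd_triangle[of x\<^sub>0 \<one> x] gd_triangle[of \<one> x\<^sub>0 x] gd_commute[of x\<^sub>0 \<one>] x c i by auto
  have "gd x\<^sub>0 (\<rho> m) \<le> c + real m"
    using gd_triangle[of x\<^sub>0 \<one> "\<rho> m"] gd_commute[of x\<^sub>0 \<one>] x \<rho>c c by auto
  then have "real i - c \<le> gp x (\<rho> m)"
    using x_len \<rho>c(2)[of m] between by (simp add: gromov_product_def)
  moreover have "real i - c \<le> gp (\<rho> m) (\<rho> i)"
    using based_ray_gp[OF \<rho>, of m i] i c of_nat_0_le_iff[of "wdist \<one> x\<^sub>0"] by (simp add: min_def)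
  ultimately have "real i - c - h \<le> gp x (\<rho> i)"
    using x \<rho>c by (intro gp_chain2[of _ "\<rho> m"])
  then show ?thesis
    using x_len \<rho>c(2)[of i] by (simp add: gromov_product_def)
qed

text \<open>Segments from \<open>\<rho> n\<close> to \<open>\<sigma> n\<close> pass within a bounded
  distance of the identity, because the two rays are not asymptotic. Centred there, they have a
  diagonal limit, and \<open>fellow_travel\<close> compares the two halves of this limit with
  \<open>\<rho>\<close> and \<open>\<sigma>\<close>.\<close>

lemma ex_line:
  assumes \<xi>: "\<xi> \<in> boundary" and \<eta>: "\<eta> \<in> boundary" and ne: "\<xi> \<noteq> \<eta>"
    and \<rho>: "\<rho> \<in> \<xi>" "\<rho> 0 = \<one>" and \<sigma>: "\<sigma> \<in> \<eta>" "\<sigma> 0 = \<one>"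
  obtains \<gamma> where "joins \<gamma> \<xi> \<eta>"
proof -
  have ray: "\<rho> \<in> rays" "\<sigma> \<in> rays"
    using boundary_mem_rays \<xi> \<eta> \<rho> \<sigma> by auto
  note closed = raysD(1)[OF ray(1)] raysD(1)[OF ray(2)]
  \<comment> \<open>Unbounded products would keep the rays within 4h of each other at all
    times.\<close>
  have "\<exists>c. \<forall>n. gp (\<rho> n) (\<sigma> n) \<le> c"
  proof (rule ccontr)
    assume unbounded: "\<not> ?thesis"
    have "gd (\<rho> t) (\<sigma> t) \<le> 4 * h" for t
    proof -
      obtain n where n: "real t < gp (\<rho> n) (\<sigma> n)"
        using unbounded by (meson not_le)
      then have "t \<le> n"
        using gp_le_left[OF closed(1)[of n] closed(2)[of n]] ray_based[OF ray(1) \<rho>(2), of n] by linarith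
      then show ?thesis
        using n by (intro based_rays_close[OF ray(1) \<rho>(2) ray(2) \<sigma>(2)]) auto
    qed
    then have "\<xi> = \<eta>"
      using boundary_eqI[OF \<xi> \<eta> \<rho>(1) \<sigma>(1)] asymptoticI[OF ray] by blast
    then show False using ne by blast
  qed
  then obtain c\<^sub>0 where c\<^sub>0: "\<And>n. gp (\<rho> n) (\<sigma> n) \<le> c\<^sub>0" by blast
  define c where "c = c\<^sub>0 + 2 * h + 1"
  have "\<exists>f p q. (\<forall>i. f i \<in> carrier G) \<and> gd \<one> (f 0) \<le> gp (\<rho> n) (\<sigma> n) + 2 * h + 1 \<and>
    (\<forall>i. gd (f 0) (f i) \<le> \<bar>real_of_int i\<bar>) \<and> f (- int p) = \<rho> n \<and> f (int q) = \<sigma> n \<and>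
    (\<forall>i j. - int p \<le> i \<and> i \<le> int q \<and> - int p \<le> j \<and> j \<le> int q
      \<longrightarrow> gd (f i) (f j) = \<bar>real_of_int i - real_of_int j\<bar>)" for n
    by (rule centred_segment[OF closed])
  then obtain f p q where f: "\<And>n i. f n i \<in> carrier G"
    and f0: "\<And>n. gd \<one> (f n 0) \<le> gp (\<rho> n) (\<sigma> n) + 2 * h + 1"
    and f_lip: "\<And>n i. gd (f n 0) (f n i) \<le> \<bar>real_of_int i\<bar>"
    and f_ends: "\<And>n. f n (- int (p n)) = \<rho> n" "\<And>n. f n (int (q n)) = \<sigma> n"
    and f_geo: "\<And>n i j. - int (p n) \<le> i \<Longrightarrow> i \<le> int (q n) \<Longrightarrow> - int (p n) \<le> j \<Longrightarrow> j \<le> int (q n)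
      \<Longrightarrow> gd (f n i) (f n j) = \<bar>real_of_int i - real_of_int j\<bar>"
    by metis
  have f0c: "gd \<one> (f n 0) \<le> c" for n
    using f0[of n] c\<^sub>0[of n] by (simp add: c_def)
  \<comment> \<open>Both halves of the \<open>n\<close>-th segment have length at least n - c, so
    every finite window of times eventually lies inside the segments.\<close>
  have p: "real n - c \<le> real (p n)" for n
    using f_geo[of n 0 "- int (p n)"] f_ends(1)[of n] gd_triangle[of \<one> "f n 0" "\<rho> n"] f[of n 0] closed(1)[of n]
      ray_based[OF ray(1) \<rho>(2), of n] f0c[of n] by auto
  have q: "real n - c \<le> real (q n)" for n
    using f_geo[of n 0 "int (q n)"] f_ends(2)[of n] gd_triangle[of \<one> "f n 0" "\<sigma> n"] f[of n 0] closed(2)[of n]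
      ray_based[OF ray(2) \<sigma>(2), of n] f0c[of n] by auto
  have "finite (range (\<lambda>n. f n i))" for i
  proof (rule finite_subset)
    show "range (\<lambda>n. f n i) \<subseteq> {x \<in> carrier G. wlen x \<le> nat \<lceil>c + \<bar>real_of_int i\<bar>\<rceil>}"
    proof clarify
      fix n
      have "real (wlen (f n i)) \<le> c + \<bar>real_of_int i\<bar>"
        using gd_triangle[of \<one> "f n 0" "f n i"] f0c[of n] f_lip[of n i] f by simp
      then show "f n i \<in> carrier G \<and> wlen (f n i) \<le> nat \<lceil>c + \<bar>real_of_int i\<bar>\<rceil>"
        using f[of n i] by linarith
    qed
  qed (rule finite_wlen_le)
  then obtain s g where s: "strict_mono (s :: nat \<Rightarrow> nat)"
    and g: "\<And>i. \<forall>\<^sub>F n in sequentially. f (s n) i = g i"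
    using diagonal_limit[of f] by metis
  have large: "\<exists>n. real N \<le> real (s n) - c \<and> f (s n) i = g i \<and> f (s n) j = g j \<and> f (s n) 0 = g 0" for N i j
  proof -
    have "\<forall>\<^sub>F n in sequentially. f (s n) i = g i \<and> f (s n) j = g j \<and> f (s n) 0 = g 0"
      using g by (intro eventually_conj)
    then obtain n where "n \<ge> N + nat \<lceil>c\<rceil>" "f (s n) i = g i \<and> f (s n) j = g j \<and> f (s n) 0 = g 0"
      by (rule eventually_sequentially_obtain_ge)
    moreover have "n \<le> s n"
      using s by (rule seq_suble)
    ultimately show ?thesis
      by (intro exI[of _ n]) linarith
  qed
  have gc: "g i \<in> carrier G" for i
    using large[of 0 i i] f by metis
  have g_geo: "gd (g i) (g j) = \<bar>real_of_int i - real_of_int j\<bar>" for i j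
  proof -
    obtain n where n: "real (nat \<bar>i\<bar> + nat \<bar>j\<bar>) \<le> real (s n) - c" "f (s n) i = g i" "f (s n) j = g j"
      using large[of "nat \<bar>i\<bar> + nat \<bar>j\<bar>" i j] by blast
    then have "gd (f (s n) i) (f (s n) j) = \<bar>real_of_int i - real_of_int j\<bar>"
      using p[of "s n"] q[of "s n"] by (intro f_geo) linarith+
    then show ?thesis using n by simp
  qed
  have line: "geodesic UNIV g"
    by (intro lineI gc g_geo)
  have half: "(\<lambda>n. g (int n)) \<in> rays" "(\<lambda>n. g (- int n)) \<in> rays"
    using gc g_geo by (auto intro!: raysI)
  have "gd (g (- int i)) (\<rho> i) \<le> 3 * c + 2 * h" for i
  proof -
    obtain n where n: "real i \<le> real (s n) - c" "f (s n) (- int i) = g (- int i)" "f (s n) 0 = g 0"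
      using large[of i "- int i" 0] by blast
    have c0: "0 \<le> c"
      using f0c[of 0] by (metis of_nat_0_le_iff order_trans)
    have i: "i \<le> p (s n)"
      using n p[of "s n"] by linarith
    show ?thesis
    proof (rule fellow_travel[of "g 0" _ _ c _ "s n"])
      show "gd \<one> (g 0) \<le> c"
        using f0c[of "s n"] n by simp
      show "i \<le> s n"
        using n c0 by linarith
      show "gd (g (- int i)) (\<rho> (s n)) = gd (g 0) (\<rho> (s n)) - real i"
        using f_geo[of "s n" "- int i" "- int (p (s n))"] f_geo[of "s n" 0 "- int (p (s n))"]
          f_ends(1)[of "s n"] n i by simp
    qed (use gc ray \<rho> g_geo in auto)
  qed
  then have "(\<rho>, \<lambda>n. g (- int n)) \<in> asymptotic"
    using ray half gd_commute gc closed by (intro asymptoticI[where C = "3 * c + 2 * h"]) auto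
  then have 1: "(\<lambda>n. g (- int n)) \<in> \<xi>"
    using boundary_mem_closed[OF \<xi> \<rho>(1)] by blast
  have "gd (g (int i)) (\<sigma> i) \<le> 3 * c + 2 * h" for i
  proof -
    obtain n where n: "real i \<le> real (s n) - c" "f (s n) (int i) = g (int i)" "f (s n) 0 = g 0"
      using large[of i "int i" 0] by blast
    have c0: "0 \<le> c"
      using f0c[of 0] by (metis of_nat_0_le_iff order_trans)
    have i: "i \<le> q (s n)"
      using n q[of "s n"] by linarith
    show ?thesis
    proof (rule fellow_travel[of "g 0" _ _ c _ "s n"])
      show "gd \<one> (g 0) \<le> c"
        using f0c[of "s n"] n by simp
      show "i \<le> s n"
        using n c0 by linarith
      show "gd (g (int i)) (\<sigma> (s n)) = gd (g 0) (\<sigma> (s n)) - real i"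
        using f_geo[of "s n" "int i" "int (q (s n))"] f_geo[of "s n" 0 "int (q (s n))"]
          f_ends(2)[of "s n"] n i by simp
    qed (use gc ray \<sigma> g_geo in auto)
  qed
  then have "(\<sigma>, \<lambda>n. g (int n)) \<in> asymptotic"
    using ray half gd_commute gc closed by (intro asymptoticI[where C = "3 * c + 2 * h"]) auto
  then have 2: "(\<lambda>n. g (int n)) \<in> \<eta>"
    using boundary_mem_closed[OF \<eta> \<sigma>(1)] by blast
  show ?thesis
    using that line 1 2 by (auto simp: joins_def)
qed

end

text \<open>That each class contains a ray from the identity is assumed here and later read off from
  the covers: their members lie in unions of spans, whose points have such rays by
  definition.\<close>

locale based_boundary = four_point +
  assumes based: "\<xi> \<in> boundary \<Longrightarrow> \<exists>\<rho>\<in>\<xi>. \<rho> 0 = \<one>"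
begin

lemma bdry_close_nhd:
  assumes "\<xi> \<in> boundary" "\<eta> \<in> boundary" "bdry_close r \<xi> \<eta>"
  shows "\<eta> \<in> bdry_nhd \<xi> (r - 2 * h)"
proof -
  obtain \<rho> \<sigma> where "\<rho> \<in> \<xi>" "\<rho> 0 = \<one>" "\<sigma> \<in> \<eta>" "\<sigma> 0 = \<one>"
    using based assms by metis
  moreover from this obtain m where "\<And>s t. s \<ge> m \<Longrightarrow> t \<ge> m \<Longrightarrow> r - 2 * h \<le> gp (\<rho> s) (\<sigma> t)"
    using bdry_close_any_rays[OF assms] by metis
  ultimately show ?thesis
    unfolding bdry_nhd_def using assms by blast
qed

text \<open>\<open>line_depth\<close> is a \<open>Max\<close> and has meaning only for a finite set.
  A line that keeps distance n from the identity pushes any fixed line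
  \<open>\<gamma>\<^sub>0\<close> with the same ends out to n - 4h - 1.\<close>

lemma finite_line_depths:
  assumes \<xi>: "\<xi> \<in> boundary" and \<eta>: "\<eta> \<in> boundary"
  shows "finite {INF i. wdist \<one> (\<gamma> i) | \<gamma>. joins \<gamma> \<xi> \<eta>}"
proof (cases "\<exists>\<gamma>. joins \<gamma> \<xi> \<eta>")
  case True
  then obtain \<gamma>\<^sub>0 where \<gamma>\<^sub>0: "joins \<gamma>\<^sub>0 \<xi> \<eta>" by blast
  define B where "B = nat \<lceil>gd \<one> (\<gamma>\<^sub>0 0) + 4 * h + 1\<rceil>"
  have "(INF i. wdist \<one> (\<gamma> i)) \<le> B" if "joins \<gamma> \<xi> \<eta>" for \<gamma>
  proof -
    define n where "n = (INF i. wdist \<one> (\<gamma> i))"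
    have "real n \<le> gd \<one> (\<gamma> i)" for i
      unfolding n_def of_nat_le_iff by (rule INF_nat_le)
    then have "bdry_close (real n - 2 * h - 1) \<xi> \<eta>"
      by (rule joins_bdry_close[OF that])
    then have "real n - 2 * h - 1 - 2 * h \<le> gd \<one> (\<gamma>\<^sub>0 0)"
      by (rule bdry_close_joins[OF \<xi> \<eta> _ \<gamma>\<^sub>0])
    then show ?thesis
      unfolding n_def B_def by linarith
  qed
  then have "{INF i. wdist \<one> (\<gamma> i) | \<gamma>. joins \<gamma> \<xi> \<eta>} \<subseteq> {..B}"
    by blast
  then show ?thesis
    using finite_subset by blast
qed simp

lemma line_depth_attained:
  assumes \<xi>: "\<xi> \<in> boundary" and \<eta>: "\<eta> \<in> boundary" and ne: "\<xi> \<noteq> \<eta>"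
  obtains \<gamma> where "joins \<gamma> \<xi> \<eta>" "\<And>i. line_depth \<xi> \<eta> \<le> wdist \<one> (\<gamma> i)"
proof -
  have "\<exists>\<gamma>. joins \<gamma> \<xi> \<eta>"
    using based[OF \<xi>] based[OF \<eta>] ex_line[OF \<xi> \<eta> ne] by metis
  then have "line_depth \<xi> \<eta> \<in> {INF i. wdist \<one> (\<gamma> i) | \<gamma>. joins \<gamma> \<xi> \<eta>}"
    unfolding line_depth_def by (intro Max_in finite_line_depths \<xi> \<eta>) blast
  then obtain \<gamma> where "joins \<gamma> \<xi> \<eta>" "line_depth \<xi> \<eta> = (INF i. wdist \<one> (\<gamma> i))"
    by blast
  then show ?thesis
    using that INF_nat_le[of "\<lambda>i. wdist \<one> (\<gamma> i)"] by metis
qed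

lemma line_depth_ge:
  assumes \<xi>: "\<xi> \<in> boundary" and \<eta>: "\<eta> \<in> boundary" and ne: "\<xi> \<noteq> \<eta>" and close: "bdry_close r \<xi> \<eta>"
  shows "r - 2 * h \<le> line_depth \<xi> \<eta>"
proof -
  obtain \<gamma> where \<gamma>: "joins \<gamma> \<xi> \<eta>"
    using line_depth_attained[OF \<xi> \<eta> ne] by metis
  have "(INF i. wdist \<one> (\<gamma> i)) \<in> range (\<lambda>i. wdist \<one> (\<gamma> i))"
    by (intro Inf_nat_def1) auto
  then obtain i where "(INF i. wdist \<one> (\<gamma> i)) = wdist \<one> (\<gamma> i)"
    by blast
  then have "r - 2 * h \<le> real (INF i. wdist \<one> (\<gamma> i))"
    using bdry_close_joins[OF \<xi> \<eta> close \<gamma>, of i] by simp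
  also have "(INF i. wdist \<one> (\<gamma> i)) \<le> line_depth \<xi> \<eta>"
    unfolding line_depth_def by (intro Max_ge finite_line_depths \<xi> \<eta>) (use \<gamma> in blast)
  finally show ?thesis by simp
qed

text \<open>Rays from the identity have finitely many possible values at each time, so a subsequence
  stabilises pointwise. Agreement at the single time \<open>T\<close> already makes all later
  products at least T - h.\<close>

lemma boundary_sequentially_compact:
  fixes \<xi>s :: "nat \<Rightarrow> (nat \<Rightarrow> 'a) set"
  assumes "\<And>n. \<xi>s n \<in> boundary"
  obtains \<xi> s where "\<xi> \<in> boundary" "strict_mono (s :: nat \<Rightarrow> nat)"
    "\<And>r. \<forall>\<^sub>F n in sequentially. \<xi>s (s n) \<in> bdry_nhd \<xi> r"
proof -
  obtain R where R: "\<And>n. R n \<in> \<xi>s n" "\<And>n. R n 0 = \<one>"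
    using bchoice[of UNIV "\<lambda>n \<rho>. \<rho> \<in> \<xi>s n \<and> \<rho> 0 = \<one>"] based[OF assms] by blast
  have ray: "R n \<in> rays" for n
    using R assms boundary_mem_rays by blast
  note closed = raysD(1)[OF ray]
  have "finite (range (\<lambda>n. R n i))" for i
  proof (rule finite_subset)
    show "range (\<lambda>n. R n i) \<subseteq> {x \<in> carrier G. wlen x \<le> i}"
      using ray_based[OF ray R(2)] closed by auto
  qed (rule finite_wlen_le)
  then obtain s \<rho> where s: "strict_mono (s :: nat \<Rightarrow> nat)"
    and \<rho>: "\<And>i. \<forall>\<^sub>F n in sequentially. R (s n) i = \<rho> i"
    using diagonal_limit[of R] by metis
  have agree: "\<exists>n. R (s n) i = \<rho> i \<and> R (s n) j = \<rho> j" for i j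
    using eventually_happens[OF eventually_conj[OF \<rho> \<rho>]] by simp
  have \<rho>_ray: "\<rho> \<in> rays"
  proof (rule raysI)
    show "\<rho> i \<in> carrier G" for i
      using agree[of i i] closed by metis
    show "gd (\<rho> i) (\<rho> j) = \<bar>real i - real j\<bar>" for i j
      using agree[of i j] raysD(2)[OF ray] by metis
  qed
  have \<rho>0: "\<rho> 0 = \<one>"
    using agree[of 0 0] R by metis
  define \<xi> where "\<xi> = asymptotic `` {\<rho>}"
  have \<xi>: "\<xi> \<in> boundary" "\<rho> \<in> \<xi>"
    using boundary_class[OF \<rho>_ray] by (auto simp: \<xi>_def)
  have "\<forall>\<^sub>F n in sequentially. \<xi>s (s n) \<in> bdry_nhd \<xi> r" for r
  proof -
    define T where "T = nat \<lceil>r + h\<rceil>"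
    have T: "r \<le> real T - h"
      unfolding T_def by linarith
    have "\<xi>s (s n) \<in> bdry_nhd \<xi> r" if n: "R (s n) T = \<rho> T" for n
    proof -
      have "r \<le> gp (\<rho> u) (R (s n) v)" if "u \<ge> T" "v \<ge> T" for u v
      proof -
        have "real T - h \<le> gp (\<rho> u) (R (s n) v)"
          using raysD(1)[OF \<rho>_ray] closed n that based_ray_gp[OF \<rho>_ray \<rho>0, of u T]
            based_ray_gp[OF ray R(2), of "s n" T v]
          by (intro gp_chain2[of _ "\<rho> T"]) auto
        then show ?thesis using T by linarith
      qed
      then have "\<exists>m. \<forall>u\<ge>m. \<forall>v\<ge>m. r \<le> gp (\<rho> u) (R (s n) v)"
        by blast
      then show ?thesis
        unfolding bdry_nhd_def using assms[of "s n"] \<xi>(2) \<rho>0 R[of "s n"]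
        by (intro CollectI conjI bexI[of _ \<rho>] bexI[of _ "R (s n)"])
    qed
    then show ?thesis
      by (rule eventually_mono[OF \<rho>[of T]])
  qed
  then show ?thesis
    using that \<xi> s by blast
qed

text \<open>The Lebesgue number is expressed by lines instead of a metric: a left translation
  carries lines to lines and changes their distance from the identity in a controlled way. The proof
  takes a limit of counterexamples; a member around the limit of one end also captures the other
  end.\<close>

lemma open_cover_lebesgue:
  assumes opens: "\<And>V. V \<in> \<V> \<Longrightarrow> openin bdry_topology V" and cover: "\<Union>\<V> = boundary"
  obtains r :: real where "\<And>\<gamma> \<xi> \<eta>. \<xi> \<in> boundary \<Longrightarrow> \<eta> \<in> boundary \<Longrightarrow> joins \<gamma> \<xi> \<eta> \<Longrightarrow>
    (\<And>i. r \<le> gd \<one> (\<gamma> i)) \<Longrightarrow> \<exists>V\<in>\<V>. \<xi> \<in> V \<and> \<eta> \<in> V"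
proof (rule ccontr)
  assume no: "\<not> thesis"
  have "\<exists>\<xi> \<eta> \<gamma>. \<xi> \<in> boundary \<and> \<eta> \<in> boundary \<and> joins \<gamma> \<xi> \<eta> \<and> (\<forall>i. real n \<le> gd \<one> (\<gamma> i)) \<and>
      \<not> (\<exists>V\<in>\<V>. \<xi> \<in> V \<and> \<eta> \<in> V)" for n :: nat
  proof (rule ccontr)
    assume *: "\<not> ?thesis"
    have thesis
    proof (rule that[of "real n"])
      fix \<gamma> \<xi> \<eta>
      assume "\<xi> \<in> boundary" "\<eta> \<in> boundary" "joins \<gamma> \<xi> \<eta>" "\<And>i. real n \<le> gd \<one> (\<gamma> i)"
      then have "\<xi> \<in> boundary \<and> \<eta> \<in> boundary \<and> joins \<gamma> \<xi> \<eta> \<and> (\<forall>i. real n \<le> gd \<one> (\<gamma> i))"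
        by simp
      then show "\<exists>V\<in>\<V>. \<xi> \<in> V \<and> \<eta> \<in> V"
        using * by meson
    qed
    then show False using no by contradiction
  qed
  then obtain \<xi>s \<eta>s \<gamma>s where bd: "\<And>n. \<xi>s n \<in> boundary" "\<And>n. \<eta>s n \<in> boundary"
    and joins: "\<And>n :: nat. joins (\<gamma>s n) (\<xi>s n) (\<eta>s n)" "\<And>n i. real n \<le> gd \<one> (\<gamma>s n i)"
    and sep: "\<And>n. \<not> (\<exists>V\<in>\<V>. \<xi>s n \<in> V \<and> \<eta>s n \<in> V)"
    by metis
  obtain \<xi> s where \<xi>: "\<xi> \<in> boundary" and s: "strict_mono (s :: nat \<Rightarrow> nat)"
    and lim: "\<And>r. \<forall>\<^sub>F n in sequentially. \<xi>s (s n) \<in> bdry_nhd \<xi> r"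
    using boundary_sequentially_compact[of \<xi>s] bd by metis
  obtain V r where V: "V \<in> \<V>" "bdry_nhd \<xi> r \<subseteq> V"
    using \<xi> cover opens unfolding openin_bdry_topology by blast
  \<comment> \<open>Pays for two losses of 2h, one in \<open>bdry_close_trans\<close> and one in
    \<open>bdry_close_nhd\<close>.\<close>
  define r' where "r' = r + 4 * h"
  obtain n where n: "n \<ge> nat \<lceil>r' + 2 * h + 1\<rceil>" "\<xi>s (s n) \<in> bdry_nhd \<xi> r'"
    using eventually_sequentially_obtain_ge[OF lim] by metis
  have "n \<le> s n"
    using s by (rule seq_suble)
  then have "r' \<le> real (s n) - 2 * h - 1"
    using n by linarith
  then have "bdry_close r' (\<xi>s (s n)) (\<eta>s (s n))"
    using joins_bdry_close[OF joins] bdry_close_mono by blast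
  then have "bdry_close (r' - 2 * h) \<xi> (\<eta>s (s n))"
    using bdry_close_trans \<xi> bd bdry_nhd_close[OF n(2)] by blast
  then have "\<eta>s (s n) \<in> bdry_nhd \<xi> (r' - 2 * h - 2 * h)"
    using bdry_close_nhd \<xi> bd by blast
  then have "\<eta>s (s n) \<in> V"
    using V by (auto simp: r'_def)
  moreover have "\<xi>s (s n) \<in> V"
    using V n h_nonneg bdry_nhd_antimono[of r r' \<xi>] by (auto simp: r'_def)
  ultimately show False
    using sep V by blast
qed

end

section \<open>Finitely many types and the uniform Lebesgue number\<close>

lemma Least_no_witness: "(\<And>n. \<not> P n) \<Longrightarrow> (LEAST n. P n) = (LEAST n :: nat. False)"
  by (rule arg_cong[where f = Least]) auto

lemma finite_bound:
  fixes f :: "'c \<Rightarrow> real"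
  assumes "finite T"
  obtains c :: real where "\<And>t. t \<in> T \<Longrightarrow> f t \<le> c"
  using assms that[of "Max (f ` T)"] by auto

context generated_group
begin

text \<open>Cancelling the last letter of a shortest word shortens \<open>y\<close> by one, so the
  \<open>LEAST\<close> in \<open>up\<close> has a witness.\<close>

lemma up_closed:
  assumes y: "y \<in> carrier G" "y \<noteq> \<one>"
  shows "up y \<in> carrier G" "Suc (wlen (up y)) = wlen y"
proof -
  obtain ws where ws: "set ws \<subseteq> set ss" "length ws = wlen y" "word ws = y"
    using wlen_word[OF y(1)] by blast
  have "ws \<noteq> []"
    using ws y by auto
  then obtain vs w where vs: "ws = vs @ [w]"
    by (metis append_butlast_last_id)
  have w: "w \<in> set ss" "w \<in> carrier G" "set vs \<subseteq> set ss"
    using ws vs gen_closed by auto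
  then have "y = word vs \<otimes> w"
    using word_append[of vs "[w]"] ws vs by (simp del: foldr_append)
  then have eq: "y \<otimes> inv w = word vs"
    using w by (simp add: m_assoc)
  have "wlen (word vs) \<le> length vs"
    using w by (intro wlen_le)
  moreover have "wlen y \<le> wlen (word vs) + wlen w"
    using \<open>y = word vs \<otimes> w\<close> w wlen_mult[of "word vs" w] by simp
  moreover have "wlen w \<le> 1"
    using wlen_le[of "[w]"] w by simp
  moreover have "length vs + 1 = wlen y"
    using ws vs by simp
  ultimately have len: "int (wlen (y \<otimes> inv w)) = int (wlen y) - 1"
    unfolding eq by linarith
  obtain i where "i < length ss" "ss ! i = inv w"
    using gens_inv[OF w(1)] by (metis in_set_conv_nth)
  then have "\<exists>i. i < length ss \<and> int (wlen (y \<otimes> ss ! i)) = int (wlen y) - 1"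
    using len by metis
  from LeastI_ex[OF this] show "up y \<in> carrier G" "Suc (wlen (up y)) = wlen y"
    using y(1) gen_closed[OF nth_mem] unfolding up_def by auto
qed

lemma up_iter_closed:
  assumes "y \<in> carrier G" "j \<le> wlen y"
  shows "(up ^^ j) y \<in> carrier G \<and> wlen ((up ^^ j) y) = wlen y - j"
  using assms(2)
proof (induction j)
  case (Suc j)
  then have IH: "(up ^^ j) y \<in> carrier G" "wlen ((up ^^ j) y) = wlen y - j"
    by auto
  then have "(up ^^ j) y \<noteq> \<one>"
    using Suc.prems by auto
  then show ?case
    using up_closed[OF IH(1)] IH by auto
qed (use assms in simp)

text \<open>After \<open>wlen y\<close> steps the identity is reached; from then on the iteration no
  longer depends on \<open>y\<close>, whatever \<open>up\<close> does at the identity.\<close>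

lemma up_iter_beyond:
  assumes "y \<in> carrier G" "wlen y \<le> j"
  shows "(up ^^ j) y = (up ^^ (j - wlen y)) \<one>"
proof -
  have "(up ^^ wlen y) y = \<one>"
    using up_iter_closed[of y "wlen y"] assms wlen_eq_0_iff[of "(up ^^ wlen y) y"] by simp
  then show ?thesis
    using assms funpow_add[of "j - wlen y" "wlen y" up] by simp
qed

lemma finite_ball_types: "finite (ball_type r ` carrier G)"
proof (rule finite_subset)
  show "ball_type r ` carrier G \<subseteq> {y \<in> carrier G. wlen y \<le> r} \<rightarrow>\<^sub>E {- int r..int r}"
  proof (intro image_subsetI, unfold ball_type_def restrict_PiE_iff, intro ballI)
    fix x y
    assume "x \<in> carrier G" "y \<in> {y \<in> carrier G. wlen y \<le> r}"
    then have *: "x \<in> carrier G" "y \<in> carrier G" "wlen y \<le> r"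
      by auto
    have "x = (x \<otimes> y) \<otimes> inv y"
      using * by (simp add: m_assoc)
    then have "wlen x \<le> wlen (x \<otimes> y) + wlen y"
      using wlen_mult[of "x \<otimes> y" "inv y"] * by simp
    moreover have "wlen (x \<otimes> y) \<le> wlen x + wlen y"
      using * by (intro wlen_mult)
    ultimately show "int (wlen (x \<otimes> y)) - int (wlen x) \<in> {- int r..int r}"
      using * by simp
  qed
qed (intro finite_PiE finite_wlen_le finite_atLeastAtMost_int)

lemma finite_Z_types: "finite (Z_type n l ` carrier G)"
proof (rule finite_subset)
  show "Z_type n l ` carrier G \<subseteq> Inl ` {x \<in> carrier G. wlen x \<le> l} \<union> Inr ` ball_type n ` carrier G"
    by (auto simp: Z_type_def)
qed (intro finite_UnI finite_imageI finite_wlen_le finite_ball_types)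

lemma finite_real_ball: "finite {x \<in> carrier G. real (wlen x) \<le> r}"
proof (rule finite_subset)
  show "{x \<in> carrier G. real (wlen x) \<le> r} \<subseteq> {x \<in> carrier G. wlen x \<le> nat \<lceil>r\<rceil>}"
    by (auto simp: le_nat_iff) linarith
qed (rule finite_wlen_le)

end

section \<open>Finiteness of the type functions\<close>

context hyperbolic_types
begin

lemma finite_child_numbers: "finite (child_number ` carrier G)"
proof -
  let ?Z = "Z_type N L ` carrier G"
  \<comment> \<open>The value of the definite description in \<open>child_number\<close> when no
    index qualifies, counted as one more possible number.\<close>
  define j :: nat where "j = (THE i. False)"
  have sub: "child_number g \<in> {0} \<union> Suc ` ((\<Union>\<tau>\<in>?Z. {..<length (enum \<tau>)}) \<union> {j})"
    if g: "g \<in> carrier G" for g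
  proof (cases "wlen g < L")
    case True
    then show ?thesis by (simp add: child_number_def)
  next
    case False
    define f where "f = big_up L 1 g"
    define \<tau> where "\<tau> = Z_type N L f"
    define P where "P i \<longleftrightarrow> i < length (enum \<tau>) \<and> enum \<tau> ! i = rep \<tau> \<otimes> inv f \<otimes> g" for i
    have "f \<in> carrier G"
      using up_iter_closed[of g L] g False by (simp add: f_def big_up_def)
    then have \<tau>: "\<tau> \<in> ?Z"
      by (simp add: \<tau>_def)
    have eq: "child_number g = Suc (THE i. P i)"
      using False by (simp add: child_number_def f_def \<tau>_def P_def Let_def)
    show ?thesis
    proof (cases "\<exists>i. P i")
      case True
      moreover have "i = i'" if "P i" "P i'" for i i'
        using that enum[OF \<tau>] nth_eq_iff_index_eq unfolding P_def by metis
      ultimately have "P (THE i. P i)"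
        by (metis theI)
      then show ?thesis
        using \<tau> eq by (auto simp: P_def)
    next
      case False
      then have "P = (\<lambda>i. False)" by auto
      then show ?thesis using eq by (simp add: j_def)
    qed
  qed
  have "finite ({0} \<union> Suc ` ((\<Union>\<tau>\<in>?Z. {..<length (enum \<tau>)}) \<union> {j}))"
    by (intro finite_UnI finite_imageI finite_UN_I finite_Z_types) auto
  then show ?thesis
    by (rule finite_subset[rotated]) (intro image_subsetI sub)
qed

lemma finite_A_types: "finite (A_type ` carrier G)"
proof (rule finite_subset)
  show "A_type ` carrier G \<subseteq> (Z_type N L ` carrier G) \<times> (child_number ` carrier G)"
    by (auto simp: A_type_def)
qed (intro finite_cartesian_product finite_Z_types finite_child_numbers)

text \<open>If two companions are never separated by their \<open>A\<close>-types, then \<^const>\<open>split_height\<close> is the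
  unspecified number \<open>LEAST k. False\<close>, at which \<^const>\<open>up\<close> may be iterated beyond \<open>\<one>\<close>. This
  adds only finitely many values, so there is no need to exclude it.\<close>

lemma finite_split_A_types:
  obtains \<A> where "finite \<A>"
    "\<And>g g' i. g' \<in> companions g \<Longrightarrow> i \<in> set (split_heights g) \<Longrightarrow> A_type (big_up L i g') \<in> \<A>"
proof -
  define k\<^sub>0 where "k\<^sub>0 = (LEAST k :: nat. False)"
  define \<A> where "\<A> = A_type ` carrier G \<union> A_type ` (\<lambda>j. (up ^^ j) \<one>) ` {..L * k\<^sub>0}"
  have "A_type (big_up L i g') \<in> \<A>" if g': "g' \<in> companions g" and i: "i \<in> set (split_heights g)" for g g' i
  proof -
    have c: "g' \<in> carrier G" "wlen g' = wlen g"
      using g' by (auto simp: companions_def)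
    let ?S = "{split_height g\<^sub>1 g\<^sub>2 | g\<^sub>1 g\<^sub>2. g\<^sub>1 \<in> companions g \<and> g\<^sub>2 \<in> companions g \<and> g\<^sub>1 \<noteq> g\<^sub>2}"
    have "i \<in> insert 0 ?S"
    proof (cases "finite (insert 0 ?S)")
      case True
      from i show ?thesis
        unfolding split_heights_def set_rev set_sorted_list_of_set[OF True] .
    next
      \<comment> \<open>For an infinite set \<open>sorted_list_of_set\<close> is the empty list, so
        \<open>i\<close> cannot occur in it.\<close>
      case False
      then show ?thesis
        using i by (simp add: split_heights_def)
    qed
    then have "L * i \<le> wlen g \<or> i = k\<^sub>0"
    proof
      assume "i \<in> ?S"
      then obtain g\<^sub>1 g\<^sub>2 where 12: "g\<^sub>1 \<in> companions g" "g\<^sub>2 \<in> companions g" "i = split_height g\<^sub>1 g\<^sub>2"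
        by blast
      show ?thesis
      proof (cases "\<exists>k. A_type (big_up L k g\<^sub>1) \<noteq> A_type (big_up L k g\<^sub>2)")
        case True
        from LeastI_ex[OF this] have ne: "A_type (big_up L i g\<^sub>1) \<noteq> A_type (big_up L i g\<^sub>2)"
          by (simp add: 12 split_height_def)
        \<comment> \<open>Companions have equal length, so once the identity is reached their
          ancestors coincide and can no longer differ in type.\<close>
        have "L * i < wlen g"
        proof (rule ccontr)
          assume "\<not> L * i < wlen g"
          then show False
            using ne 12 up_iter_beyond[of _ "L * i"] by (simp add: companions_def big_up_def)
        qed
        then show ?thesis by simp
      next
        case False
        then have "i = k\<^sub>0"
          unfolding 12(3) split_height_def k\<^sub>0_def by (intro Least_no_witness) blast
        then show ?thesis ..
      qed
    qed simp
    then show ?thesis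
    proof
      assume "L * i \<le> wlen g"
      then show ?thesis
        using up_iter_closed[of g' "L * i"] c by (simp add: \<A>_def big_up_def)
    next
      assume i: "i = k\<^sub>0"
      show ?thesis
      proof (cases "L * i \<le> wlen g'")
        case True
        then show ?thesis
          using up_iter_closed[of g' "L * i"] c by (simp add: \<A>_def big_up_def)
      next
        case False
        then have "big_up L i g' = (up ^^ (L * i - wlen g')) \<one>"
          using up_iter_beyond[OF c(1), of "L * i"] by (simp add: big_up_def)
        then show ?thesis
          unfolding \<A>_def i by simp
      qed
    qed
  qed
  moreover have "finite \<A>"
    unfolding \<A>_def by (intro finite_UnI finite_A_types finite_imageI finite_atMost)
  ultimately show ?thesis using that by blast
qed

text \<open>Translation by \<open>inv g\<close> embeds the companions into one finite ball. This
  bounds their number, hence the number of split heights and the length of the words, whose letters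
  come from the finite set \<open>\<A>\<close>.\<close>

lemma finite_B_types: "finite (B_type ` carrier G)"
proof -
  obtain \<A> where \<A>: "finite \<A>"
    "\<And>g g' i. g' \<in> companions g \<Longrightarrow> i \<in> set (split_heights g) \<Longrightarrow> A_type (big_up L i g') \<in> \<A>"
    using finite_split_A_types by blast
  define R where "R = {x \<in> carrier G. real (wlen x) \<le> torsion_radius \<delta>}"
  \<comment> \<open>At most one height for each pair of companions, and one more for the added
    0.\<close>
  define M where "M = Suc (card R * card R)"
  have R: "finite R"
    unfolding R_def by (rule finite_real_ball)
  have len: "length (split_heights g) \<le> M" if g: "g \<in> carrier G" for g
  proof -
    let ?C = "companions g"
    have inj: "inj_on (\<lambda>x. inv g \<otimes> x) ?C" and img: "(\<lambda>x. inv g \<otimes> x) ` ?C \<subseteq> R"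
      using g by (auto simp: companions_def R_def wdist_def intro!: inj_onI)
    have C: "finite ?C" "card ?C \<le> card R"
      using inj_on_finite[OF inj img R] card_inj_on_le[OF inj img R] by auto
    have sub: "{split_height g' g'' | g' g''. g' \<in> ?C \<and> g'' \<in> ?C \<and> g' \<noteq> g''} \<subseteq> (\<lambda>(x, y). split_height x y) ` (?C \<times> ?C)"
      by auto
    have "card {split_height g' g'' | g' g''. g' \<in> ?C \<and> g'' \<in> ?C \<and> g' \<noteq> g''} \<le> card (?C \<times> ?C)"
      using C by (intro order_trans[OF card_mono[OF _ sub] card_image_le]) auto
    also have "\<dots> \<le> card R * card R"
      using C by (simp add: card_cartesian_product mult_le_mono)
    finally show ?thesis
      unfolding split_heights_def length_rev length_sorted_list_of_set M_def
      by (metis (no_types, lifting) card_insert_le_m1 diff_Suc_1 zero_less_Suc)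
  qed
  have "B_type ` carrier G \<subseteq> Pow (R \<times> {xs. set xs \<subseteq> \<A> \<and> length xs \<le> M})"
  proof (intro image_subsetI PowI subsetI)
    fix g p
    assume g: "g \<in> carrier G" and "p \<in> B_type g"
    then obtain g' where g': "g' \<in> companions g"
        "p = (inv g \<otimes> g', map (\<lambda>k. A_type (big_up L k g')) (split_heights g))"
      unfolding B_type_def by blast
    then show "p \<in> R \<times> {xs. set xs \<subseteq> \<A> \<and> length xs \<le> M}"
      using \<A>(2)[OF g'(1)] len[OF g] g by (auto simp: R_def companions_def wdist_def)
  qed
  moreover have "finite (Pow (R \<times> {xs. set xs \<subseteq> \<A> \<and> length xs \<le> M}))"
    by (intro finite_Pow_iff[THEN iffD2] finite_cartesian_product R finite_lists_length_le \<A>(1))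
  ultimately show ?thesis
    using finite_subset by blast
qed

lemma finite_B_type_exts: "finite (B_type_ext \<theta> ` carrier G)"
proof -
  let ?H = "{x \<in> carrier G. real (wlen x) \<le> 12 * of_int \<theta> * \<delta>}"
  let ?V = "insert None (Some ` B_type ` carrier G)"
  have "finite {f. \<forall>x. (x \<in> ?H \<longrightarrow> f x \<in> ?V) \<and> (x \<notin> ?H \<longrightarrow> f x = None)}"
    using finite_B_types by (intro finite_set_of_finite_funs finite_real_ball) auto
  then show ?thesis
    by (rule finite_subset[rotated]) (auto simp: B_type_ext_def)
qed

end

section \<open>Spans and rays supplied by the covers\<close>

context boundary_covers
begin

lemma ex_four_point: "\<exists>h. four_point G ss h"
proof -
  obtain h where h: "\<forall>w\<in>carrier G. \<forall>x\<in>carrier G. \<forall>y\<in>carrier G. \<forall>z\<in>carrier G.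
      gromov_product w x z \<ge> min (gromov_product w x y) (gromov_product w y z) - h"
    using gromov_hyperbolic by blast
  have "four_point G ss h"
    by unfold_locales (use h in blast)
  then show ?thesis ..
qed

lemma E_obtain:
  assumes "\<xi> \<in> boundary"
  obtains x where "x \<in> carrier G" "wlen x = n" "\<xi> \<in> E x"
  using assms E_cover[of n] by blast

lemma E_span:
  assumes "x \<in> carrier G" "\<xi> \<in> E x"
  obtains u where "u \<in> carrier G" "wlen (x \<otimes> u) = wlen x" "\<xi> \<in> span (x \<otimes> u)"
    "span (x \<otimes> u) \<inter> span x \<noteq> {}"
proof -
  have "\<xi> \<in> \<Union>{span (x \<otimes> u) | u. u \<in> carrier G \<and> wlen (x \<otimes> u) = wlen x \<and> span (x \<otimes> u) \<inter> span x \<noteq> {}}"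
    using subsetD[OF E_span_star[OF assms(1)] assms(2)] unfolding span_star_def
    by (rule subsetD[OF interior_of_subset])
  then show ?thesis using that by blast
qed

lemma ex_based_boundary: "\<exists>h. based_boundary G ss h"
proof -
  obtain h where "four_point G ss h"
    using ex_four_point by blast
  then interpret four_point G ss h .
  have "based_boundary G ss h"
  proof
    fix \<xi> assume "\<xi> \<in> boundary"
    then obtain x where x: "x \<in> carrier G" "\<xi> \<in> E x"
      using E_obtain by metis
    show "\<exists>\<rho>\<in>\<xi>. \<rho> 0 = \<one>"
      using E_span[OF x] unfolding span_def by blast
  qed
  then show ?thesis ..
qed

lemma E_subset_boundary: "x \<in> carrier G \<Longrightarrow> E x \<subseteq> boundary"
  using E_open openin_subset topspace_bdry_topology by metis

end

locale based_boundary_covers = boundary_covers G ss \<delta> N\<^sub>0 N L rep enum k E + based_boundary G ss h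
  for G :: "('g, 'm) monoid_scheme" (structure) and ss \<delta> N\<^sub>0 N L rep enum k E h
begin

lemma span_close:
  assumes "x \<in> carrier G" "y \<in> carrier G" "wlen x = wlen y" "\<xi> \<in> span x" "\<xi> \<in> span y"
  shows "gd x y \<le> 4 * h"
proof -
  obtain \<rho> i where \<rho>: "\<rho> \<in> \<xi>" "\<rho> 0 = \<one>" "x = \<rho> i"
    using assms by (auto simp: span_def)
  obtain \<sigma> j where \<sigma>: "\<sigma> \<in> \<xi>" "\<sigma> 0 = \<one>" "y = \<sigma> j"
    using assms by (auto simp: span_def)
  have \<xi>: "\<xi> \<in> boundary"
    using assms by (auto simp: span_def)
  have "real i = gd \<one> x" "real j = gd \<one> y"
    using ray_based[OF boundary_mem_rays[OF \<xi>]] \<rho> \<sigma> by metis+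
  then have "i = j"
    using assms by simp
  then show ?thesis
    using based_asymptotic_close[OF \<xi> \<rho>(1,2) \<sigma>(1,2)] \<rho> \<sigma> by simp
qed

text \<open>A point of \<open>E x\<close> lies in the span of some \<open>x \<otimes> u\<close>
  whose span meets that of \<open>x\<close>; a boundary point common to these spans keeps
  \<open>x \<otimes> u\<close> within 4h of \<open>x\<close>.\<close>

lemma E_ray:
  assumes x: "x \<in> carrier G" "\<xi> \<in> E x"
  obtains \<rho> where "\<rho> \<in> \<xi>" "\<rho> 0 = \<one>" "gd (\<rho> (wlen x)) x \<le> 4 * h"
proof -
  obtain u where u: "u \<in> carrier G" "wlen (x \<otimes> u) = wlen x" "\<xi> \<in> span (x \<otimes> u)"
    "span (x \<otimes> u) \<inter> span x \<noteq> {}"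
    using E_span[OF x] by metis
  then have close: "gd (x \<otimes> u) x \<le> 4 * h"
    using span_close[of "x \<otimes> u" x] x by auto
  obtain \<rho> i where \<rho>: "\<rho> \<in> \<xi>" "\<rho> 0 = \<one>" "x \<otimes> u = \<rho> i" and \<xi>: "\<xi> \<in> boundary"
    using u by (auto simp: span_def)
  have "real i = gd \<one> (x \<otimes> u)"
    using ray_based[OF boundary_mem_rays[OF \<xi> \<rho>(1)] \<rho>(2)] \<rho>(3) by simp
  then have "i = wlen x"
    using u x by simp
  then show ?thesis
    using that \<rho> close by simp
qed

text \<open>Three times 4h: from \<open>x\<close> to its ray, across to the ray belonging to
  \<open>y\<close> at the same time, and on to \<open>y\<close>. This fixes the radius of the ball
  on which types are compared in \<open>E_lebesgue\<close>.\<close>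

lemma E_meet_close:
  assumes x: "x \<in> carrier G" "\<xi> \<in> E x" and y: "y \<in> carrier G" "\<xi> \<in> E y" and len: "wlen x = wlen y"
  shows "gd x y \<le> 12 * h"
proof -
  obtain \<rho> where \<rho>: "\<rho> \<in> \<xi>" "\<rho> 0 = \<one>" "gd (\<rho> (wlen x)) x \<le> 4 * h"
    using E_ray[OF x] .
  obtain \<sigma> where \<sigma>: "\<sigma> \<in> \<xi>" "\<sigma> 0 = \<one>" "gd (\<sigma> (wlen x)) y \<le> 4 * h"
    using E_ray[OF y] unfolding len .
  have \<xi>: "\<xi> \<in> boundary"
    using E_subset_boundary x by blast
  have c: "\<rho> (wlen x) \<in> carrier G" "\<sigma> (wlen x) \<in> carrier G"
    using boundary_mem_rays[OF \<xi>] \<rho> \<sigma> raysD(1) by blast+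
  have "gd (\<rho> (wlen x)) (\<sigma> (wlen x)) \<le> 4 * h"
    by (rule based_asymptotic_close[OF \<xi> \<rho>(1,2) \<sigma>(1,2)])
  then show ?thesis
    using gd_triangle[OF x(1) c(1) c(2)] gd_triangle[OF x(1) c(2) y(1)] gd_commute[OF c(1) x(1)] \<rho> \<sigma>
    by linarith
qed

text \<open>Rays to both points pass within 4h of \<open>x\<close> at time \<open>n\<close>, so
  their product there is at least n - 4h. Moving further out costs 2h, and the comparison with lines
  another 2h.\<close>

lemma E_depth:
  assumes x: "x \<in> carrier G" "\<xi> \<in> E x" "\<eta> \<in> E x" and ne: "\<xi> \<noteq> \<eta>"
  shows "real (wlen x) - 8 * h \<le> line_depth \<xi> \<eta>"
proof -
  define n where "n = wlen x"
  obtain \<rho> where \<rho>: "\<rho> \<in> \<xi>" "\<rho> 0 = \<one>" "gd (\<rho> n) x \<le> 4 * h"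
    using E_ray[OF x(1,2)] unfolding n_def .
  obtain \<sigma> where \<sigma>: "\<sigma> \<in> \<eta>" "\<sigma> 0 = \<one>" "gd (\<sigma> n) x \<le> 4 * h"
    using E_ray[OF x(1,3)] unfolding n_def .
  have bd: "\<xi> \<in> boundary" "\<eta> \<in> boundary"
    using E_subset_boundary x by blast+
  have ray: "\<rho> \<in> rays" "\<sigma> \<in> rays"
    using boundary_mem_rays bd \<rho> \<sigma> by blast+
  note c = raysD(1)[OF ray(1)] raysD(1)[OF ray(2)]
  have "gd (\<rho> n) (\<sigma> n) \<le> 8 * h"
    using gd_triangle[OF c(1) x(1) c(2), of n n] gd_commute[OF c(2) x(1), of n] \<rho> \<sigma> by linarith
  then have mid: "real n - 4 * h \<le> gp (\<rho> n) (\<sigma> n)"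
    using ray_based[OF ray(1) \<rho>(2), of n] ray_based[OF ray(2) \<sigma>(2), of n] by (simp add: gromov_product_def)
  have "real n - 4 * h - 2 * h \<le> gp (\<rho> s) (\<sigma> t)" if "s \<ge> n" "t \<ge> n" for s t
  proof (rule gp_chain3[OF c(1) c(1) c(2) c(2) _ mid])
    show "real n - 4 * h \<le> gp (\<rho> s) (\<rho> n)" "real n - 4 * h \<le> gp (\<sigma> n) (\<sigma> t)"
      using based_ray_gp[OF ray(1) \<rho>(2), of s n] based_ray_gp[OF ray(2) \<sigma>(2), of n t] that h_nonneg by auto
  qed
  then have "bdry_close (real n - 4 * h - 2 * h) \<xi> \<eta>"
    unfolding bdry_close_def using \<rho> \<sigma> by blast
  then show ?thesis
    using line_depth_ge[OF bd ne] unfolding n_def by fastforce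
qed

text \<open>The Lebesgue number of level \<open>n\<close> is made uniform in \<open>n\<close> by translating with group elements:
  up to translation, there are only finitely many patterns of types in the \<open>D\<close>-ball
  around an element.\<close>

lemma E_lebesgue:
  obtains c :: real where "\<And>n \<xi> \<eta>. \<xi> \<in> boundary \<Longrightarrow> \<eta> \<in> boundary \<Longrightarrow> \<xi> \<noteq> \<eta> \<Longrightarrow> real n + c \<le> line_depth \<xi> \<eta>
    \<Longrightarrow> \<exists>x\<in>carrier G. wlen x = n \<and> \<xi> \<in> E x \<and> \<eta> \<in> E x"
proof -
  define lebesgue where "lebesgue n r \<longleftrightarrow> (\<forall>\<gamma> \<xi> \<eta>. \<xi> \<in> boundary \<and> \<eta> \<in> boundary \<and> joins \<gamma> \<xi> \<eta> \<and>
      (\<forall>i. r \<le> gd \<one> (\<gamma> i)) \<longrightarrow>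
      (\<exists>V\<in>{E x | x. x \<in> carrier G \<and> wlen x = n}. \<xi> \<in> V \<and> \<eta> \<in> V))" for n and r :: real
  have "\<exists>r. lebesgue n r" for n
  proof -
    have opens: "V \<in> {E x | x. x \<in> carrier G \<and> wlen x = n} \<Longrightarrow> openin bdry_topology V" for V
      using E_open by blast
    show ?thesis
    proof (rule open_cover_lebesgue[OF opens E_cover[of n]])
      fix r :: real
      assume r: "\<And>\<gamma> \<xi> \<eta>. \<xi> \<in> boundary \<Longrightarrow> \<eta> \<in> boundary \<Longrightarrow> joins \<gamma> \<xi> \<eta> \<Longrightarrow>
        (\<And>i. r \<le> gd \<one> (\<gamma> i)) \<Longrightarrow> \<exists>V\<in>{E x | x. x \<in> carrier G \<and> wlen x = n}. \<xi> \<in> V \<and> \<eta> \<in> V"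
      show ?thesis
        unfolding lebesgue_def by (intro exI[of _ r] allI impI, elim conjE, rule r) auto
    qed
  qed
  then obtain r where "\<And>n. lebesgue n (r n)"
    by metis
  then have r: "\<And>n \<gamma> \<xi> \<eta>. \<xi> \<in> boundary \<Longrightarrow> \<eta> \<in> boundary \<Longrightarrow> joins \<gamma> \<xi> \<eta> \<Longrightarrow>
      (\<And>i. r n \<le> gd \<one> (\<gamma> i)) \<Longrightarrow> \<exists>V\<in>{E x | x. x \<in> carrier G \<and> wlen x = n}. \<xi> \<in> V \<and> \<eta> \<in> V"
    unfolding lebesgue_def by meson
  define B where "B = B_type_ext (3 * k + 4)"
  define D where "D = {u \<in> carrier G. real (wlen u) \<le> 12 * h}"
  \<comment> \<open>Records which neighbours \<open>y \<otimes> u\<close> lie on the sphere of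
    \<open>y\<close>, and their types. Equal patterns let one group element transport all members of
    the cover that could meet \<open>E y\<close>.\<close>
  define pat where "pat y u = (if u \<in> D \<and> wlen (y \<otimes> u) = wlen y then Some (B (y \<otimes> u)) else None)" for y u
  have fin: "finite (pat ` carrier G)"
  proof -
    have "finite {f. \<forall>u. (u \<in> D \<longrightarrow> f u \<in> insert None (Some ` B ` carrier G)) \<and> (u \<notin> D \<longrightarrow> f u = None)}"
      unfolding D_def B_def using finite_B_type_exts
      by (intro finite_set_of_finite_funs finite_real_ball) auto
    then show ?thesis
      by (rule finite_subset[rotated]) (auto simp: pat_def D_def)
  qed
  define rp where "rp \<tau> = (SOME y. y \<in> carrier G \<and> pat y = \<tau>)" for \<tau>
  have rp: "rp \<tau> \<in> carrier G \<and> pat (rp \<tau>) = \<tau>" if "\<tau> \<in> pat ` carrier G" for \<tau>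
    unfolding rp_def by (rule someI_ex) (use that in blast)
  \<comment> \<open>The threshold at the level of the representative plus the part of the
    translation length that the representative contributes; the remaining part is
    \<open>n\<close>.\<close>
  obtain c where c: "\<And>\<tau>. \<tau> \<in> pat ` carrier G \<Longrightarrow> r (wlen (rp \<tau>)) + real (wlen (rp \<tau>)) \<le> c"
    using finite_bound[OF fin, of "\<lambda>\<tau>. r (wlen (rp \<tau>)) + real (wlen (rp \<tau>))"] by metis
  have one: "\<one> \<in> D"
    using h_nonneg by (simp add: D_def)
  have "\<exists>x\<in>carrier G. wlen x = n \<and> \<xi> \<in> E x \<and> \<eta> \<in> E x"
    if \<xi>: "\<xi> \<in> boundary" and \<eta>: "\<eta> \<in> boundary" and ne: "\<xi> \<noteq> \<eta>"
      and deep: "real n + c \<le> line_depth \<xi> \<eta>" for n \<xi> \<eta>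
  proof -
    obtain y where y: "y \<in> carrier G" "wlen y = n" "\<xi> \<in> E y"
      using E_obtain[OF \<xi>] .
    define y\<^sub>0 where "y\<^sub>0 = rp (pat y)"
    have y\<^sub>0: "y\<^sub>0 \<in> carrier G" "pat y\<^sub>0 = pat y" "r (wlen y\<^sub>0) + real (wlen y\<^sub>0) \<le> c"
      using rp c y unfolding y\<^sub>0_def by auto
    define g where "g = y \<otimes> inv y\<^sub>0"
    have g: "g \<in> carrier G" "g \<otimes> y\<^sub>0 = y"
      using y y\<^sub>0 by (simp_all add: g_def m_assoc)
    have transport: "wlen (y \<otimes> u) = wlen y \<and> E (y \<otimes> u) = shift g ` E (y\<^sub>0 \<otimes> u)"
      if u: "u \<in> D" "wlen (y\<^sub>0 \<otimes> u) = wlen y\<^sub>0" for u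
    proof -
      have "pat y u = Some (B (y\<^sub>0 \<otimes> u))"
        unfolding y\<^sub>0(2)[symmetric] using u by (simp add: pat_def)
      then have *: "wlen (y \<otimes> u) = wlen y" "B (y \<otimes> u) = B (y\<^sub>0 \<otimes> u)"
        by (auto simp: pat_def split: if_splits)
      have uc: "u \<in> carrier G"
        using u by (simp add: D_def)
      have "y \<otimes> u = g \<otimes> (y\<^sub>0 \<otimes> u)"
        using g y\<^sub>0 uc by (simp add: m_assoc[symmetric])
      then have "E (y \<otimes> u) = bdry_act g (E (y\<^sub>0 \<otimes> u))"
        using E_equivariant[of g "y\<^sub>0 \<otimes> u"] * g y\<^sub>0 uc unfolding B_def by simp
      then show ?thesis
        using * by (simp add: bdry_act_shift)
    qed
    define \<xi>' where "\<xi>' = shift (inv g) \<xi>"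
    define \<eta>' where "\<eta>' = shift (inv g) \<eta>"
    have shift_back: "shift g \<xi>' = \<xi>" "shift g \<eta>' = \<eta>"
      unfolding \<xi>'_def \<eta>'_def by (simp_all add: shift_shift_inv g \<xi> \<eta>)
    have bd: "\<xi>' \<in> boundary" "\<eta>' \<in> boundary"
      unfolding \<xi>'_def \<eta>'_def by (simp_all add: shift_boundary g \<xi> \<eta>)
    have "\<xi> \<in> shift g ` E y\<^sub>0"
      using transport[OF one] y y\<^sub>0 by simp
    then have xi_E: "\<xi>' \<in> E y\<^sub>0"
      unfolding \<xi>'_def using shift_inv_shift[OF g(1)] E_subset_boundary[OF y\<^sub>0(1)] by auto
    obtain \<gamma> where \<gamma>: "joins \<gamma> \<xi> \<eta>" "\<And>i. line_depth \<xi> \<eta> \<le> wdist \<one> (\<gamma> i)"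
      using line_depth_attained[OF \<xi> \<eta> ne] by metis
    have line: "\<gamma> i \<in> carrier G" for i
      using \<gamma> lineD(1) by (auto simp: joins_def)
    have "joins (\<lambda>i. inv g \<otimes> \<gamma> i) \<xi>' \<eta>'"
      unfolding \<xi>'_def \<eta>'_def using g \<gamma> by (intro joins_shift) auto
    \<comment> \<open>Translation by \<open>inv g\<close> brings the line closer to the identity by
      at most \<open>n + wlen y\<^sub>0\<close>, which the assumption \<open>deep\<close> and the
      choice of \<open>c\<close> absorb.\<close>
    moreover have "r (wlen y\<^sub>0) \<le> gd \<one> (inv g \<otimes> \<gamma> i)" for i
    proof -
      have "gd \<one> (\<gamma> i) \<le> gd \<one> g + gd g (\<gamma> i)"
        using g line by (intro gd_triangle) auto
      moreover have "gd g (\<gamma> i) = gd \<one> (inv g \<otimes> \<gamma> i)"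
        using wdist_mult_left[of "inv g" g "\<gamma> i"] g line[of i] by simp
      moreover have "gd \<one> g \<le> real n + real (wlen y\<^sub>0)"
        using wlen_mult[of y "inv y\<^sub>0"] y y\<^sub>0 by (simp add: g_def)
      moreover have "real (line_depth \<xi> \<eta>) \<le> gd \<one> (\<gamma> i)"
        using \<gamma>(2) by simp
      ultimately show ?thesis
        using deep y\<^sub>0(3) by linarith
    qed
    ultimately obtain z where z: "z \<in> carrier G" "wlen z = wlen y\<^sub>0" "\<xi>' \<in> E z" "\<eta>' \<in> E z"
      using r[OF bd, of "\<lambda>i. inv g \<otimes> \<gamma> i" "wlen y\<^sub>0"] by blast
    define u where "u = inv y\<^sub>0 \<otimes> z"
    have z_eq: "y\<^sub>0 \<otimes> u = z"
      using y\<^sub>0 z by (simp add: u_def m_assoc[symmetric])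
    \<comment> \<open>The member found at the reference level shares \<open>\<xi>'\<close> with
      \<open>E y\<^sub>0\<close>, so its index is among the neighbours recorded in the pattern and
      it can be carried back.\<close>
    have "u \<in> D"
      using E_meet_close[OF y\<^sub>0(1) xi_E z(1,3)] z y\<^sub>0 by (simp add: D_def u_def wdist_def)
    then have "wlen (y \<otimes> u) = n" "E (y \<otimes> u) = shift g ` E z"
      using transport[of u] y z z_eq by auto
    moreover have "\<xi> \<in> shift g ` E z" "\<eta> \<in> shift g ` E z"
      using z shift_back by (metis imageI)+
    ultimately show ?thesis
      using y y\<^sub>0 z by (intro bexI[of _ "y \<otimes> u"]) (auto simp: u_def)
  qed
  then show ?thesis using that by blast
qed

end

section \<open>Comparison of the metrics\<close>

text \<open>The identity between a quasi-metric and its power is quasisymmetric with a power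
  function, and bi-Lipschitz changes affect only the constant in front.\<close>

lemma same_quasiconformal_powr:
  fixes q :: "'a \<Rightarrow> 'a \<Rightarrow> real"
  assumes K: "K \<ge> 1" and K': "K' \<ge> 1" and \<alpha>: "\<alpha> > 0"
    and q: "\<And>x y. x \<in> M \<Longrightarrow> y \<in> M \<Longrightarrow> 0 \<le> q x y"
    and d: "\<And>x y. x \<in> M \<Longrightarrow> y \<in> M \<Longrightarrow> q x y / K \<le> d x y \<and> d x y \<le> K * q x y"
    and d': "\<And>x y. x \<in> M \<Longrightarrow> y \<in> M \<Longrightarrow>
      q x y powr \<alpha> / K' \<le> d' x y \<and> d' x y \<le> K' * q x y powr \<alpha>"
  shows "same_quasiconformal M d d'"
proof -
  \<comment> \<open>Each comparison is used twice, for the pair \<open>x\<close>, \<open>y\<close>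
    and for the pair \<open>x\<close>, \<open>z\<close>; the constant of \<open>d\<close> is also
    raised to the power \<open>\<alpha>\<close>.\<close>
  define A where "A = K' * K' * (K * K) powr \<alpha>"
  have A: "A > 0"
    using K K' by (simp add: A_def)
  have "homeomorphism {0..} {0..} (\<lambda>t. A * t powr \<alpha>) (\<lambda>s. (s / A) powr (1 / \<alpha>))"
  proof (rule homeomorphismI)
    show "continuous_on {0..} (\<lambda>t. A * t powr \<alpha>)" "continuous_on {0..} (\<lambda>s. (s / A) powr (1 / \<alpha>))"
      using A \<alpha> by (intro continuous_intros continuous_on_powr'; auto)+
  qed (use A \<alpha> in \<open>auto simp: powr_powr\<close>)
  moreover have "d' x y \<le> A * t powr \<alpha> * d' x z"
    if M: "x \<in> M" "y \<in> M" "z \<in> M" and t: "0 \<le> t" and le: "d x y \<le> t * d x z" for x y z t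
  proof -
    have "q x y / K \<le> t * (K * q x z)"
      using d[OF M(1,2)] d[OF M(1,3)] le mult_left_mono[OF _ t, of "d x z" "K * q x z"] by linarith
    then have "q x y \<le> K * K * t * q x z"
      using K by (simp add: field_simps)
    then have "q x y powr \<alpha> \<le> (K * K * t * q x z) powr \<alpha>"
      using q M \<alpha> by (intro powr_mono2) auto
    also have "\<dots> = (K * K) powr \<alpha> * t powr \<alpha> * q x z powr \<alpha>"
      using K t q[OF M(1,3)] by (simp add: powr_mult)
    also have "\<dots> \<le> (K * K) powr \<alpha> * t powr \<alpha> * (K' * d' x z)"
      using d'[OF M(1,3)] K' by (intro mult_left_mono) (auto simp: field_simps)
    finally have "K' * q x y powr \<alpha> \<le> K' * ((K * K) powr \<alpha> * t powr \<alpha> * (K' * d' x z))"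
      using K' by (intro mult_left_mono) auto
    then show ?thesis
      using d'[OF M(1,2)] by (simp add: A_def mult_ac)
  qed
  ultimately show ?thesis
    unfolding same_quasiconformal_def by blast
qed

context star_refining
begin

text \<open>With b = \<open>a ^ l\<close> the weight of level \<open>i\<close> is the visual size at
  depth \<open>i * l\<close>. The additive error \<open>C\<close> and the rounding to multiples of
  \<open>l\<close> turn into the factor \<open>a ^ (C + l)\<close>.\<close>

lemma simplicial_metric_comparison:
  fixes depth :: "'x \<Rightarrow> 'x \<Rightarrow> nat" and C l :: nat
  assumes a: "1 < a" and small: "(1 - 1 / m) * a ^ l < 1" and l: "0 < l"
    and upper: "\<And>i V x y. V \<in> \<U> i \<Longrightarrow> x \<in> V \<Longrightarrow> y \<in> V \<Longrightarrow> x \<noteq> y \<Longrightarrow> i * l \<le> depth x y + C"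
    and lower: "\<And>i x y. x \<in> X \<Longrightarrow> y \<in> X \<Longrightarrow> x \<noteq> y \<Longrightarrow> i * l + C \<le> depth x y \<Longrightarrow>
      \<exists>V\<in>\<U> i. x \<in> V \<and> y \<in> V"
  obtains K where "K \<ge> 1" "\<And>x y. x \<in> X \<Longrightarrow> y \<in> X \<Longrightarrow> x \<noteq> y \<Longrightarrow>
    1 / a ^ depth x y / K \<le> simplicial_metric \<U> (a ^ l) (canonical_map \<U> x) (canonical_map \<U> y) \<and>
    simplicial_metric \<U> (a ^ l) (canonical_map \<U> x) (canonical_map \<U> y) \<le> K * (1 / a ^ depth x y)"
proof -
  define b where "b = a ^ l"
  have b: "1 < b"
    using a l by (simp add: b_def)
  define K\<^sub>0 where "K\<^sub>0 = 2 / (1 - (1 - 1 / m) * b) + 2 / (1 - 1 / b)"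
  define K\<^sub>1 where "K\<^sub>1 = a ^ (C + l)"
  have "2 \<le> 2 / (1 - 1 / b)"
    using b by (simp add: field_simps)
  moreover have "0 \<le> 2 / (1 - (1 - 1 / m) * b)"
    using small by (simp add: b_def)
  ultimately have K\<^sub>0: "1 \<le> K\<^sub>0" "2 / (1 - 1 / b) \<le> K\<^sub>0"
    unfolding K\<^sub>0_def by linarith+
  have K\<^sub>1: "1 \<le> K\<^sub>1"
    using a by (simp add: K\<^sub>1_def)
  have comparison: "1 / a ^ depth x y / (K\<^sub>0 * K\<^sub>1) \<le> simplicial_metric \<U> b (canonical_map \<U> x) (canonical_map \<U> y) \<and>
      simplicial_metric \<U> b (canonical_map \<U> x) (canonical_map \<U> y) \<le> K\<^sub>0 * K\<^sub>1 * (1 / a ^ depth x y)"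
    if x: "x \<in> X" and y: "y \<in> X" and ne: "x \<noteq> y" for x y
  proof -
    define n where "n = depth x y"
    let ?d = "simplicial_metric \<U> b (canonical_map \<U> x) (canonical_map \<U> y)"
    \<comment> \<open>The first level with \<open>j * l\<close> above \<open>n + C\<close>, where
      \<open>upper\<close> excludes a common member.\<close>
    define j where "j = (n + C) div l + 1"
    have j: "n + C < j * l" "j * l \<le> n + C + l"
      using l dividend_less_div_times[of l "n + C"] div_times_less_eq_dividend[of "n + C" l]
      by (auto simp: j_def)
    have "\<not> (x \<in> V \<and> y \<in> V)" if "V \<in> \<U> j" for V
      using upper[OF that _ _ ne] j(1) unfolding n_def by fastforce
    then have "2 / b ^ j \<le> ?d"
      by (rule simplicial_metric_ge[OF b x y])
    moreover have "b ^ j \<le> a ^ n * K\<^sub>1"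
    proof -
      have "b ^ j = a ^ (j * l)"
        by (simp add: b_def power_mult[symmetric] mult.commute)
      also have "\<dots> \<le> a ^ (n + C + l)"
        using a j by (intro power_increasing) auto
      finally show ?thesis
        by (simp add: K\<^sub>1_def power_add mult.assoc)
    qed
    then have "1 / (a ^ n * K\<^sub>1) \<le> 1 / b ^ j"
      using a b by (intro divide_left_mono) (auto simp: K\<^sub>1_def)
    moreover have "1 / a ^ n / (K\<^sub>0 * K\<^sub>1) \<le> 1 / (a ^ n * K\<^sub>1)"
      using a K\<^sub>0 K\<^sub>1 by (simp add: field_simps)
    moreover have "0 < 1 / b ^ j"
      using b by simp
    ultimately have 1: "1 / a ^ n / (K\<^sub>0 * K\<^sub>1) \<le> ?d"
      by linarith
    have 2: "?d \<le> K\<^sub>0 * K\<^sub>1 * (1 / a ^ n)"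
    proof (cases "C \<le> n")
      case True
      \<comment> \<open>The last level with \<open>i * l + C\<close> at most \<open>n\<close>, where
        \<open>lower\<close> provides a common member.\<close>
      define i where "i = (n - C) div l"
      have "i * l \<le> n - C" "n - C < l + i * l"
        unfolding i_def using l by (auto simp: dividend_less_div_times intro: div_times_less_eq_dividend)
      then have i: "i * l + C \<le> n" "n \<le> i * l + l + C"
        using True by linarith+
      obtain V where V: "V \<in> \<U> i" "x \<in> V" "y \<in> V"
        using lower[OF x y ne, of i] i unfolding n_def by blast
      have "?d \<le> K\<^sub>0 / b ^ i"
        unfolding K\<^sub>0_def using simplicial_metric_le[OF b x y V] small by (simp add: b_def)
      moreover have "a ^ n \<le> b ^ i * K\<^sub>1"
      proof -
        have "a ^ n \<le> a ^ (i * l + (C + l))"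
          using a i by (intro power_increasing) auto
        also have "\<dots> = b ^ i * K\<^sub>1"
          by (simp add: b_def K\<^sub>1_def power_add power_mult[symmetric] mult.commute)
        finally show ?thesis .
      qed
      then have "1 / b ^ i \<le> K\<^sub>1 * (1 / a ^ n)"
        using a b by (simp add: field_simps)
      then have "K\<^sub>0 * (1 / b ^ i) \<le> K\<^sub>0 * (K\<^sub>1 * (1 / a ^ n))"
        using K\<^sub>0 by (intro mult_left_mono) auto
      ultimately show ?thesis by simp
    next
      \<comment> \<open>For \<open>n\<close> below \<open>C\<close> even level 0 is out of reach of
        \<open>lower\<close>; but then \<open>a ^ n\<close> is at most \<open>K\<^sub>1\<close> and
        the bound on the diameter suffices.\<close>
      case False
      have "?d \<le> K\<^sub>0"
        using simplicial_metric_le_const[OF b canonical_map(1)[OF x] canonical_map(1)[OF y]] K\<^sub>0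
        by linarith
      moreover have "a ^ n \<le> K\<^sub>1"
        unfolding K\<^sub>1_def using a False by (intro power_increasing) auto
      then have "K\<^sub>0 * 1 \<le> K\<^sub>0 * (K\<^sub>1 * (1 / a ^ n))"
        using a K\<^sub>0 by (intro mult_left_mono) (auto simp: field_simps)
      ultimately show ?thesis by simp
    qed
    show ?thesis
      using 1 2 by (simp add: n_def)
  qed
  have "1 \<le> K\<^sub>0 * K\<^sub>1"
    using K\<^sub>0 K\<^sub>1 mult_mono[of 1 K\<^sub>0 1 K\<^sub>1] by simp
  then show ?thesis
    using that comparison unfolding b_def by blast
qed

end

context boundary_covers
begin

text \<open>The interface between the geometry and the nerves; \<open>h\<close> and the auxiliary
  locales stay inside the proof.\<close>

lemma depth_comparison:
  "\<exists>C :: nat.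
    (\<forall>x\<in>carrier G. \<forall>\<xi>\<in>E x. \<forall>\<eta>\<in>E x. \<xi> \<noteq> \<eta> \<longrightarrow> wlen x \<le> line_depth \<xi> \<eta> + C) \<and>
    (\<forall>n. \<forall>\<xi>\<in>boundary. \<forall>\<eta>\<in>boundary. \<xi> \<noteq> \<eta> \<and> n + C \<le> line_depth \<xi> \<eta> \<longrightarrow>
      (\<exists>x\<in>carrier G. wlen x = n \<and> \<xi> \<in> E x \<and> \<eta> \<in> E x))"
proof -
  obtain h where "based_boundary G ss h"
    using ex_based_boundary by blast
  then interpret based_boundary G ss h .
  interpret based_boundary_covers G ss \<delta> N\<^sub>0 N L rep enum k E h ..
  obtain c :: real where c: "\<And>n \<xi> \<eta>. \<xi> \<in> boundary \<Longrightarrow> \<eta> \<in> boundary \<Longrightarrow> \<xi> \<noteq> \<eta> \<Longrightarrow>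
      real n + c \<le> line_depth \<xi> \<eta> \<Longrightarrow> \<exists>x\<in>carrier G. wlen x = n \<and> \<xi> \<in> E x \<and> \<eta> \<in> E x"
    using E_lebesgue by metis
  define C where "C = nat \<lceil>8 * h\<rceil> + nat \<lceil>c\<rceil>"
  have C: "8 * h \<le> real C" "c \<le> real C"
    unfolding C_def by linarith+
  show ?thesis
  proof (intro exI[of _ C] conjI allI ballI impI)
    fix x \<xi> \<eta>
    assume "x \<in> carrier G" "\<xi> \<in> E x" "\<eta> \<in> E x" "\<xi> \<noteq> \<eta>"
    then have "real (wlen x) - 8 * h \<le> line_depth \<xi> \<eta>"
      by (rule E_depth)
    then show "wlen x \<le> line_depth \<xi> \<eta> + C"
      using C by linarith
  next
    fix n \<xi> \<eta>
    assume *: "\<xi> \<in> boundary" "\<eta> \<in> boundary" "\<xi> \<noteq> \<eta> \<and> n + C \<le> line_depth \<xi> \<eta>"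
    then have "real n + c \<le> line_depth \<xi> \<eta>"
      using C by linarith
    then show "\<exists>x\<in>carrier G. wlen x = n \<and> \<xi> \<in> E x \<and> \<eta> \<in> E x"
      using c * by blast
  qed
qed

lemma boundary_accumulation:
  fixes xs :: "nat \<Rightarrow> (nat \<Rightarrow> 'a) set"
  assumes "range xs \<subseteq> boundary"
  obtains \<xi> where "\<xi> \<in> boundary"
    "\<And>W. openin bdry_topology W \<Longrightarrow> \<xi> \<in> W \<Longrightarrow> \<exists>\<^sub>F j in sequentially. xs j \<in> W"
proof -
  obtain h where "based_boundary G ss h"
    using ex_based_boundary by blast
  then interpret based_boundary G ss h .
  have "xs n \<in> boundary" for n
    using assms by blast
  then obtain \<xi> s where \<xi>: "\<xi> \<in> boundary" "strict_mono (s :: nat \<Rightarrow> nat)"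
      "\<And>r. \<forall>\<^sub>F n in sequentially. xs (s n) \<in> bdry_nhd \<xi> r"
    using boundary_sequentially_compact[of xs] by metis
  have "\<exists>\<^sub>F j in sequentially. xs j \<in> W" if W: "openin bdry_topology W" "\<xi> \<in> W" for W
    unfolding frequently_sequentially
  proof
    fix m
    obtain r where r: "bdry_nhd \<xi> r \<subseteq> W"
      using W unfolding openin_bdry_topology by blast
    obtain n where "n \<ge> m" "xs (s n) \<in> bdry_nhd \<xi> r"
      using eventually_sequentially_obtain_ge[OF \<xi>(3)] by metis
    then show "\<exists>n\<ge>m. xs n \<in> W"
      using r seq_suble[OF \<xi>(2), of n] by (intro exI[of _ "s n"]) auto
  qed
  then show ?thesis
    using that \<xi>(1) by blast
qed

end

context boundary_markov_system
begin

lemma ex_star_refining: "\<exists>m\<ge>2. star_refining (\<lambda>i. level_cover E (i * \<l>)) boundary m"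
proof -
  \<comment> \<open>Finiteness, multiplicity and star refinement do not involve \<open>dv a\<close>,
    so a single parameter serves.\<close>
  obtain a where adm: "admissible bdry_topology (dv a) (\<lambda>n. level_cover E (n * \<l>))"
    using eventually_happens[OF step_admissible] by (auto simp: trivial_limit_at_right_real)
  then have "\<exists>m. \<forall>n. \<forall>F\<subseteq>level_cover E (n * \<l>). \<Inter>F \<noteq> {} \<longrightarrow> card F \<le> m"
    unfolding admissible_def by (elim conjE)
  then obtain m where m: "\<And>n F. F \<subseteq> level_cover E (n * \<l>) \<Longrightarrow> \<Inter>F \<noteq> {} \<Longrightarrow> card F \<le> m"
    by metis
  \<comment> \<open>The added 2 makes 1 - 1/m positive, so that a threshold for \<open>a\<close> can
    be defined through its reciprocal.\<close>
  have "star_refining (\<lambda>i. level_cover E (i * \<l>)) boundary (m + 2)"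
  proof
    fix n
    show "finite (level_cover E (n * \<l>))" "\<Union>(level_cover E (n * \<l>)) = boundary"
      using adm by (auto simp: admissible_def topspace_bdry_topology)
    show "V \<noteq> {}" if "V \<in> level_cover E (n * \<l>)" for V
      using that by (simp add: level_cover_def)
    show "card F \<le> m + 2" if "F \<subseteq> level_cover E (n * \<l>)" "\<Inter>F \<noteq> {}" for F
      using m[OF that] by simp
    show "\<exists>V\<in>level_cover E (n * \<l>). \<Union>{W' \<in> level_cover E (Suc n * \<l>). W' \<inter> W \<noteq> {}} \<subseteq> V"
      if "W \<in> level_cover E (Suc n * \<l>)" for W
    proof -
      have "\<forall>n>0. \<forall>U\<in>level_cover E (n * \<l>). \<exists>V\<in>level_cover E ((n - 1) * \<l>).
          \<Union>{U' \<in> level_cover E (n * \<l>). U' \<inter> U \<noteq> {}} \<subseteq> V"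
        using adm by (simp add: admissible_def)
      from this[rule_format, of "Suc n", OF _ that] show ?thesis
        by simp
    qed
  qed simp
  then show ?thesis
    by (intro exI[of _ "m + 2"]) simp
qed

abbreviation cover :: "nat \<Rightarrow> (nat \<Rightarrow> 'a) set set set"
  where "cover i \<equiv> level_cover E (i * \<l>)"

abbreviation pull_metric :: "real \<Rightarrow> (nat \<Rightarrow> 'a) set \<Rightarrow> (nat \<Rightarrow> 'a) set \<Rightarrow> real"
  where "pull_metric b \<xi> \<eta> \<equiv> simplicial_metric cover b (canonical_map cover \<xi>) (canonical_map cover \<eta>)"

text \<open>\<open>a\<^sub>0\<close> is limited by the range in which \<open>dv a\<close> is a
  visual metric and by the value at which contraction and weights balance. The constants
  \<open>m\<close> and \<open>C\<close> do not leave this proof.\<close>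

lemma small_parameters:
  obtains a\<^sub>0 where "a\<^sub>0 > 1"
    "\<And>a. 1 < a \<Longrightarrow> a < a\<^sub>0 \<Longrightarrow> visual_metric a (dv a)"
    "\<And>b. 1 < b \<Longrightarrow> Metric_space (inverse_limit cover) (simplicial_metric cover b)"
    "canonical_map cover ` boundary = inverse_limit cover"
    "\<And>a. 1 < a \<Longrightarrow> a < a\<^sub>0 \<Longrightarrow> \<exists>K\<ge>1. \<forall>\<xi>\<in>boundary. \<forall>\<eta>\<in>boundary.
      visual_qmetric a \<xi> \<eta> / K \<le> pull_metric (a ^ \<l>) \<xi> \<eta> \<and>
      pull_metric (a ^ \<l>) \<xi> \<eta> \<le> K * visual_qmetric a \<xi> \<eta>"
proof -
  obtain m where m: "m \<ge> 2" and "star_refining cover boundary m"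
    using ex_star_refining by blast
  then interpret star_refining cover boundary m by simp
  obtain C :: nat where C:
    "(\<forall>x\<in>carrier G. \<forall>\<xi>\<in>E x. \<forall>\<eta>\<in>E x. \<xi> \<noteq> \<eta> \<longrightarrow> wlen x \<le> line_depth \<xi> \<eta> + C) \<and>
    (\<forall>n. \<forall>\<xi>\<in>boundary. \<forall>\<eta>\<in>boundary. \<xi> \<noteq> \<eta> \<and> n + C \<le> line_depth \<xi> \<eta> \<longrightarrow>
      (\<exists>x\<in>carrier G. wlen x = n \<and> \<xi> \<in> E x \<and> \<eta> \<in> E x))"
    using depth_comparison ..
  obtain a\<^sub>1 where a\<^sub>1: "a\<^sub>1 > 1" "\<And>a. 1 < a \<Longrightarrow> a < a\<^sub>1 \<Longrightarrow> visual_metric a (dv a)"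
    using visual unfolding eventually_at_right_field by blast
  define \<mu> where "\<mu> = 1 - 1 / real m"
  have \<mu>: "0 < \<mu>" "\<mu> < 1"
    using m by (auto simp: \<mu>_def)
  \<comment> \<open>The solution of \<open>\<mu> * a ^ \<l> = 1\<close>.\<close>
  define a\<^sub>2 where "a\<^sub>2 = root \<l> (1 / \<mu>)"
  have a\<^sub>2: "1 < a\<^sub>2" "a\<^sub>2 ^ \<l> = 1 / \<mu>"
    using \<mu> step_pos by (auto simp: a\<^sub>2_def)
  have small: "\<mu> * a ^ \<l> < 1" if "1 < a" "a < a\<^sub>2" for a
  proof -
    have "a ^ \<l> < a\<^sub>2 ^ \<l>"
      using that step_pos by (intro power_strict_mono) auto
    then show ?thesis
      using \<mu> by (simp add: a\<^sub>2 field_simps)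
  qed
  have surj: "canonical_map cover ` boundary = inverse_limit cover"
  proof
    show "canonical_map cover ` boundary \<subseteq> inverse_limit cover"
      using canonical_map(1) by blast
    show "inverse_limit cover \<subseteq> canonical_map cover ` boundary"
    proof
      fix p assume "p \<in> inverse_limit cover"
      then show "p \<in> canonical_map cover ` boundary"
      proof (rule canonical_map_surj)
        fix xs :: "nat \<Rightarrow> (nat \<Rightarrow> 'a) set"
        assume "range xs \<subseteq> boundary"
        then obtain \<xi> where \<xi>: "\<xi> \<in> boundary"
            "\<And>W. openin bdry_topology W \<Longrightarrow> \<xi> \<in> W \<Longrightarrow> \<exists>\<^sub>F j in sequentially. xs j \<in> W"
          using boundary_accumulation by blast
        moreover have "openin bdry_topology W" if "W \<in> cover n" for W n
          using that E_open by (auto simp: level_cover_def)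
        ultimately show "\<exists>x\<in>boundary. \<forall>n. \<forall>W\<in>cover n. x \<in> W \<longrightarrow> (\<exists>\<^sub>F j in sequentially. xs j \<in> W)"
          by blast
      qed
    qed
  qed
  have comparison: "\<exists>K\<ge>1. \<forall>\<xi>\<in>boundary. \<forall>\<eta>\<in>boundary.
      visual_qmetric a \<xi> \<eta> / K \<le> pull_metric (a ^ \<l>) \<xi> \<eta> \<and>
      pull_metric (a ^ \<l>) \<xi> \<eta> \<le> K * visual_qmetric a \<xi> \<eta>"
    if a: "1 < a" "a < min a\<^sub>1 a\<^sub>2" for a
  proof -
    have small_a: "(1 - 1 / real m) * a ^ \<l> < 1"
      using small[of a] a by (simp add: \<mu>_def)
    have up: "i * \<l> \<le> line_depth \<xi> \<eta> + C" if V: "V \<in> cover i" "\<xi> \<in> V" "\<eta> \<in> V" "\<xi> \<noteq> \<eta>" for i V \<xi> \<eta>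
    proof -
      obtain x where "x \<in> carrier G" "wlen x = i * \<l>" "V = E x"
        using V(1) by (auto simp: level_cover_def)
      then show ?thesis
        using conjunct1[OF C, rule_format, of x \<xi> \<eta>] V by simp
    qed
    have low: "\<exists>V\<in>cover i. \<xi> \<in> V \<and> \<eta> \<in> V"
      if *: "\<xi> \<in> boundary" "\<eta> \<in> boundary" "\<xi> \<noteq> \<eta>" "i * \<l> + C \<le> line_depth \<xi> \<eta>" for i \<xi> \<eta>
    proof -
      obtain x where "x \<in> carrier G" "wlen x = i * \<l>" "\<xi> \<in> E x" "\<eta> \<in> E x"
        using conjunct2[OF C, rule_format, of \<xi> \<eta> "i * \<l>"] * by auto
      then show ?thesis
        by (intro bexI[of _ "E x"]) (auto simp: level_cover_def)
    qed
    have diag: "pull_metric (a ^ \<l>) \<xi> \<xi> = 0" for \<xi>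
      by (simp add: simplicial_metric_def simplex_dist_def)
    show ?thesis
    proof (rule simplicial_metric_comparison[where depth = line_depth and C = C, OF a(1) small_a step_pos])
      fix K :: real
      assume "K \<ge> 1" "\<And>\<xi> \<eta>. \<xi> \<in> boundary \<Longrightarrow> \<eta> \<in> boundary \<Longrightarrow> \<xi> \<noteq> \<eta> \<Longrightarrow>
        1 / a ^ line_depth \<xi> \<eta> / K \<le> pull_metric (a ^ \<l>) \<xi> \<eta> \<and>
        pull_metric (a ^ \<l>) \<xi> \<eta> \<le> K * (1 / a ^ line_depth \<xi> \<eta>)"
      then show ?thesis
        using diag by (intro exI[of _ K]) (auto simp: visual_qmetric_def)
    qed (use up low in auto)
  qed
  show ?thesis
    using that[of "min a\<^sub>1 a\<^sub>2"] a\<^sub>1 a\<^sub>2(1) surj comparison Metric_space_simplicial by auto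
qed

text \<open>Injectivity is a consequence of the lower bound: distinct points have positive
  \<open>visual_qmetric\<close>, hence positive simplicial distance.\<close>

lemma canonical_map_bilipschitz:
  assumes a: "1 < a" and vis: "visual_metric a (dv a)"
    and metric: "Metric_space (inverse_limit cover) (simplicial_metric cover (a ^ \<l>))"
    and surj: "canonical_map cover ` boundary = inverse_limit cover"
    and K: "K \<ge> 1" "\<forall>\<xi>\<in>boundary. \<forall>\<eta>\<in>boundary.
      visual_qmetric a \<xi> \<eta> / K \<le> pull_metric (a ^ \<l>) \<xi> \<eta> \<and>
      pull_metric (a ^ \<l>) \<xi> \<eta> \<le> K * visual_qmetric a \<xi> \<eta>"
  shows "bilipschitz boundary (dv a) (inverse_limit cover) (simplicial_metric cover (a ^ \<l>)) (canonical_map cover)"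
proof -
  interpret M: Metric_space "inverse_limit cover" "simplicial_metric cover (a ^ \<l>)"
    by (rule metric)
  obtain B where B: "B \<ge> 1" "\<And>\<xi> \<eta>. \<xi> \<in> boundary \<Longrightarrow> \<eta> \<in> boundary \<Longrightarrow>
      visual_qmetric a \<xi> \<eta> / B \<le> dv a \<xi> \<eta> \<and> dv a \<xi> \<eta> \<le> B * visual_qmetric a \<xi> \<eta>"
    using vis unfolding visual_metric_def bilipschitz_def by auto
  have "inj_on (canonical_map cover) boundary"
  proof (rule inj_onI, rule ccontr)
    fix \<xi> \<eta>
    assume *: "\<xi> \<in> boundary" "\<eta> \<in> boundary" "canonical_map cover \<xi> = canonical_map cover \<eta>" "\<xi> \<noteq> \<eta>"
    moreover from this have "canonical_map cover \<eta> \<in> inverse_limit cover"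
      using surj by blast
    ultimately have "pull_metric (a ^ \<l>) \<xi> \<eta> = 0"
      by simp
    moreover have "0 < visual_qmetric a \<xi> \<eta> / K"
      using a K * by (simp add: visual_qmetric_def)
    ultimately show False
      using K * by fastforce
  qed
  then have "bij_betw (canonical_map cover) boundary (inverse_limit cover)"
    using surj by (simp add: bij_betw_def)
  moreover have "dv a \<xi> \<eta> / (B * K) \<le> pull_metric (a ^ \<l>) \<xi> \<eta> \<and>
      pull_metric (a ^ \<l>) \<xi> \<eta> \<le> B * K * dv a \<xi> \<eta>"
    if *: "\<xi> \<in> boundary" "\<eta> \<in> boundary" for \<xi> \<eta>
  proof
    note q = B(2)[OF *] K(2)[rule_format, OF *]
    have "dv a \<xi> \<eta> / (B * K) \<le> visual_qmetric a \<xi> \<eta> / K"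
      using q(1) B(1) K(1) by (simp add: field_simps)
    then show "dv a \<xi> \<eta> / (B * K) \<le> pull_metric (a ^ \<l>) \<xi> \<eta>"
      using q(2) by linarith
    have "K * visual_qmetric a \<xi> \<eta> \<le> K * (B * dv a \<xi> \<eta>)"
      using q(1) B(1) K(1) by (intro mult_left_mono) (auto simp: field_simps)
    then show "pull_metric (a ^ \<l>) \<xi> \<eta> \<le> B * K * dv a \<xi> \<eta>"
      using q(2) by (simp add: mult_ac)
  qed
  moreover have "1 \<le> B * K"
    using B(1) K(1) mult_mono[of 1 B 1 K] by simp
  ultimately show ?thesis
    unfolding bilipschitz_def by blast
qed

text \<open>Quasi-metrics with parameters \<open>a\<close> and \<open>c\<close> are powers of each
  other with exponent \<open>ln c / ln a\<close>; on the diagonal this uses that 0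
  \<open>powr\<close> \<alpha> is 0.\<close>

lemma visual_quasiconformal:
  assumes a: "1 < a" and c: "1 < c" and vis: "visual_metric a (dv a)"
    and K: "K \<ge> 1" "\<forall>\<xi>\<in>boundary. \<forall>\<eta>\<in>boundary.
      visual_qmetric c \<xi> \<eta> / K \<le> d \<xi> \<eta> \<and> d \<xi> \<eta> \<le> K * visual_qmetric c \<xi> \<eta>"
  shows "same_quasiconformal boundary (dv a) d"
proof -
  obtain B where B: "B \<ge> 1" "\<And>\<xi> \<eta>. \<xi> \<in> boundary \<Longrightarrow> \<eta> \<in> boundary \<Longrightarrow>
      visual_qmetric a \<xi> \<eta> / B \<le> dv a \<xi> \<eta> \<and> dv a \<xi> \<eta> \<le> B * visual_qmetric a \<xi> \<eta>"
    using vis unfolding visual_metric_def bilipschitz_def by auto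
  define \<alpha> where "\<alpha> = ln c / ln a"
  have \<alpha>: "\<alpha> > 0"
    using a c by (simp add: \<alpha>_def)
  have q: "visual_qmetric a \<xi> \<eta> powr \<alpha> = visual_qmetric c \<xi> \<eta>" for \<xi> \<eta>
    using a c by (simp add: visual_qmetric_def powr_def \<alpha>_def ln_div ln_realpow exp_minus exp_of_nat2_mult inverse_eq_divide)
  have q_nonneg: "0 \<le> visual_qmetric a \<xi> \<eta>" for \<xi> \<eta>
    using a by (simp add: visual_qmetric_def)
  show ?thesis
    by (rule same_quasiconformal_powr[of B K \<alpha> _ "visual_qmetric a"])
      (use B K \<alpha> q_nonneg in \<open>auto simp: q\<close>)
qed

lemma canonical_map_quasiconformal:
  "\<exists>a\<^sub>0>1.
    (\<forall>a b. 1 < a \<and> a < a\<^sub>0 \<and> 1 < b \<and> b < a\<^sub>0 \<longrightarrow> same_quasiconformal boundary (dv a) (pull_metric b)) \<and>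
    (\<forall>a. 1 < a \<and> a < a\<^sub>0 \<longrightarrow>
      Metric_space (inverse_limit cover) (simplicial_metric cover a) \<and>
      bilipschitz boundary (dv a) (inverse_limit cover) (simplicial_metric cover (a ^ \<l>)) (canonical_map cover))"
proof -
  show ?thesis
  proof (rule small_parameters)
    fix a\<^sub>0 :: real
    assume a\<^sub>0: "a\<^sub>0 > 1"
      and vis: "\<And>a. 1 < a \<Longrightarrow> a < a\<^sub>0 \<Longrightarrow> visual_metric a (dv a)"
      and metric: "\<And>b. 1 < b \<Longrightarrow> Metric_space (inverse_limit cover) (simplicial_metric cover b)"
      and surj: "canonical_map cover ` boundary = inverse_limit cover"
      and comparison: "\<And>a. 1 < a \<Longrightarrow> a < a\<^sub>0 \<Longrightarrow> \<exists>K\<ge>1. \<forall>\<xi>\<in>boundary. \<forall>\<eta>\<in>boundary.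
        visual_qmetric a \<xi> \<eta> / K \<le> pull_metric (a ^ \<l>) \<xi> \<eta> \<and>
        pull_metric (a ^ \<l>) \<xi> \<eta> \<le> K * visual_qmetric a \<xi> \<eta>"
    have "same_quasiconformal boundary (dv a) (pull_metric b)"
      if a: "1 < a" "a < a\<^sub>0" and b: "1 < b" "b < a\<^sub>0" for a b
    proof -
      \<comment> \<open>The simplicial parameter \<open>b\<close> matches the visual parameter
        \<open>c\<close>, which stays below \<open>a\<^sub>0\<close> because 1 < c \<le> b.\<close>
      define c where "c = root \<l> b"
      have c: "1 < c" "c ^ \<l> = b"
        using b step_pos by (auto simp: c_def)
      then have "c < a\<^sub>0"
        using b self_le_power[of c \<l>] step_pos by simp
      then show ?thesis
        using comparison[of c] c visual_quasiconformal[OF a(1) c(1) vis[OF a]] by auto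
    qed
    moreover have "bilipschitz boundary (dv a) (inverse_limit cover) (simplicial_metric cover (a ^ \<l>)) (canonical_map cover)"
      if a: "1 < a" "a < a\<^sub>0" for a
      using comparison[OF a] canonical_map_bilipschitz[OF a(1) vis[OF a] metric surj] step_pos a by auto
    ultimately show ?thesis
      using a\<^sub>0 metric by blast
  qed
qed

end

theorem theorem0p2:
  fixes G :: "('g, 'm) monoid_scheme" and ss :: "'g list"
    and \<delta> :: real and N\<^sub>0 N L :: nat
    and rep :: "'g + ('g \<Rightarrow> int) \<Rightarrow> 'g" and enum :: "'g + ('g \<Rightarrow> int) \<Rightarrow> 'g list"
    and k :: int and E :: "'g \<Rightarrow> (nat \<Rightarrow> 'g) set set"
    and dv :: "real \<Rightarrow> (nat \<Rightarrow> 'g) set \<Rightarrow> (nat \<Rightarrow> 'g) set \<Rightarrow> real" and \<l> :: nat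
  assumes "boundary_markov_system G ss \<delta> N\<^sub>0 N L rep enum k E dv \<l>"
  shows "let X = generated_group.boundary G ss;
             \<U> = (\<lambda>i. generated_group.level_cover G ss E (i * \<l>));
             \<phi> = canonical_map \<U>;
             dM = simplicial_metric \<U>
         in \<exists>a\<^sub>0>1.
              (\<forall>a b. 1 < a \<and> a < a\<^sub>0 \<and> 1 < b \<and> b < a\<^sub>0 \<longrightarrow>
                 same_quasiconformal X (dv a) (\<lambda>x y. dM b (\<phi> x) (\<phi> y))) \<and>
              (\<forall>a. 1 < a \<and> a < a\<^sub>0 \<longrightarrow>
                 Metric_space (inverse_limit \<U>) (dM a) \<and>
                 bilipschitz X (dv a) (inverse_limit \<U>) (dM (a ^ \<l>)) \<phi>)"
  unfolding Let_def by (rule boundary_markov_system.canonical_map_quasiconformal[OF assms])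

end
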